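(* Let $G$ be a discrete countable group and let $S$ be an ergodic $G$-space that is amenable in the sense of Zimmer. Then there are a BQI probability measure $\nu$ on $S$ (in the given measure class) and a sequence $(\lambda_n)_{n\ge0}$ of uniformly BQI probability measures on $G\times\mathbb{N}$ such that for every non-principal ultrafilter $\mathcal{U}$ on the natural numbers there is an isomorphism of Radon–Nikodym factors $$(S,\nu)_{RN}\;\cong\;\big(\mathcal{U}\lim\,(G\times\mathbb{N},\lambda_n)\big)_{RN}.$$
   Context: A $G$-space is a Borel space with a measurable $G$-action and a fixed $G$-invariant measure class (the class of a probability measure). $G$ acts on $G\times\mathbb{N}$ by left translation on the first coordinate. Spaces are not assumed standard. Amenability: for a $G$-equivariant measurable map $\pi:Y\to X$ carrying the measure class of $Y$ to that of $X$, a $G$-equivariant conditional expectation is a linear map $E:L^\infty(Y)\to L^\infty(X)$ with $E(f\circ g)=E(f)\circ g$, $E(f)\ge0$ for $f\ge0$, $E(1)=1$, $E((h\circ\pi)f)=hE(f)$ for $h\in L^\infty(X)$. $S$ is amenable (in Zimmer's sense) if one exists for the projection $G\times S\to S$, where $G\times S$ has the product measure class and diagonal action. A quasi-invariant (QI) $G$-space is a probability space $(X,\Sigma,\nu)$ with a measurable $G$-action such that $g\nu$ and $\nu$ have the same null sets for every $g\in G$. The measure $\nu$ is BQI (bounded quasi-invariant) if there is $M:G\to[1,\infty)$ with $g\nu\le M(g)\nu$ for all $g$; a family of measures (on possibly different spaces) is uniformly BQI if one $M$ works for all of them. A factor $p:(X,\nu_X)\to(Y,\nu_Y)$ of QI $G$-spaces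 is a $G$-equivariant measurable map with $p_*\nu_X=\nu_Y$; it is measure preserving if $\frac{dg\nu_X}{d\nu_X}=\frac{dg\nu_Y}{d\nu_Y}\circ p$ for all $g$. The Radon–Nikodym factor $(X,\nu)_{RN}$ is the final object among the measure preserving factors of $(X,\nu)$ (concretely, a topological (standard) model of $(X,\Sigma_{RN},\nu)$ with $\Sigma_{RN}$ the $\sigma$-algebra generated by the functions $\frac{dg\nu}{d\nu}$, $g\in G$). Isomorphisms are $G$-equivariant, carry the measure to the measure, and are taken modulo null sets. Ultralimit: for an ultrafilter $\mathcal{U}$ on a set $\mathcal{I}$ and probability spaces $(X_i,\Sigma_i,\nu_i)$, $\mathcal{U}\lim(X_i,\nu_i)=(X,\Sigma,\nu)$ where $X=\prod_iX_i/\!\sim$ with $(x_i)\sim(y_i)$ iff $\{i:x_i=y_i\}\in\mathcal{U}$, $\Sigma$ is generated by the algebra of sets $\mathcal{U}\lim A_i=\{[x_i]:\{i:x_i\in A_i\}\in\mathcal{U}\}$ ($A_i\in\Sigma_i$), and $\nu$ is the unique probability measure with $\nu(\mathcal{U}\lim A_i)=\mathcal{U}\lim\nu_i(A_i)$. $G$ acts by $g[x_i]=[gx_i]$; for uniformly BQI measures the result is a QI $G$-space. *)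

theory Defs
  imports "HOL-Probability.Probability" "HOL-Algebra.Group_Action"
begin

section \<open>Quasi-invariant spaces\<close>

text \<open>
  \<open>G\<close> is a countable discrete group, so joint measurability of an action is measurability of
  each translation. The probability measure of \<open>X\<close> also serves as a representative
  when only its measure class matters. Actions are in the sense of \<^locale>\<open>group_action\<close>, hence
  extensional: \<open>act g\<close> is \<open>undefined\<close> off \<open>space X\<close>.
\<close>

definition qi_space ::
  "('g, 'm) monoid_scheme \<Rightarrow> 'x measure \<Rightarrow> ('g \<Rightarrow> 'x \<Rightarrow> 'x) \<Rightarrow> bool" where
  "qi_space G X act \<longleftrightarrow>
     prob_space X \<and>
     group_action G (space X) act \<and>
     (\<forall>g\<in>carrier G. act g \<in> X \<rightarrow>\<^sub>M X) \<and>
     (\<forall>g\<in>carrier G. null_sets (distr X X (act g)) = null_sets X)"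

definition ergodic_space ::
  "('g, 'm) monoid_scheme \<Rightarrow> 'x measure \<Rightarrow> ('g \<Rightarrow> 'x \<Rightarrow> 'x) \<Rightarrow> bool" where
  "ergodic_space G X act \<longleftrightarrow>
     (\<forall>A\<in>sets X. (\<forall>g\<in>carrier G. act g ` A = A) \<longrightarrow>
        A \<in> null_sets X \<or> space X - A \<in> null_sets X)"

definition bqi_bound ::
  "('g, 'm) monoid_scheme \<Rightarrow> ('g \<Rightarrow> real) \<Rightarrow> 'x measure \<Rightarrow> ('g \<Rightarrow> 'x \<Rightarrow> 'x) \<Rightarrow> bool" where
  "bqi_bound G b X act \<longleftrightarrow>
     (\<forall>g\<in>carrier G. 1 \<le> b g \<and>
        (\<forall>A\<in>sets X. emeasure (distr X X (act g)) A \<le> ennreal (b g) * emeasure X A))"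

definition BQI ::
  "('g, 'm) monoid_scheme \<Rightarrow> 'x measure \<Rightarrow> ('g \<Rightarrow> 'x \<Rightarrow> 'x) \<Rightarrow> bool" where
  "BQI G X act \<longleftrightarrow> qi_space G X act \<and> (\<exists>b. bqi_bound G b X act)"

definition uniformly_BQI ::
  "('g, 'm) monoid_scheme \<Rightarrow> ('i \<Rightarrow> 'x measure) \<Rightarrow> ('i \<Rightarrow> 'g \<Rightarrow> 'x \<Rightarrow> 'x) \<Rightarrow> bool" where
  "uniformly_BQI G X act \<longleftrightarrow>
     (\<forall>i. qi_space G (X i) (act i)) \<and> (\<exists>b. \<forall>i. bqi_bound G b (X i) (act i))"

definition transl_act ::
  "('g, 'm) monoid_scheme \<Rightarrow> 'g \<Rightarrow> 'g \<times> nat \<Rightarrow> 'g \<times> nat" where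
  "transl_act G g = (\<lambda>(h, n) \<in> carrier G \<times> UNIV. (g \<otimes>\<^bsub>G\<^esub> h, n))"

section \<open>Amenability\<close>

text \<open>
  Elements of \<open>L\<^sup>\<infinity>\<close> are represented by essentially bounded measurable functions; an operator on
  classes is an operator on representatives that respects almost everywhere equality.
\<close>

definition Linf :: "'x measure \<Rightarrow> ('x \<Rightarrow> real) set" where
  "Linf X = {f \<in> borel_measurable X. \<exists>C. AE x in X. \<bar>f x\<bar> \<le> C}"

definition equivariant_cond_exp ::
  "('g, 'm) monoid_scheme \<Rightarrow> 'y measure \<Rightarrow> ('g \<Rightarrow> 'y \<Rightarrow> 'y) \<Rightarrow>
   'x measure \<Rightarrow> ('g \<Rightarrow> 'x \<Rightarrow> 'x) \<Rightarrow> ('y \<Rightarrow> 'x) \<Rightarrow> (('y \<Rightarrow> real) \<Rightarrow> 'x \<Rightarrow> real) \<Rightarrow> bool" where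
  "equivariant_cond_exp G Y actY X actX \<pi> E \<longleftrightarrow>
     (\<forall>f\<in>Linf Y. E f \<in> Linf X) \<and>
     (\<forall>f\<in>Linf Y. \<forall>f'\<in>Linf Y. (AE y in Y. f y = f' y) \<longrightarrow> (AE x in X. E f x = E f' x)) \<and>
     (\<forall>f\<in>Linf Y. \<forall>f'\<in>Linf Y. AE x in X. E (\<lambda>y. f y + f' y) x = E f x + E f' x) \<and>
     (\<forall>c. \<forall>f\<in>Linf Y. AE x in X. E (\<lambda>y. c * f y) x = c * E f x) \<and>
     (\<forall>g\<in>carrier G. \<forall>f\<in>Linf Y. AE x in X. E (\<lambda>y. f (actY g y)) x = E f (actX g x)) \<and>
     (\<forall>f\<in>Linf Y. (AE y in Y. 0 \<le> f y) \<longrightarrow> (AE x in X. 0 \<le> E f x)) \<and>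
     (AE x in X. E (\<lambda>y. 1) x = 1) \<and>
     (\<forall>h\<in>Linf X. \<forall>f\<in>Linf Y. AE x in X. E (\<lambda>y. h (\<pi> y) * f y) x = h x * E f x)"

definition diag_act ::
  "('g, 'm) monoid_scheme \<Rightarrow> 'x measure \<Rightarrow> ('g \<Rightarrow> 'x \<Rightarrow> 'x) \<Rightarrow> 'g \<Rightarrow> 'g \<times> 'x \<Rightarrow> 'g \<times> 'x" where
  "diag_act G X act g = (\<lambda>(h, x) \<in> carrier G \<times> space X. (g \<otimes>\<^bsub>G\<^esub> h, act g x))"

definition Zimmer_amenable ::
  "('g, 'm) monoid_scheme \<Rightarrow> 'x measure \<Rightarrow> ('g \<Rightarrow> 'x \<Rightarrow> 'x) \<Rightarrow> bool" where
  "Zimmer_amenable G X act \<longleftrightarrow>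
     (\<exists>E. equivariant_cond_exp G
            (count_space (carrier G) \<Otimes>\<^sub>M X) (diag_act G X act) X act snd E)"

section \<open>Radon--Nikodym factors\<close>

definition rn_cocycle :: "'x measure \<Rightarrow> ('g \<Rightarrow> 'x \<Rightarrow> 'x) \<Rightarrow> 'g \<Rightarrow> 'x \<Rightarrow> ennreal" where
  "rn_cocycle X act g = RN_deriv X (distr X X (act g))"

definition qi_factor ::
  "('g, 'm) monoid_scheme \<Rightarrow> 'x measure \<Rightarrow> ('g \<Rightarrow> 'x \<Rightarrow> 'x) \<Rightarrow>
   'z measure \<Rightarrow> ('g \<Rightarrow> 'z \<Rightarrow> 'z) \<Rightarrow> ('x \<Rightarrow> 'z) \<Rightarrow> bool" where
  "qi_factor G X actX Z actZ p \<longleftrightarrow>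
     qi_space G X actX \<and> qi_space G Z actZ \<and>
     p \<in> X \<rightarrow>\<^sub>M Z \<and> distr X Z p = Z \<and>
     (\<forall>g\<in>carrier G. \<forall>x\<in>space X. p (actX g x) = actZ g (p x))"

definition measure_preserving_factor ::
  "('g, 'm) monoid_scheme \<Rightarrow> 'x measure \<Rightarrow> ('g \<Rightarrow> 'x \<Rightarrow> 'x) \<Rightarrow>
   'z measure \<Rightarrow> ('g \<Rightarrow> 'z \<Rightarrow> 'z) \<Rightarrow> ('x \<Rightarrow> 'z) \<Rightarrow> bool" where
  "measure_preserving_factor G X actX Z actZ p \<longleftrightarrow>
     qi_factor G X actX Z actZ p \<and>
     (\<forall>g\<in>carrier G. AE x in X. rn_cocycle X actX g x = rn_cocycle Z actZ g (p x))"

definition standard_borel :: "'z measure \<Rightarrow> bool" where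
  "standard_borel Z \<longleftrightarrow>
     (\<exists>T. completely_metrizable_space T \<and> second_countable T \<and>
          topspace T = space Z \<and> sets Z = sigma_sets (topspace T) {U. openin T U})"

definition rn_sigma ::
  "('g, 'm) monoid_scheme \<Rightarrow> 'x measure \<Rightarrow> ('g \<Rightarrow> 'x \<Rightarrow> 'x) \<Rightarrow> 'x set set" where
  "rn_sigma G X act =
     sigma_sets (space X) {rn_cocycle X act g -` B \<inter> space X | g B. g \<in> carrier G \<and> B \<in> sets borel}"

text \<open>
  The Radon--Nikodym factor is only determined up to isomorphism, so it is given as a predicate:
  \<open>Z\<close>, with factor map \<open>p\<close>, is a standard model of \<open>(X, rn_sigma G X actX)\<close>. Since
  Radon--Nikodym derivatives are defined almost everywhere, the
  \<open>\<sigma>\<close>-algebra pulled back along \<open>p\<close> is compared with \<open>rn_sigma\<close> modulo null sets.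
  Every standard Borel space is isomorphic to a Borel subset of \<^typ>\<open>nat \<Rightarrow> real\<close>, so models
  may be taken on that type.
\<close>

definition RN_factor ::
  "('g, 'm) monoid_scheme \<Rightarrow> 'x measure \<Rightarrow> ('g \<Rightarrow> 'x \<Rightarrow> 'x) \<Rightarrow>
   'z measure \<Rightarrow> ('g \<Rightarrow> 'z \<Rightarrow> 'z) \<Rightarrow> ('x \<Rightarrow> 'z) \<Rightarrow> bool" where
  "RN_factor G X actX Z actZ p \<longleftrightarrow>
     standard_borel Z \<and>
     measure_preserving_factor G X actX Z actZ p \<and>
     (\<forall>B\<in>sets Z. \<exists>A\<in>rn_sigma G X actX. AE x in X. p x \<in> B \<longleftrightarrow> x \<in> A) \<and>
     (\<forall>A\<in>rn_sigma G X actX. \<exists>B\<in>sets Z. AE x in X. p x \<in> B \<longleftrightarrow> x \<in> A)"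

definition qi_isomorphic ::
  "('g, 'm) monoid_scheme \<Rightarrow> 'z measure \<Rightarrow> ('g \<Rightarrow> 'z \<Rightarrow> 'z) \<Rightarrow>
   'w measure \<Rightarrow> ('g \<Rightarrow> 'w \<Rightarrow> 'w) \<Rightarrow> bool" where
  "qi_isomorphic G Z actZ W actW \<longleftrightarrow>
     (\<exists>f h. f \<in> Z \<rightarrow>\<^sub>M W \<and> h \<in> W \<rightarrow>\<^sub>M Z \<and>
        distr Z W f = W \<and> distr W Z h = Z \<and>
        (AE z in Z. h (f z) = z) \<and> (AE w in W. f (h w) = w) \<and>
        (\<forall>g\<in>carrier G. AE z in Z. f (actZ g z) = actW g (f z)))"

section \<open>Ultralimits\<close>

text \<open>Ultrafilters are maximal proper filters in the sense of \<^typ>\<open>'i filter\<close>, with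
  \<open>{i. P i} \<in> \<U>\<close> written \<^term>\<open>eventually P \<U>\<close>.\<close>

definition nonprincipal_ultrafilter :: "'i filter \<Rightarrow> bool" where
  "nonprincipal_ultrafilter \<U> \<longleftrightarrow>
     \<U> \<noteq> bot \<and>
     (\<forall>P. eventually P \<U> \<or> eventually (\<lambda>i. \<not> P i) \<U>) \<and>
     (\<forall>i. \<U> \<noteq> principal {i})"

definition ultra_rel :: "'i filter \<Rightarrow> ('i \<Rightarrow> 'x measure) \<Rightarrow> (('i \<Rightarrow> 'x) \<times> ('i \<Rightarrow> 'x)) set" where
  "ultra_rel \<U> X =
     {(x, y). (\<forall>i. x i \<in> space (X i)) \<and> (\<forall>i. y i \<in> space (X i)) \<and> eventually (\<lambda>i. x i = y i) \<U>}"

definition ultra_space :: "'i filter \<Rightarrow> ('i \<Rightarrow> 'x measure) \<Rightarrow> ('i \<Rightarrow> 'x) set set" where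
  "ultra_space \<U> X = {x. \<forall>i. x i \<in> space (X i)} // ultra_rel \<U> X"

definition ultra_set ::
  "'i filter \<Rightarrow> ('i \<Rightarrow> 'x measure) \<Rightarrow> ('i \<Rightarrow> 'x set) \<Rightarrow> ('i \<Rightarrow> 'x) set set" where
  "ultra_set \<U> X A =
     {ultra_rel \<U> X `` {x} | x. (\<forall>i. x i \<in> space (X i)) \<and> eventually (\<lambda>i. x i \<in> A i) \<U>}"

definition ultralimit :: "'i filter \<Rightarrow> ('i \<Rightarrow> 'x measure) \<Rightarrow> ('i \<Rightarrow> 'x) set measure" where
  "ultralimit \<U> X =
     extend_measure (ultra_space \<U> X) {A. \<forall>i. A i \<in> sets (X i)} (ultra_set \<U> X)
       (\<lambda>A. Lim \<U> (\<lambda>i. emeasure (X i) (A i)))"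

text \<open>The union below ranges over the representatives of a class and has a single value.\<close>

definition ultra_act ::
  "'i filter \<Rightarrow> ('i \<Rightarrow> 'x measure) \<Rightarrow> ('i \<Rightarrow> 'g \<Rightarrow> 'x \<Rightarrow> 'x) \<Rightarrow>
   'g \<Rightarrow> ('i \<Rightarrow> 'x) set \<Rightarrow> ('i \<Rightarrow> 'x) set" where
  "ultra_act \<U> X act g =
     (\<lambda>c \<in> ultra_space \<U> X. \<Union>x\<in>c. ultra_rel \<U> X `` {\<lambda>i. act i g (x i)})"

end

theory Submission
  imports Defs
begin

text \<open>
  Write \<open>\<rho>\<^sub>g\<close> for the Radon--Nikodym cocycle \<open>dg\<nu>/d\<nu>\<close> of a quasi-invariant space. Its
  Radon--Nikodym factor is determined by the joint law of the functions \<open>\<rho>\<^sub>g\<close>, \<open>g \<in> G\<close>: a standard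
  model is that law, transported by the logarithm to a closed set of sequences on which \<open>G\<close> acts by
  the cocycle identity (lemmas \<open>RN_factor_Zmod\<close> and \<open>rn_model_same_law\<close>). It therefore suffices to
  find \<open>\<nu>\<close> on \<open>S\<close> and uniformly BQI measures on \<open>G \<times> \<nat>\<close> whose cocycles converge in law to
  that of \<open>\<nu>\<close>, because the cocycle of an ultralimit is the ultralimit of the cocycles: integrals
  of ultralimits of uniformly bounded functions are ultralimits of integrals (\<open>hat_integral\<close>), which
  gives both the densities of the translates (\<open>translate_UL\<close>) and the law (\<open>law_UL\<close>). For this it is
  enough to know the cocycles on \<open>G \<times> \<nat>\<close> up to an error that vanishes in total variation.

  Bounded quasi-invariance comes from averaging. There is a probability \<open>m\<close> on \<open>G\<close> with full
  support and \<open>m(g\<^sup>-\<^sup>1h) \<le> M(g) m(h)\<close> (\<open>ex_weight\<close>), and then \<open>m * \<lambda> = \<Sum>\<^sub>k m(k) k\<lambda>\<close> has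
  bound \<open>M\<close> for every probability measure \<open>\<lambda>\<close> on every \<open>G\<close>-space. Take \<open>X = m * S\<close> and
  \<open>\<nu> = m * X\<close>.

  Amenability provides measurable maps \<open>\<phi>\<close> from \<open>S\<close> to the probability measures on finite subsets
  of \<open>G\<close> that are almost equivariant in mean: \<open>\<integral> \<Sum>\<^sub>h |\<phi>(ks)(kh) - \<phi>(s)(h)| dX(s)\<close> is small for
  finitely many \<open>k\<close> (theorem \<open>reiter\<close>). Otherwise these integrals are bounded below, and the
  gradient, at an almost minimal point, of a smoothed \<open>L\<^sup>1\<close> norm yields bounded functions
  \<open>f\<^sub>k\<close> separating \<open>0\<close> from all such defects, first for \<open>\<phi>\<close> supported in a given finite set
  (\<open>separation\<close>) and then, by a weak-star limit over larger and larger sets (\<open>weak_star_limit\<close>),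
  for all \<open>\<phi>\<close>. Choosing \<open>\<phi>\<close> to be a Dirac mass at a minimising point, one finds, with the
  cocycle \<open>\<rho>\<close> of \<open>X\<close>, that
  \<open>\<Sum>\<^sub>k (\<rho>\<^sub>k(s) f\<^sub>k(k\<^sup>-\<^sup>1h, k\<^sup>-\<^sup>1s) - f\<^sub>k(h, s))\<close> is bounded below, uniformly in \<open>h\<close>, by a
  function of \<open>s\<close> with positive integral. An equivariant conditional expectation keeps the lower
  bound, but sends this sum to a function of integral zero (\<open>no_uniform_drift\<close>).

  Finally the measure \<open>\<phi>(s)(h) dX(s)\<close> on \<open>G \<times> S\<close> is averaged by \<open>m\<close>. Almost
  equivariance says that the result is close in total variation to \<open>\<phi>(s)(h) d\<nu>(s)\<close>, and
  likewise for its translates, so that its cocycle is close to that of \<open>\<nu>\<close>. The map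
  \<open>(h, s) \<mapsto> (h, h\<^sup>-\<^sup>1s)\<close> turns the diagonal action on \<open>G \<times> S\<close> into translation of the first
  coordinate; hence the second coordinate can be replaced by a code in \<open>\<nat>\<close> that remembers the
  finitely many values of the cocycle in question up to a small error (\<open>ex_approximant\<close>).
\<close>

section \<open>Measurable group actions\<close>

text \<open>A measure dominated by a multiple of a probability measure has a density that satisfies the
  corresponding bound everywhere, not only almost everywhere.\<close>

lemma (in prob_space) bounded_density:
  assumes sN: "sets N = sets M" and c: "0 \<le> c"
    and bound: "\<And>A. A \<in> sets M \<Longrightarrow> emeasure N A \<le> ennreal c * emeasure M A"
  shows "\<exists>f\<in>borel_measurable M. (\<forall>x. 0 \<le> f x \<and> f x \<le> c) \<and> density M (\<lambda>x. ennreal (f x)) = N"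
proof -
  have "absolutely_continuous M N"
    unfolding absolutely_continuous_def
  proof
    fix A assume "A \<in> null_sets M"
    then show "A \<in> null_sets N" using bound[of A] sN by (auto simp: null_sets_def)
  qed
  from Radon_Nikodym[OF this sN] obtain f
    where f[measurable]: "f \<in> borel_measurable M" and D: "density M f = N" by auto
  let ?A = "{x\<in>space M. ennreal c < f x}"
  have fin: "(\<integral>\<^sup>+x. ennreal c * indicator ?A x \<partial>M) \<noteq> \<infinity>"
    by (simp add: nn_integral_cmult_indicator emeasure_eq_measure ennreal_mult_eq_top_iff)
  have le: "emeasure N ?A \<le> (\<integral>\<^sup>+x. ennreal c * indicator ?A x \<partial>M)"
    using bound[of ?A] by (simp add: nn_integral_cmult_indicator)
  have "(\<integral>\<^sup>+x. (f x * indicator ?A x - ennreal c * indicator ?A x) \<partial>M) =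
     (\<integral>\<^sup>+x. f x * indicator ?A x \<partial>M) - (\<integral>\<^sup>+x. ennreal c * indicator ?A x \<partial>M)"
    using fin by (intro nn_integral_diff) (auto simp: indicator_def)
  also have "(\<integral>\<^sup>+x. f x * indicator ?A x \<partial>M) = emeasure N ?A"
    unfolding D[symmetric] by (rule emeasure_density[symmetric]) auto
  also have "\<dots> - (\<integral>\<^sup>+x. ennreal c * indicator ?A x \<partial>M) = 0"
    using le fin le_less_trans[OF le] by (simp add: diff_eq_0_iff_ennreal less_top)
  finally have "AE x in M. f x * indicator ?A x - ennreal c * indicator ?A x = 0"
    by (subst (asm) nn_integral_0_iff_AE) auto
  with AE_space have "AE x in M. f x \<le> ennreal c"
  proof eventually_elim
    fix x assume x: "x \<in> space M" "f x * indicator ?A x - ennreal c * indicator ?A x = 0"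
    show "f x \<le> ennreal c"
    proof (rule ccontr)
      assume "\<not> f x \<le> ennreal c"
      with x show False by (simp add: not_le diff_eq_0_iff_ennreal)
    qed
  qed
  then have "AE x in M. ennreal (min c (enn2real (f x))) = f x"
  proof eventually_elim
    fix x assume x: "f x \<le> ennreal c"
    then have "f x < \<infinity>" using le_less_trans ennreal_less_top infinity_ennreal_def by metis
    then obtain r where "f x = ennreal r" "0 \<le> r" by (cases "f x") auto
    then show "ennreal (min c (enn2real (f x))) = f x" using x c by simp
  qed
  then have "density M (\<lambda>x. ennreal (min c (enn2real (f x)))) = N"
    unfolding D[symmetric] by (intro density_cong) auto
  then show ?thesis using c by (intro bexI[of _ "\<lambda>x. min c (enn2real (f x))"]) auto
qed

lemma group_actionI:
  assumes "group G"
    and cl: "\<And>g x. g \<in> carrier G \<Longrightarrow> x \<in> E \<Longrightarrow> f g x \<in> E"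
    and one: "\<And>x. x \<in> E \<Longrightarrow> f \<one>\<^bsub>G\<^esub> x = x"
    and mult: "\<And>g h x. g \<in> carrier G \<Longrightarrow> h \<in> carrier G \<Longrightarrow> x \<in> E \<Longrightarrow> f (g \<otimes>\<^bsub>G\<^esub> h) x = f g (f h x)"
    and ext: "\<And>g. g \<in> carrier G \<Longrightarrow> f g \<in> extensional E"
  shows "group_action G E f"
proof -
  interpret group G by fact
  have inv: "f (inv\<^bsub>G\<^esub> g) (f g x) = x" "f g (f (inv\<^bsub>G\<^esub> g) x) = x"
    if "g \<in> carrier G" "x \<in> E" for g x
    using that mult[of "inv\<^bsub>G\<^esub> g" g x] mult[of g "inv\<^bsub>G\<^esub> g" x] one by auto
  have bij: "f g \<in> Bij E" if g: "g \<in> carrier G" for g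
  proof -
    have "bij_betw (f g) E E"
      by (rule bij_betwI[of _ _ _ "f (inv\<^bsub>G\<^esub> g)"]) (use g inv cl in auto)
    with ext[OF g] show ?thesis by (simp add: Bij_def)
  qed
  have "f (g \<otimes>\<^bsub>G\<^esub> h) = compose E (f g) (f h)" if "g \<in> carrier G" "h \<in> carrier G" for g h
  proof (rule extensionalityI[of _ E])
    show "f (g \<otimes>\<^bsub>G\<^esub> h) \<in> extensional E" using that ext by simp
  qed (use that mult in \<open>auto simp: compose_def\<close>)
  then have "f \<in> hom G (BijGroup E)"
    using bij by (auto simp: hom_def BijGroup_def)
  then show ?thesis
    using group_BijGroup by (simp add: group_action_def group_hom_def group_hom_axioms_def \<open>group G\<close>)
qed

text \<open>A measurable action on a probability space; the measure need not be quasi-invariant.\<close>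

locale measurable_action = group G for G (structure) +
  fixes X :: "'x measure" and act :: "'a \<Rightarrow> 'x \<Rightarrow> 'x"
  assumes prob: "prob_space X"
    and ga: "group_action G (space X) act"
    and act_measurable: "\<And>g. g \<in> carrier G \<Longrightarrow> act g \<in> X \<rightarrow>\<^sub>M X"
begin

lemma act_space: "g \<in> carrier G \<Longrightarrow> x \<in> space X \<Longrightarrow> act g x \<in> space X"
  using group_action.element_image[OF ga] by blast

lemma act_one: "x \<in> space X \<Longrightarrow> act \<one> x = x"
  using group_action.id_eq_one[OF ga] by (metis restrict_apply')

lemma act_mult: "g \<in> carrier G \<Longrightarrow> h \<in> carrier G \<Longrightarrow> x \<in> space X \<Longrightarrow> act (g \<otimes> h) x = act g (act h x)"
  using group_action.composition_rule[OF ga] by blast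

lemma act_inv:
  "g \<in> carrier G \<Longrightarrow> x \<in> space X \<Longrightarrow> act (inv g) (act g x) = x"
  "g \<in> carrier G \<Longrightarrow> x \<in> space X \<Longrightarrow> act g (act (inv g) x) = x"
  using act_mult[of "inv g" g x] act_mult[of g "inv g" x] act_one by auto

lemma act_vimage_sets: "g \<in> carrier G \<Longrightarrow> A \<in> sets X \<Longrightarrow> act g -` A \<inter> space X \<in> sets X"
  using act_measurable by (rule measurable_sets)

lemma act_vimage_mult:
  assumes "g \<in> carrier G" "h \<in> carrier G"
  shows "act h -` (act g -` A \<inter> space X) \<inter> space X = act (g \<otimes> h) -` A \<inter> space X"
  using assms by (auto simp: act_mult act_space)

lemma act_vimage_inv:
  assumes "g \<in> carrier G" "A \<subseteq> space X"
  shows "act (inv g) -` (act g -` A \<inter> space X) \<inter> space X = A"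
  using act_vimage_mult[OF assms(1) inv_closed[OF assms(1)], of A] assms by (auto simp: act_one)

lemma emeasure_translate:
  "g \<in> carrier G \<Longrightarrow> A \<in> sets X \<Longrightarrow>
    emeasure (distr X X (act g)) A = emeasure X (act g -` A \<inter> space X)"
  by (simp add: emeasure_distr act_measurable)

text \<open>A bound for all translates yields quasi-invariance, since it applies to \<open>g\<close> and to its inverse.\<close>

lemma qi_of_bound:
  assumes b: "\<And>g A. g \<in> carrier G \<Longrightarrow> A \<in> sets X \<Longrightarrow>
      emeasure (distr X X (act g)) A \<le> ennreal (b g) * emeasure X A"
  shows "qi_space G X act"
proof -
  have 1: "act g -` A \<inter> space X \<in> null_sets X" if "g \<in> carrier G" "A \<in> null_sets X" for g A
    using b[of g A] that act_vimage_sets[of g A] emeasure_translate[of g A]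
    by (auto simp: null_sets_def)
  have "null_sets (distr X X (act g)) = null_sets X" if g: "g \<in> carrier G" for g
  proof (intro equalityI subsetI)
    fix A assume "A \<in> null_sets (distr X X (act g))"
    then have A: "A \<in> sets X" "act g -` A \<inter> space X \<in> null_sets X"
      using g emeasure_translate[of g A] act_vimage_sets[of g A] by (auto simp: null_sets_def)
    from 1[OF inv_closed[OF g] A(2)] show "A \<in> null_sets X"
      using act_vimage_inv[OF g sets.sets_into_space[OF A(1)]] by simp
  next
    fix A assume "A \<in> null_sets X"
    with 1[OF g this] show "A \<in> null_sets (distr X X (act g))"
      using emeasure_translate[OF g, of A] by (auto simp: null_sets_def)
  qed
  then show ?thesis
    by (auto simp: qi_space_def prob ga act_measurable)
qed

end

lemma qi_space_measurable_action:
  "group G \<Longrightarrow> qi_space G X act \<Longrightarrow> measurable_action G X act"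
  by (simp add: qi_space_def measurable_action_def measurable_action_axioms_def)

section \<open>Ultrafilters on the natural numbers\<close>

text \<open>A nonprincipal ultrafilter on the natural numbers.\<close>

locale nat_ultrafilter =
  fixes U :: "nat filter"
  assumes npu: "nonprincipal_ultrafilter U"
begin

lemma not_bot: "U \<noteq> bot"
  using npu by (simp add: nonprincipal_ultrafilter_def)

lemma ultra_cases: "eventually P U \<or> eventually (\<lambda>i. \<not> P i) U"
  using npu by (simp add: nonprincipal_ultrafilter_def)

lemma eventually_not_iff: "eventually (\<lambda>i. \<not> P i) U \<longleftrightarrow> \<not> eventually P U"
  using ultra_cases[of P] eventually_conj[of P U "\<lambda>i. \<not> P i"] not_bot
  by (auto simp: trivial_limit_def)

lemma eventually_disj_iff: "eventually (\<lambda>i. P i \<or> Q i) U \<longleftrightarrow> eventually P U \<or> eventually Q U"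
  using eventually_not_iff[of "\<lambda>i. P i \<or> Q i"] eventually_not_iff[of P] eventually_not_iff[of Q]
  by (auto simp: eventually_conj_iff)

lemma le_sequentially: "U \<le> sequentially"
  unfolding Filter.le_sequentially
proof
  fix n
  have ne: "eventually (\<lambda>i. i \<noteq> j) U" for j
  proof (rule ccontr)
    assume "\<not> eventually (\<lambda>i. i \<noteq> j) U"
    then have j: "eventually (\<lambda>i. i = j) U"
      using eventually_not_iff[of "\<lambda>i. i \<noteq> j"] by simp
    have "eventually P U \<longleftrightarrow> P j" for P
    proof
      assume "eventually P U"
      from eventually_conj[OF this j] have "\<exists>i. P i \<and> i = j"
        using not_bot eventually_happens by blast
      then show "P j" by simp
    next
      assume "P j"
      then show "eventually P U" using j by (auto elim: eventually_mono)
    qed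
    then have "U = principal {j}"
      by (auto simp: filter_eq_iff eventually_principal)
    then show False using npu by (simp add: nonprincipal_ultrafilter_def)
  qed
  have "eventually (\<lambda>i. \<forall>j\<in>{..<n}. i \<noteq> j) U"
    by (intro eventually_ball_finite) (auto intro: ne)
  then show "eventually (\<lambda>i. n \<le> i) U"
    by (rule eventually_mono) (metis lessThan_iff not_le)
qed

lemma eventually_ge: "eventually (\<lambda>i. n \<le> i) U"
  using le_sequentially unfolding Filter.le_sequentially by blast

lemma tendsto_ultra: "x \<longlonglongrightarrow> l \<Longrightarrow> (x \<longlongrightarrow> l) U"
  using le_sequentially by (rule tendsto_mono)

lemma ultra_convergent:
  fixes x :: "nat \<Rightarrow> real"
  assumes "\<And>i. a \<le> x i" "\<And>i. x i \<le> b"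
  obtains l where "a \<le> l" "l \<le> b" "(x \<longlongrightarrow> l) U"
proof -
  let ?F = "filtermap x U"
  have "eventually (\<lambda>y. y \<in> {a..b}) ?F" "?F \<noteq> bot"
    using assms not_bot by (auto simp: eventually_filtermap filtermap_bot_iff)
  then obtain l where l: "l \<in> {a..b}" "inf (nhds l) ?F \<noteq> bot"
    using compact_Icc[of a b] unfolding compact_filter le_principal by blast
  have "(x \<longlongrightarrow> l) U"
  proof (rule topological_tendstoI)
    fix S assume S: "open S" "l \<in> S"
    have "\<not> eventually (\<lambda>i. x i \<notin> S) U"
    proof
      assume "eventually (\<lambda>i. x i \<notin> S) U"
      then have "eventually (\<lambda>y. y \<notin> S) ?F" by (simp add: eventually_filtermap)
      moreover have "eventually (\<lambda>y. y \<in> S) (nhds l)" using S by (rule eventually_nhds_in_open)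
      ultimately have "eventually (\<lambda>y. False) (inf (nhds l) ?F)"
        unfolding eventually_inf by blast
      with l show False by (simp add: trivial_limit_def)
    qed
    then show "eventually (\<lambda>i. x i \<in> S) U" using eventually_not_iff by blast
  qed
  then show thesis using that l by auto
qed

lemma tendsto_Lim_ultra:
  fixes x :: "nat \<Rightarrow> real"
  assumes "\<And>i. a \<le> x i" "\<And>i. x i \<le> b"
  shows "(x \<longlongrightarrow> Lim U x) U" "a \<le> Lim U x" "Lim U x \<le> b"
proof -
  obtain l where l: "a \<le> l" "l \<le> b" "(x \<longlongrightarrow> l) U" using ultra_convergent[of a x b] assms by metis
  with tendsto_Lim[OF not_bot l(3)]
  show "(x \<longlongrightarrow> Lim U x) U" "a \<le> Lim U x" "Lim U x \<le> b" by auto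
qed

end

lemma ex_nat_ultrafilter: "\<exists>U. nat_ultrafilter U"
proof -
  let ?A = "{F :: nat filter. F \<noteq> bot \<and> F \<le> sequentially}"
  let ?P = "\<lambda>F G :: nat filter. G \<le> F"
  have "\<exists>m\<in>?A. \<forall>a\<in>?A. ?P m a \<longrightarrow> a = m"
  proof (rule predicate_Zorn)
    show "partial_order_on ?A (relation_of ?P ?A)"
      by (rule partial_order_on_relation_ofI) auto
    fix C assume C: "C \<in> Chains (relation_of ?P ?A)"
    show "\<exists>u\<in>?A. \<forall>a\<in>C. ?P a u"
    proof (cases "C = {}")
      case True
      have "sequentially \<in> ?A" by simp
      with True show ?thesis by blast
    next
      case False
      have CA: "C \<subseteq> ?A" and tot: "\<And>F G. F \<in> C \<Longrightarrow> G \<in> C \<Longrightarrow> F \<le> G \<or> G \<le> F"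
        using C by (auto simp: Chains_def relation_of_def)
      have ev: "eventually P (Inf C) \<longleftrightarrow> (\<exists>b\<in>C. eventually P b)" for P
        using False by (rule eventually_Inf_base) (use tot in \<open>metis inf.absorb1 inf.absorb2 order_refl\<close>)
      have "Inf C \<noteq> bot"
        using ev[of "\<lambda>_. False"] CA by (auto simp: trivial_limit_def)
      moreover have "Inf C \<le> sequentially"
        using False CA by (metis (mono_tags, lifting) Inf_lower2 all_not_in_conv mem_Collect_eq subset_iff)
      ultimately show ?thesis by (intro bexI[of _ "Inf C"]) (auto intro: Inf_lower)
    qed
  qed
  then obtain U where U: "U \<noteq> bot" "U \<le> sequentially"
    and max: "\<And>F. F \<noteq> bot \<Longrightarrow> F \<le> sequentially \<Longrightarrow> F \<le> U \<Longrightarrow> F = U" by auto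
  have "eventually P U \<or> eventually (\<lambda>i. \<not> P i) U" for P
  proof (rule disjCI)
    assume n: "\<not> eventually (\<lambda>i. \<not> P i) U"
    let ?F = "inf U (principal {i. P i})"
    have "?F \<noteq> bot"
      using n by (simp add: trivial_limit_def eventually_inf_principal)
    then have "?F = U" by (intro max) (auto intro: U(2) le_infI1)
    moreover have "eventually P ?F" by (simp add: eventually_inf_principal)
    ultimately show "eventually P U" by simp
  qed
  moreover have "U \<noteq> principal {i}" for i
  proof
    assume "U = principal {i}"
    moreover have "eventually (\<lambda>n. Suc i \<le> n) U"
      using U(2) unfolding le_sequentially by blast
    ultimately show False by (simp add: eventually_principal)
  qed
  ultimately show ?thesis
    using U(1) by (auto simp: nat_ultrafilter_def nonprincipal_ultrafilter_def)
qed

section \<open>Weak-star limits of bounded functions\<close>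

context nat_ultrafilter begin

text \<open>The unit ball of \<open>L\<^sup>\<infinity>\<close> is weak-star compact: the ultralimit of the integrals over a set is an
  absolutely continuous set function, and its density is the limit.\<close>
lemma weak_star_limit:
  fixes X :: "'x measure" and f :: "nat \<Rightarrow> 'x \<Rightarrow> real"
  assumes X: "prob_space X"
    and f[measurable]: "\<And>n. f n \<in> borel_measurable X"
    and bd: "\<And>n x. \<bar>f n x\<bar> \<le> 1"
  shows "\<exists>g\<in>borel_measurable X. (\<forall>x. \<bar>g x\<bar> \<le> 1) \<and>
    (\<forall>A\<in>sets X. ((\<lambda>n. \<integral>x. indicator A x * f n x \<partial>X) \<longlongrightarrow> (\<integral>x. indicator A x * g x \<partial>X)) U)"
proof -
  interpret prob_space X by fact
  have int_f: "integrable X (\<lambda>x. indicator A x * f n x)" if "A \<in> sets X" for A n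
    using that bd by (intro integrable_const_bound[where B=1]) (auto simp: indicator_def)
  have int_A: "integrable X (\<lambda>x. indicator A x :: real)" if "A \<in> sets X" for A
    using that by (intro integrable_const_bound[where B=1]) (auto simp: indicator_def)
  \<comment> \<open>the shift by 1 makes the set functions nonnegative\<close>
  define I where "I = (\<lambda>n A. \<integral>x. indicator A x * (1 + f n x) \<partial>X)"
  have I_eq: "I n A = measure X A + (\<integral>x. indicator A x * f n x \<partial>X)" if "A \<in> sets X" for n A
    using that int_f[OF that, of n] int_A[OF that] by (simp add: I_def distrib_left)
  have I0: "0 \<le> I n A" for n A
    unfolding I_def
  proof (intro integral_nonneg_AE AE_I2)
    fix x show "0 \<le> indicator A x * (1 + f n x)"
      using bd[of n x] by (auto simp: indicator_def abs_le_iff)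
  qed
  have I2: "I n A \<le> 2 * measure X A" if A: "A \<in> sets X" for n A
  proof -
    have "(\<integral>x. indicator A x * f n x \<partial>X) \<le> (\<integral>x. indicator A x \<partial>X)"
      using int_f[OF A] int_A[OF A] bd[of n]
      by (intro integral_mono) (auto simp: indicator_def abs_le_iff)
    with I_eq[OF A, of n] A show ?thesis by simp
  qed
  define N where "N = (\<lambda>A. Lim U (\<lambda>n. I n A))"
  have N: "((\<lambda>n. I n A) \<longlongrightarrow> N A) U" "0 \<le> N A" "N A \<le> 2 * measure X A" if "A \<in> sets X" for A
    using tendsto_Lim_ultra[of 0 "\<lambda>n. I n A" "2 * measure X A"] I0 I2[OF that] by (auto simp: N_def)
  have N_add: "N (A \<union> B) = N A + N B" if "A \<in> sets X" "B \<in> sets X" "A \<inter> B = {}" for A B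
  proof -
    have "I n (A \<union> B) = I n A + I n B" for n
    proof -
      have "(\<integral>x. indicator (A \<union> B) x * f n x \<partial>X) =
        (\<integral>x. indicator A x * f n x + indicator B x * f n x \<partial>X)"
        using that(3) by (intro Bochner_Integration.integral_cong) (auto simp: indicator_def)
      then show ?thesis
        using that int_f by (simp add: I_eq finite_measure_Union)
    qed
    then have "((\<lambda>n. I n (A \<union> B)) \<longlongrightarrow> N A + N B) U"
      using tendsto_add[OF N(1)[OF that(1)] N(1)[OF that(2)]] by simp
    then show ?thesis
      using N(1)[of "A \<union> B"] that tendsto_unique[OF not_bot] by blast
  qed
  define c where "c = (\<lambda>A. ennreal (N A))"
  have pos: "positive (sets X) c"
    using N(2,3)[of "{}"] by (auto simp: positive_def c_def)
  have add: "additive (sets X) c"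
    using N_add N(2) by (auto simp: additive_def c_def)
  have ca: "countably_additive (sets X) c"
  proof (rule sets.empty_continuous_imp_countably_additive[OF pos add])
    fix A :: "nat \<Rightarrow> 'x set" assume A: "range A \<subseteq> sets X" "decseq A" "(\<Inter>i. A i) = {}"
    have "(\<lambda>i. 2 * measure X (A i)) \<longlonglongrightarrow> 2 * measure X (\<Inter>i. A i)"
      by (intro tendsto_intros finite_Lim_measure_decseq A)
    then have "(\<lambda>i. 2 * measure X (A i)) \<longlonglongrightarrow> 0" using A by simp
    moreover have "\<forall>i. 0 \<le> N (A i)" "\<forall>i. N (A i) \<le> 2 * measure X (A i)"
      using A(1) N(2,3) by (auto simp: image_subset_iff)
    ultimately have "(\<lambda>i. N (A i)) \<longlonglongrightarrow> 0"
      using tendsto_sandwich[OF always_eventually always_eventually tendsto_const,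
          of 0 "\<lambda>i. N (A i)" "\<lambda>i. 2 * measure X (A i)" sequentially] by simp
    then show "(\<lambda>i. c (A i)) \<longlonglongrightarrow> 0"
      unfolding c_def using tendsto_ennrealI by fastforce
  qed (auto simp: c_def)
  define M where "M = measure_of (space X) (sets X) c"
  have sM[simp]: "sets M = sets X" by (simp add: M_def)
  have eM: "emeasure M A = ennreal (N A)" if "A \<in> sets X" for A
    using emeasure_measure_of_sigma[OF sets.sigma_algebra_axioms pos ca that] by (simp add: M_def c_def)
  have "\<exists>h\<in>borel_measurable X. (\<forall>x. 0 \<le> h x \<and> h x \<le> 2) \<and> density X (\<lambda>x. ennreal (h x)) = M"
  proof (rule bounded_density)
    fix A assume A: "A \<in> sets X"
    have "emeasure M A \<le> ennreal (2 * measure X A)" unfolding eM[OF A] by (intro ennreal_leI N(3) A)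
    then show "emeasure M A \<le> ennreal 2 * emeasure X A" by (simp add: emeasure_eq_measure ennreal_mult)
  qed simp_all
  then obtain h where h[measurable]: "h \<in> borel_measurable X" and hb: "\<And>x. 0 \<le> h x" "\<And>x. h x \<le> 2"
    and hM: "density X (\<lambda>x. ennreal (h x)) = M" by auto
  have h_eq: "(\<integral>\<^sup>+x. ennreal (h x) * indicator A x \<partial>X) = ennreal (N A)" if "A \<in> sets X" for A
    using eM[OF that] that by (simp add: hM[symmetric] emeasure_density)
  define g where "g = (\<lambda>x. h x - 1)"
  have g[measurable]: "g \<in> borel_measurable X" by (simp add: g_def)
  have gb: "\<bar>g x\<bar> \<le> 1" for x using hb[of x] by (simp add: g_def abs_le_iff)
  have "((\<lambda>n. \<integral>x. indicator A x * f n x \<partial>X) \<longlongrightarrow> (\<integral>x. indicator A x * g x \<partial>X)) U" if A: "A \<in> sets X" for A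
  proof -
    have ig: "integrable X (\<lambda>x. indicator A x * g x)"
      using A gb by (intro integrable_const_bound[where B=1]) (auto simp: indicator_def)
    have "ennreal (N A) = (\<integral>\<^sup>+x. ennreal (indicator A x * (1 + g x)) \<partial>X)"
      unfolding h_eq[OF A, symmetric]
      by (rule nn_integral_cong) (auto simp: g_def indicator_def)
    also have "\<dots> = ennreal (\<integral>x. indicator A x * (1 + g x) \<partial>X)"
    proof (rule nn_integral_eq_integral)
      show "integrable X (\<lambda>x. indicator A x * (1 + g x))"
        using ig int_A[OF A] by (simp add: distrib_left)
      have "0 \<le> 1 + g x" for x using gb[of x] by (simp add: abs_le_iff)
      then show "AE x in X. 0 \<le> indicator A x * (1 + g x)" by simp
    qed
    also have "(\<integral>x. indicator A x * (1 + g x) \<partial>X) = measure X A + (\<integral>x. indicator A x * g x \<partial>X)"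
      using ig int_A[OF A] A by (simp add: distrib_left)
    finally have "N A = measure X A + (\<integral>x. indicator A x * g x \<partial>X)"
    proof (subst (asm) ennreal_inj)
      have "- (\<integral>x. indicator A x * g x \<partial>X) \<le> (\<integral>x. indicator A x \<partial>X)"
        unfolding integral_minus[symmetric] using ig int_A[OF A] gb
        by (intro integral_mono) (auto simp: indicator_def abs_le_iff)
      then show "0 \<le> measure X A + (\<integral>x. indicator A x * g x \<partial>X)" using A by simp
    qed (use N(2)[OF A] in auto)
    with tendsto_diff[OF N(1)[OF A] tendsto_const[of "measure X A"]]
    show ?thesis by (simp add: I_eq[OF A])
  qed
  with g gb show ?thesis by blast
qed

end

section \<open>Loeb measures\<close>

text \<open>The ultralimit of a sequence of probability spaces.\<close>
locale loeb = nat_ultrafilter U for U :: "nat filter" +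
  fixes X :: "nat \<Rightarrow> 'x measure"
  assumes prob: "\<And>i. prob_space (X i)"
begin

text \<open>The sequences of points, whose classes under \<open>cls\<close> are the points of the ultralimit.\<close>

definition pts :: "(nat \<Rightarrow> 'x) set" where
  "pts = {x. \<forall>i. x i \<in> space (X i)}"

definition cls :: "(nat \<Rightarrow> 'x) \<Rightarrow> (nat \<Rightarrow> 'x) set" where
  "cls x = ultra_rel U X `` {x}"

abbreviation (input) fam :: "(nat \<Rightarrow> 'x set) set" where
  "fam \<equiv> {A. \<forall>i. A i \<in> sets (X i)}"

text \<open>A representative of a class.\<close>

definition rep :: "(nat \<Rightarrow> 'x) set \<Rightarrow> nat \<Rightarrow> 'x" where
  "rep c = (SOME x. x \<in> c)"

lemma equiv_rel: "equiv pts (ultra_rel U X)"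
proof (rule equivI)
  show "ultra_rel U X \<subseteq> pts \<times> pts" by (auto simp: ultra_rel_def pts_def)
  show "refl_on pts (ultra_rel U X)" by (auto simp: refl_on_def ultra_rel_def pts_def)
  show "sym (ultra_rel U X)"
    by (auto simp: sym_def ultra_rel_def elim: eventually_mono)
  show "trans (ultra_rel U X)"
    by (rule transI) (auto simp: ultra_rel_def elim: eventually_elim2)
qed

lemma cls_eq_iff: "x \<in> pts \<Longrightarrow> y \<in> pts \<Longrightarrow> cls x = cls y \<longleftrightarrow> eventually (\<lambda>i. x i = y i) U"
  unfolding cls_def using eq_equiv_class_iff[OF equiv_rel, of x y]
  by (auto simp: ultra_rel_def pts_def)

lemma ultra_space_eq: "ultra_space U X = cls ` pts"
  by (auto simp: ultra_space_def pts_def cls_def quotient_def)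

lemma ultra_set_eq: "ultra_set U X A = cls ` {x\<in>pts. eventually (\<lambda>i. x i \<in> A i) U}"
  by (auto simp: ultra_set_def pts_def cls_def)

lemma cls_in_ultra_set_iff: "x \<in> pts \<Longrightarrow> cls x \<in> ultra_set U X A \<longleftrightarrow> eventually (\<lambda>i. x i \<in> A i) U"
proof -
  assume x: "x \<in> pts"
  have "eventually (\<lambda>i. x i \<in> A i) U" if "y \<in> pts" "cls x = cls y" "eventually (\<lambda>i. y i \<in> A i) U" for y
  proof -
    have "eventually (\<lambda>i. x i = y i) U" using x that by (simp add: cls_eq_iff)
    with that(3) show ?thesis by eventually_elim simp
  qed
  then show "cls x \<in> ultra_set U X A \<longleftrightarrow> eventually (\<lambda>i. x i \<in> A i) U"
    using x by (auto simp: ultra_set_eq)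
qed

lemma mem_cls_iff: "x \<in> pts \<Longrightarrow> y \<in> cls x \<longleftrightarrow> y \<in> pts \<and> eventually (\<lambda>i. x i = y i) U"
  by (auto simp: cls_def ultra_rel_def pts_def)

lemma rep_cls: "x \<in> pts \<Longrightarrow> rep (cls x) \<in> pts \<and> eventually (\<lambda>i. x i = rep (cls x) i) U"
proof -
  assume x: "x \<in> pts"
  then have "x \<in> cls x" by (simp add: mem_cls_iff)
  then have "rep (cls x) \<in> cls x" unfolding rep_def by (rule someI[of "\<lambda>y. y \<in> cls x"])
  with x show ?thesis by (simp add: mem_cls_iff)
qed

lemma pts_nonempty: "\<exists>x. x \<in> pts"
proof -
  have "\<forall>i. \<exists>x. x \<in> space (X i)" using prob_space.not_empty[OF prob] by blast
  then obtain x where "\<forall>i. x i \<in> space (X i)" by (rule choice[THEN exE])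
  then show ?thesis by (auto simp: pts_def)
qed

lemma ultra_set_subset: "ultra_set U X A \<subseteq> ultra_space U X"
  by (auto simp: ultra_set_eq ultra_space_eq)

lemma ultra_set_mono_iff:
  assumes "\<And>i. A i \<subseteq> space (X i)"
  shows "ultra_set U X A \<subseteq> ultra_set U X B \<longleftrightarrow> eventually (\<lambda>i. A i \<subseteq> B i) U"
proof
  assume le: "ultra_set U X A \<subseteq> ultra_set U X B"
  obtain z where z: "z \<in> pts" using pts_nonempty by blast
  define x where "x = (\<lambda>i. if \<exists>y. y \<in> A i - B i then SOME y. y \<in> A i - B i else z i)"
  have xi: "x i \<in> A i - B i" if "\<not> A i \<subseteq> B i" for i
  proof -
    have "\<exists>y. y \<in> A i - B i" using that by blast
    from someI_ex[OF this] have "(SOME y. y \<in> A i - B i) \<in> A i - B i" .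
    then show ?thesis using \<open>\<exists>y. y \<in> A i - B i\<close> by (simp only: x_def if_True)
  qed
  have x: "x \<in> pts"
  proof (unfold pts_def, safe)
    fix i show "x i \<in> space (X i)"
    proof (cases "A i \<subseteq> B i")
      case True
      then have "x i = z i" by (auto simp: x_def)
      then show ?thesis using z by (simp add: pts_def)
    next
      case False
      then show ?thesis using xi[of i] assms[of i] by blast
    qed
  qed
  show "eventually (\<lambda>i. A i \<subseteq> B i) U"
  proof (rule ccontr)
    assume "\<not> ?thesis"
    then have n: "eventually (\<lambda>i. \<not> A i \<subseteq> B i) U" by (simp add: eventually_not_iff)
    then have "eventually (\<lambda>i. x i \<in> A i) U" "eventually (\<lambda>i. \<not> x i \<in> B i) U"
      using xi by (auto elim!: eventually_mono)
    then show False
      using le cls_in_ultra_set_iff[OF x] eventually_not_iff[of "\<lambda>i. x i \<in> B i"] by blast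
  qed
next
  assume ev: "eventually (\<lambda>i. A i \<subseteq> B i) U"
  have "eventually (\<lambda>i. x i \<in> B i) U" if "eventually (\<lambda>i. x i \<in> A i) U" for x
    using ev that by eventually_elim blast
  then show "ultra_set U X A \<subseteq> ultra_set U X B"
    unfolding ultra_set_eq by blast
qed

lemma ultra_set_Int: "ultra_set U X A \<inter> ultra_set U X B = ultra_set U X (\<lambda>i. A i \<inter> B i)"
  using ultra_set_subset[of A] ultra_set_subset[of "\<lambda>i. A i \<inter> B i"]
  by (auto simp: ultra_space_eq cls_in_ultra_set_iff eventually_conj_iff)

lemma ultra_set_Un: "ultra_set U X A \<union> ultra_set U X B = ultra_set U X (\<lambda>i. A i \<union> B i)"
  using ultra_set_subset[of A] ultra_set_subset[of B] ultra_set_subset[of "\<lambda>i. A i \<union> B i"]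
  by (auto simp: ultra_space_eq cls_in_ultra_set_iff eventually_disj_iff)

lemma ultra_set_Diff: "ultra_set U X A - ultra_set U X B = ultra_set U X (\<lambda>i. A i - B i)"
  using ultra_set_subset[of A] ultra_set_subset[of "\<lambda>i. A i - B i"]
  by (auto simp: ultra_space_eq cls_in_ultra_set_iff eventually_conj_iff eventually_not_iff)

lemma ultra_set_empty: "ultra_set U X (\<lambda>i. {}) = {}"
  using not_bot by (auto simp: ultra_set_eq trivial_limit_def)

lemma ultra_set_space: "ultra_set U X (\<lambda>i. space (X i)) = ultra_space U X"
  by (auto simp: ultra_set_eq ultra_space_eq pts_def)

text \<open>Countable saturation: internal sets with nonempty finite intersections have a common point. This
  makes the limit measure continuous at the empty set, hence countably additive.\<close>

lemma ultra_saturation: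
  fixes A :: "nat \<Rightarrow> nat \<Rightarrow> 'x set"
  assumes A: "\<And>k i. A k i \<subseteq> space (X i)"
    and ne: "\<And>k. (\<Inter>j\<le>k. ultra_set U X (A j)) \<noteq> {}"
  shows "(\<Inter>k. ultra_set U X (A k)) \<noteq> {}"
proof -
  define B where "B k i = (\<Inter>j\<le>k. A j i)" for k i
  have B_eq: "ultra_set U X (B k) = (\<Inter>j\<le>k. ultra_set U X (A j))" for k
  proof (induction k)
    case 0 show ?case by (simp add: B_def [abs_def])
  next
    case (Suc k)
    have "B (Suc k) = (\<lambda>i. B k i \<inter> A (Suc k) i)"
      by (auto simp: B_def atMost_Suc fun_eq_iff)
    then show ?case using Suc by (auto simp: ultra_set_Int[symmetric] atMost_Suc)
  qed
  have Bne: "eventually (\<lambda>i. B k i \<noteq> {}) U" for k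
  proof (rule ccontr)
    assume "\<not> ?thesis"
    then have "eventually (\<lambda>i. B k i = {}) U" using eventually_not_iff by blast
    then have "ultra_set U X (B k) = {}"
      using ultra_set_mono_iff[of "B k" "\<lambda>_. {}"] A by (auto simp: B_def ultra_set_empty)
    with ne[of k] B_eq show False by simp
  qed
  have Bdec: "B l i \<subseteq> B k i" if "k \<le> l" for k l i
    using that by (force simp: B_def)
  \<comment> \<open>the \<open>i\<close>-th coordinate of the common point is taken in the longest possible initial segment of \<open>A 0, \<dots>, A i\<close>\<close>
  define m where "m i = Max {k. k \<le> i \<and> (k = 0 \<or> B k i \<noteq> {})}" for i
  obtain z where z: "z \<in> pts" using pts_nonempty by blast
  define x where "x = (\<lambda>i. if B (m i) i = {} then z i else SOME y. y \<in> B (m i) i)"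
  have fin: "finite {k. k \<le> i \<and> (k = 0 \<or> B k i \<noteq> {})}" for i
    by (rule finite_subset[of _ "{..i}"]) auto
  have xi: "x i \<in> B (m i) i" if "B (m i) i \<noteq> {}" for i
    using that by (auto simp: x_def intro: someI_ex)
  have Bsp: "B k i \<subseteq> space (X i)" for k i using A by (force simp: B_def)
  have x: "x \<in> pts"
  proof (unfold pts_def, safe)
    fix i show "x i \<in> space (X i)"
    proof (cases "B (m i) i = {}")
      case True
      then show ?thesis using z by (simp add: x_def pts_def)
    next
      case False
      then show ?thesis using xi[of i] Bsp[of "m i" i] by blast
    qed
  qed
  have "eventually (\<lambda>i. x i \<in> A k i) U" for k
    using Bne[of k] eventually_ge[of k]
  proof eventually_elim
    case (elim i)
    have km: "k \<le> m i" unfolding m_def by (rule Max_ge[OF fin]) (use elim in auto)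
    have mi: "m i \<in> {k. k \<le> i \<and> (k = 0 \<or> B k i \<noteq> {})}" unfolding m_def by (rule Max_in[OF fin]) auto
    have "B (m i) i \<noteq> {}"
    proof (cases "m i = 0")
      case True
      with km elim show ?thesis by auto
    next
      case False
      with mi show ?thesis by auto
    qed
    from xi[OF this] Bdec[OF km] have "x i \<in> B k i" by blast
    then show ?case by (auto simp: B_def)
  qed
  then have "cls x \<in> (\<Inter>k. ultra_set U X (A k))" using x by (simp add: cls_in_ultra_set_iff)
  then show ?thesis by blast
qed

lemma tendsto_measure:
  "((\<lambda>i. measure (X i) (A i)) \<longlongrightarrow> Lim U (\<lambda>i. measure (X i) (A i))) U"
  "0 \<le> Lim U (\<lambda>i. measure (X i) (A i))"
  using tendsto_Lim_ultra[of 0 "\<lambda>i. measure (X i) (A i)" 1] prob_space.prob_le_1[OF prob] by auto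

lemma Lim_emeasure:
  "Lim U (\<lambda>i. emeasure (X i) (A i)) = ennreal (Lim U (\<lambda>i. measure (X i) (A i)))"
proof (rule tendsto_Lim[OF not_bot])
  have eq: "emeasure (X i) (A i) = ennreal (measure (X i) (A i))" for i
    using prob[of i] prob_space.axioms(1) finite_measure.emeasure_eq_measure by blast
  show "((\<lambda>i. emeasure (X i) (A i)) \<longlongrightarrow> ennreal (Lim U (\<lambda>i. measure (X i) (A i)))) U"
    unfolding eq by (rule tendsto_ennrealI[OF tendsto_measure(1)])
qed

text \<open>The ultralimit as a measure space.\<close>

definition UL :: "(nat \<Rightarrow> 'x) set measure" where "UL = ultralimit U X"

lemma space_UL: "space UL = cls ` pts"
  unfolding UL_def ultralimit_def
  by (subst space_extend_measure) (use ultra_set_subset ultra_space_eq in auto)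

lemma sets_UL: "sets UL = sigma_sets (cls ` pts) (ultra_set U X ` fam)"
  unfolding UL_def ultralimit_def
  by (subst sets_extend_measure) (use ultra_set_subset in \<open>auto simp: ultra_space_eq\<close>)

lemma ultra_set_in_sets: "(\<And>i. A i \<in> sets (X i)) \<Longrightarrow> ultra_set U X A \<in> sets UL"
  by (auto simp: sets_UL)

text \<open>The limit of the measures extends from internal sets to the generated \<open>\<sigma>\<close>-algebra by the
  theorem of Caratheodory.\<close>

lemma emeasure_UL:
  assumes A: "\<And>i. A i \<in> sets (X i)"
  shows "emeasure UL (ultra_set U X A) = ennreal (Lim U (\<lambda>i. measure (X i) (A i)))"
proof -
  let ?M = "ultra_set U X ` fam"
  \<comment> \<open>an internal set determines its sequence only up to equality at \<open>U\<close>-almost all indices\<close>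
  define D where "D S = (SOME A. A \<in> fam \<and> S = ultra_set U X A)" for S
  have D: "D S \<in> fam \<and> S = ultra_set U X (D S)" if "S \<in> ?M" for S
  proof -
    have "\<exists>A. A \<in> fam \<and> S = ultra_set U X A" using that by blast
    then show ?thesis unfolding D_def by (rule someI_ex)
  qed
  define c where "c S = ennreal (Lim U (\<lambda>i. measure (X i) (D S i)))" for S
  have sub: "A i \<subseteq> space (X i)" if "A \<in> fam" for A i
    using that sets.sets_into_space by blast
  have c: "c (ultra_set U X A) = ennreal (Lim U (\<lambda>i. measure (X i) (A i)))" if A: "A \<in> fam" for A
  proof -
    let ?S = "ultra_set U X A"
    have d: "D ?S \<in> fam" "?S = ultra_set U X (D ?S)" using D[of ?S] A by auto
    have "eventually (\<lambda>i. A i \<subseteq> D ?S i) U" "eventually (\<lambda>i. D ?S i \<subseteq> A i) U"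
      using ultra_set_mono_iff[of A "D ?S"] ultra_set_mono_iff[of "D ?S" A] sub[OF A] sub[OF d(1)] d(2)
      by auto
    then have ev: "eventually (\<lambda>i. measure (X i) (A i) = measure (X i) (D ?S i)) U"
      by eventually_elim (metis subset_antisym)
    have "((\<lambda>i. measure (X i) (D ?S i)) \<longlongrightarrow> Lim U (\<lambda>i. measure (X i) (A i))) U"
      by (rule Lim_transform_eventually[OF tendsto_measure(1) ev])
    then show ?thesis unfolding c_def by (simp add: tendsto_Lim[OF not_bot])
  qed
  interpret algebra "cls ` pts" ?M
  proof (unfold algebra_iff_Un, intro conjI ballI)
    show "?M \<subseteq> Pow (cls ` pts)" using ultra_set_subset by (auto simp: ultra_space_eq)
    show "{} \<in> ?M" by (rule image_eqI[of _ _ "\<lambda>i. {}"]) (auto simp: ultra_set_empty)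
    fix a assume "a \<in> ?M"
    then obtain A where A: "A \<in> fam" "a = ultra_set U X A" by auto
    show "cls ` pts - a \<in> ?M"
      unfolding A ultra_space_eq[symmetric] ultra_set_space[symmetric] ultra_set_Diff
      using A by auto
    fix b assume "b \<in> ?M"
    then obtain B where B: "B \<in> fam" "b = ultra_set U X B" by auto
    show "a \<union> b \<in> ?M"
      unfolding A B ultra_set_Un using A(1) B(1) by auto
  qed
  have pos: "positive ?M c"
    using c[of "\<lambda>i. {}"] tendsto_Lim[OF not_bot tendsto_const[of "0::real"]]
    by (simp add: positive_def ultra_set_empty)
  have add: "additive ?M c"
  proof (unfold additive_def, intro ballI impI)
    fix a b assume "a \<in> ?M" "b \<in> ?M" and ab: "a \<inter> b = {}"
    then obtain A B where A: "A \<in> fam" "a = ultra_set U X A" and B: "B \<in> fam" "b = ultra_set U X B" by auto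
    have "eventually (\<lambda>i. A i \<inter> B i \<subseteq> {}) U"
      using ab unfolding A B ultra_set_Int
      by (subst ultra_set_mono_iff[symmetric]) (use sub[OF A(1)] in \<open>auto simp: ultra_set_empty\<close>)
    then have ev: "eventually (\<lambda>i. measure (X i) (A i) + measure (X i) (B i) = measure (X i) (A i \<union> B i)) U"
    proof eventually_elim
      case (elim i)
      interpret prob_space "X i" by (rule prob)
      show ?case using A(1) B(1) elim by (subst finite_measure_Union) auto
    qed
    have "((\<lambda>i. measure (X i) (A i \<union> B i)) \<longlongrightarrow>
       Lim U (\<lambda>i. measure (X i) (A i)) + Lim U (\<lambda>i. measure (X i) (B i))) U"
      by (rule Lim_transform_eventually[OF tendsto_add[OF tendsto_measure(1) tendsto_measure(1)] ev])
    then have "Lim U (\<lambda>i. measure (X i) (A i \<union> B i)) =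
       Lim U (\<lambda>i. measure (X i) (A i)) + Lim U (\<lambda>i. measure (X i) (B i))"
      by (rule tendsto_Lim[OF not_bot])
    then show "c (a \<union> b) = c a + c b"
      unfolding A B ultra_set_Un using A(1) B(1) by (simp add: c tendsto_measure(2))
  qed
  have cont: "(\<lambda>k. c (S k)) \<longlonglongrightarrow> 0"
    if S: "range S \<subseteq> ?M" "decseq S" "(\<Inter>k. S k) = {}" for S :: "nat \<Rightarrow> (nat \<Rightarrow> 'x) set set"
  proof -
    have d: "D (S k) \<in> fam" "S k = ultra_set U X (D (S k))" for k using D[of "S k"] S(1) by auto
    have "\<exists>k. (\<Inter>j\<le>k. ultra_set U X (D (S j))) = {}"
      using ultra_saturation[of "\<lambda>k. D (S k)"] sub[OF d(1)] S(3) d(2) by auto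
    then obtain k where k: "(\<Inter>j\<le>k. S j) = {}" using d(2) by auto
    have "S l = {}" if "k \<le> l" for l
    proof -
      have "S l \<subseteq> (\<Inter>j\<le>k. S j)" using decseqD[OF S(2)] that by (meson INF_greatest atMost_iff order_trans)
      then show ?thesis using k by auto
    qed
    then have "eventually (\<lambda>l. c (S l) = 0) sequentially"
      using pos by (auto simp: positive_def eventually_sequentially intro!: exI[of _ k])
    then show ?thesis by (rule tendsto_eventually)
  qed
  have "\<exists>\<mu> :: (nat \<Rightarrow> 'x) set set \<Rightarrow> ennreal.
      (\<forall>s\<in>?M. \<mu> s = c s) \<and> measure_space (cls ` pts) (sigma_sets (cls ` pts) ?M) \<mu>"
    by (rule caratheodory_empty_continuous[OF pos add _ cont]) (simp_all add: c_def)
  then obtain \<mu> :: "(nat \<Rightarrow> 'x) set set \<Rightarrow> ennreal"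
    where mu: "\<forall>s\<in>?M. \<mu> s = c s" "measure_space (cls ` pts) (sigma_sets (cls ` pts) ?M) \<mu>"
    by (elim exE conjE)
  have "emeasure UL (ultra_set U X A) = Lim U (\<lambda>i. emeasure (X i) (A i))"
  proof (rule emeasure_extend_measure[OF UL_def[unfolded ultralimit_def]])
    fix A assume "A \<in> fam"
    then show "\<mu> (ultra_set U X A) = Lim U (\<lambda>i. emeasure (X i) (A i))"
      using mu(1) c unfolding Lim_emeasure by auto
  qed (use mu(2) ultra_set_subset A in \<open>auto simp: measure_space_def sets_UL\<close>)
  then show ?thesis by (simp add: Lim_emeasure)
qed

lemma prob_UL: "prob_space UL"
proof
  have "emeasure UL (ultra_set U X (\<lambda>i. space (X i))) = ennreal (Lim U (\<lambda>i. measure (X i) (space (X i))))"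
    by (rule emeasure_UL) auto
  then show "emeasure UL (space UL) = 1"
    unfolding ultra_set_space
    by (simp add: space_UL ultra_space_eq prob_space.prob_space[OF prob] tendsto_Lim[OF not_bot])
qed

lemma measure_UL:
  assumes A: "\<And>i. A i \<in> sets (X i)"
  shows "((\<lambda>i. measure (X i) (A i)) \<longlongrightarrow> measure UL (ultra_set U X A)) U"
  using tendsto_measure(1)[of A] tendsto_measure(2)[of A] emeasure_UL[OF A] by (simp add: measure_def)

lemma UL_measure_eqI:
  assumes M: "finite_measure M" and sM: "sets M = sets UL" "sets N = sets UL"
    and eq: "\<And>A. (\<And>i. A i \<in> sets (X i)) \<Longrightarrow> emeasure M (ultra_set U X A) = emeasure N (ultra_set U X A)"
  shows "M = N"
proof (rule measure_eqI_generator_eq[of "ultra_set U X ` fam" "cls ` pts" M N "\<lambda>_. cls ` pts"])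
  have top: "cls ` pts = ultra_set U X (\<lambda>i. space (X i))"
    by (simp add: ultra_set_space ultra_space_eq)
  show "Int_stable (ultra_set U X ` fam)"
    by (auto simp: Int_stable_def ultra_set_Int)
  show "ultra_set U X ` fam \<subseteq> Pow (cls ` pts)"
    using ultra_set_subset by (auto simp: ultra_space_eq)
  show "range (\<lambda>_. cls ` pts) \<subseteq> ultra_set U X ` fam" using top by auto
  show "emeasure M (cls ` pts) \<noteq> \<infinity>" using finite_measure.finite_emeasure_space[OF M]
      sets_eq_imp_space_eq[OF sM(1)] by (simp add: space_UL)
qed (use sM eq in \<open>auto simp: sets_UL\<close>)

end

section \<open>Integration on ultralimits\<close>

context loeb begin

text \<open>The ultralimit of a sequence of functions, as a function on the ultralimit.\<close>

definition hat :: "(nat \<Rightarrow> 'x \<Rightarrow> real) \<Rightarrow> (nat \<Rightarrow> 'x) set \<Rightarrow> real" where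
  "hat f c = Lim U (\<lambda>i. f i (rep c i))"

lemma hat_cls:
  assumes x: "x \<in> pts" and l: "((\<lambda>i. f i (x i)) \<longlongrightarrow> l) U"
  shows "hat f (cls x) = l"
proof -
  have "eventually (\<lambda>i. f i (x i) = f i (rep (cls x) i)) U"
    using rep_cls[OF x] by (auto elim: eventually_mono)
  from Lim_transform_eventually[OF l this] show ?thesis
    unfolding hat_def by (rule tendsto_Lim[OF not_bot])
qed

lemma tendsto_hat:
  assumes x: "x \<in> pts"
    and bd: "\<And>i y. y \<in> space (X i) \<Longrightarrow> a \<le> f i y" "\<And>i y. y \<in> space (X i) \<Longrightarrow> f i y \<le> b"
  shows "((\<lambda>i. f i (x i)) \<longlongrightarrow> hat f (cls x)) U" "a \<le> hat f (cls x)" "hat f (cls x) \<le> b"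
proof -
  have "a \<le> f i (x i)" "f i (x i) \<le> b" for i using bd x by (auto simp: pts_def)
  note t = tendsto_Lim_ultra[of a "\<lambda>i. f i (x i)" b, OF this]
  from t hat_cls[of x f, OF x t(1)]
  show "((\<lambda>i. f i (x i)) \<longlongrightarrow> hat f (cls x)) U" "a \<le> hat f (cls x)" "hat f (cls x) \<le> b" by auto
qed

lemma hat_measurable:
  assumes f: "\<And>i. f i \<in> borel_measurable (X i)"
    and bd: "\<And>i y. y \<in> space (X i) \<Longrightarrow> a \<le> f i y" "\<And>i y. y \<in> space (X i) \<Longrightarrow> f i y \<le> b"
  shows "hat f \<in> borel_measurable UL"
proof (rule borel_measurableI_less)
  fix y :: real
  let ?A = "\<lambda>k i. {x\<in>space (X i). f i x \<le> y - 1 / real (Suc k)}"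
  have "{c\<in>space UL. hat f c < y} = (\<Union>k. ultra_set U X (?A k))"
  proof safe
    fix c assume "c \<in> space UL" and less: "hat f c < y"
    then obtain x where x: "x \<in> pts" "c = cls x" by (auto simp: space_UL)
    obtain k where k: "1 / real (Suc k) < y - hat f c"
      using nat_approx_posE[of "y - hat f c"] less by auto
    have "eventually (\<lambda>i. f i (x i) < y - 1 / real (Suc k)) U"
      by (rule order_tendstoD(2)[OF tendsto_hat(1)[of x a f b]]) (use x k bd in auto)
    then have "eventually (\<lambda>i. x i \<in> ?A k i) U"
      using x by (auto simp: pts_def elim: eventually_mono)
    then show "c \<in> (\<Union>k. ultra_set U X (?A k))"
      using x cls_in_ultra_set_iff[OF x(1), of "?A k"] by blast
  next
    fix c k assume c: "c \<in> ultra_set U X (?A k)"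
    then obtain x where x: "x \<in> pts" "c = cls x" "eventually (\<lambda>i. x i \<in> ?A k i) U"
      by (auto simp: ultra_set_eq)
    then show "c \<in> space UL" by (auto simp: space_UL)
    have "hat f (cls x) \<le> y - 1 / real (Suc k)"
      by (rule tendsto_upperbound[OF tendsto_hat(1)[of x a f b]])
         (use x bd not_bot in \<open>auto elim: eventually_mono\<close>)
    also have "\<dots> < y" by simp
    finally show "hat f c < y" using x by simp
  qed
  also have "\<dots> \<in> sets UL"
    using f by (intro sets.countable_UN) (auto intro!: ultra_set_in_sets)
  finally show "{c\<in>space UL. hat f c < y} \<in> sets UL" .
qed

text \<open>The proof compares both sides with the sums of \<open>1/M\<close> times the indicators of the superlevel
  sets at the multiples of \<open>1/M\<close>, which approximate the functions uniformly.\<close>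

lemma hat_integral:
  assumes f: "\<And>i. f i \<in> borel_measurable (X i)" and B: "0 < B"
    and bd: "\<And>i y. y \<in> space (X i) \<Longrightarrow> 0 \<le> f i y" "\<And>i y. y \<in> space (X i) \<Longrightarrow> f i y \<le> B"
  shows "((\<lambda>i. \<integral>x. f i x \<partial>X i) \<longlongrightarrow> (\<integral>c. hat f c \<partial>UL)) U"
proof -
  interpret UL: prob_space UL by (rule prob_UL)
  note f[measurable]
  have fin: "finite_measure (X i)" for i using prob prob_space.axioms(1) by blast
  have int_f: "integrable (X i) (f i)" for i
    using finite_measure.integrable_const_bound[OF fin, where B=B] bd
    by (metis (no_types, lifting) AE_I2 abs_of_nonneg f real_norm_def)
  have If0: "0 \<le> (\<integral>x. f i x \<partial>X i)" for i
    using bd(1) by (intro integral_nonneg_AE AE_I2)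
  have IfB: "(\<integral>x. f i x \<partial>X i) \<le> B" for i
    by (rule prob_space.integral_le_const[OF prob int_f]) (use bd(2) in auto)
  note lim = tendsto_Lim_ultra(1)[of 0 "\<lambda>i. \<integral>x. f i x \<partial>X i" B, OF If0 IfB]
  let ?l = "Lim U (\<lambda>i. \<integral>x. f i x \<partial>X i)"
  have hm[measurable]: "hat f \<in> borel_measurable UL" by (rule hat_measurable[OF f bd])
  have hb: "0 \<le> hat f c" "hat f c \<le> B" if "c \<in> space UL" for c
    using that tendsto_hat(2,3)[of _ 0 f B] bd by (auto simp: space_UL)
  have int_h: "integrable UL (hat f)"
    by (rule UL.integrable_const_bound[where B=B]) (use hb in auto)
  have approx: "\<bar>(\<integral>c. hat f c \<partial>UL) - ?l\<bar> \<le> 2 / real (Suc N)" for N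
  proof -
    define M where "M = real (Suc N)"
    have M: "0 < M" by (simp add: M_def)
    define J where "J = nat \<lceil>M * B\<rceil>"
    have J: "M * B \<le> real J" unfolding J_def by (simp add: of_nat_ceiling)
    let ?A = "\<lambda>j i. {x\<in>space (X i). real j / M \<le> f i x}"
    have A: "?A j i \<in> sets (X i)" for j i by measurable
    have count: "t - 1 / M \<le> (\<Sum>j=1..J. if real j / M \<le> t then 1 / M else 0) \<and>
       (\<Sum>j=1..J. if real j / M \<le> t then 1 / M else 0) \<le> t" if "0 \<le> t" "t \<le> B" for t
    proof -
      define q where "q = nat \<lfloor>M * t\<rfloor>"
      have q: "real q \<le> M * t" "M * t < real q + 1"
        using that M by (auto simp: q_def)
      have "q \<le> J"
      proof -
        have "real q \<le> M * B" using q(1) that M mult_left_mono[of t B M] by linarith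
        with J show ?thesis by linarith
      qed
      have "(real j / M \<le> t) = (j \<le> q)" for j
      proof -
        have "(real j / M \<le> t) = (real j \<le> M * t)" using M by (simp add: field_simps)
        also have "\<dots> = (j \<le> q)" using q by (auto; linarith)
        finally show ?thesis .
      qed
      then have "(\<Sum>j=1..J. if real j / M \<le> t then 1 / M else 0) = (\<Sum>j\<in>{1..J}. if j \<le> q then 1 / M else 0)"
        by simp
      also have "\<dots> = (\<Sum>j\<in>{1..J} \<inter> {j. j \<le> q}. 1 / M)" by (simp add: sum.If_cases)
      also have "{1..J} \<inter> {j. j \<le> q} = {1..q}" using \<open>q \<le> J\<close> by auto
      finally have "(\<Sum>j=1..J. if real j / M \<le> t then 1 / M else 0) = real q / M" by simp
      moreover have "t - 1 / M \<le> real q / M" "real q / M \<le> t"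
        using divide_right_mono[of "M * t - 1" "real q" M] divide_right_mono[of "real q" "M * t" M] q M
        by (simp_all add: diff_divide_distrib)
      ultimately show ?thesis by simp
    qed
    have s_int: "(\<integral>x. (\<Sum>j=1..J. if P j x then 1 / M else 0) \<partial>Y) = (\<Sum>j=1..J. measure Y {x\<in>space Y. P j x} / M)"
      "integrable Y (\<lambda>x. \<Sum>j=1..J. if P j x then 1 / M else 0)"
      if Y: "prob_space Y" and P: "\<And>j. {x\<in>space Y. P j x} \<in> sets Y" for Y :: "'y measure" and P
    proof -
      interpret Y: prob_space Y by fact
      have eq: "(if P j x then 1 / M else 0) = indicator {x\<in>space Y. P j x} x / M" if "x \<in> space Y" for x j
        using that by auto
      have i: "integrable Y (\<lambda>x. indicator {x\<in>space Y. P j x} x / M :: real)" for j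
        using P by (intro integrable_divide integrable_real_indicator) (auto simp: less_top[symmetric])
      have i': "integrable Y (\<lambda>x. if P j x then 1 / M else 0)" for j
        using i[of j] eq by (subst Bochner_Integration.integrable_cong[OF refl]) auto
      show "integrable Y (\<lambda>x. \<Sum>j=1..J. if P j x then 1 / M else 0)"
        by (intro Bochner_Integration.integrable_sum i')
      have "(\<integral>x. (\<Sum>j=1..J. if P j x then 1 / M else 0) \<partial>Y) = (\<Sum>j=1..J. \<integral>x. (if P j x then 1 / M else 0) \<partial>Y)"
        by (rule Bochner_Integration.integral_sum) (rule i')
      also have "\<dots> = (\<Sum>j=1..J. \<integral>x. indicator {x\<in>space Y. P j x} x / M \<partial>Y)"
        using eq by (intro sum.cong refl Bochner_Integration.integral_cong) auto
      also have "\<dots> = (\<Sum>j=1..J. measure Y {x\<in>space Y. P j x} / M)"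
        using P by (intro sum.cong refl) (simp add: Int_absorb2)
      finally show "(\<integral>x. (\<Sum>j=1..J. if P j x then 1 / M else 0) \<partial>Y) = (\<Sum>j=1..J. measure Y {x\<in>space Y. P j x} / M)" .
    qed
    define S where "S = (\<Sum>j=1..J. measure UL (ultra_set U X (?A j)) / M)"
    have Slim: "((\<lambda>i. \<Sum>j=1..J. measure (X i) (?A j i) / M) \<longlongrightarrow> S) U"
      unfolding S_def using A M by (intro tendsto_sum tendsto_divide measure_UL tendsto_const) auto
    have "\<bar>(\<integral>x. f i x \<partial>X i) - (\<Sum>j=1..J. measure (X i) (?A j i) / M)\<bar> \<le> 1 / M" for i
    proof -
      note s = s_int[OF prob, of i "\<lambda>j x. real j / M \<le> f i x", OF A]
      have "(\<integral>x. f i x - 1 / M \<partial>X i) \<le> (\<Sum>j=1..J. measure (X i) (?A j i) / M)"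
        unfolding s(1)[symmetric]
        by (intro integral_mono s(2)) (use count bd int_f prob_space.axioms(1)[OF prob] in \<open>auto intro!: finite_measure.integrable_const\<close>)
      moreover have "(\<Sum>j=1..J. measure (X i) (?A j i) / M) \<le> (\<integral>x. f i x \<partial>X i)"
        unfolding s(1)[symmetric] by (intro integral_mono s(2) int_f) (use count bd in auto)
      moreover have "(\<integral>x. f i x - 1 / M \<partial>X i) = (\<integral>x. f i x \<partial>X i) - 1 / M"
      proof -
        interpret prob_space "X i" by (rule prob)
        show ?thesis using int_f[of i] by (simp add: prob_space)
      qed
      moreover have "0 \<le> 1 / M" using M by simp
      ultimately show ?thesis by linarith
    qed
    then have 1: "\<bar>?l - S\<bar> \<le> 1 / M"
      using tendsto_upperbound[OF tendsto_rabs[OF tendsto_diff[OF lim Slim]] _ not_bot] by simp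
    have hA: "(\<Sum>j=1..J. if c \<in> ultra_set U X (?A j) then 1 / M else 0) \<le> hat f c \<and>
      hat f c - 1 / M \<le> (\<Sum>j=1..J. if c \<in> ultra_set U X (?A j) then 1 / M else 0)"
      if "c \<in> space UL" for c
    proof -
      obtain x where x: "x \<in> pts" "c = cls x" using \<open>c \<in> space UL\<close> by (auto simp: space_UL)
      have xs: "x i \<in> space (X i)" for i using x(1) by (simp add: pts_def)
      note th = tendsto_hat(1)[of x 0 f B, OF x(1) bd, folded x(2)]
      have "eventually (\<lambda>i. (x i \<in> ?A j i) = (c \<in> ultra_set U X (?A j))) U" for j
        using cls_in_ultra_set_iff[OF x(1), of "?A j"] eventually_not_iff[of "\<lambda>i. x i \<in> ?A j i"] x(2)
        by (cases "c \<in> ultra_set U X (?A j)") (auto elim: eventually_mono)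
      then have "eventually (\<lambda>i. \<forall>j\<in>{1..J}. (x i \<in> ?A j i) = (c \<in> ultra_set U X (?A j))) U"
        by (intro eventually_ball_finite) auto
      then have ev: "eventually (\<lambda>i. (\<Sum>j=1..J. if c \<in> ultra_set U X (?A j) then 1 / M else 0) \<le> f i (x i) \<and>
        f i (x i) - 1 / M \<le> (\<Sum>j=1..J. if c \<in> ultra_set U X (?A j) then 1 / M else 0)) U"
      proof eventually_elim
        case (elim i)
        have "(\<Sum>j=1..J. if c \<in> ultra_set U X (?A j) then 1 / M else 0) =
          (\<Sum>j=1..J. if real j / M \<le> f i (x i) then 1 / M else 0)"
          using elim xs[of i] by (intro sum.cong) auto
        then show ?case using count[of "f i (x i)"] bd[OF xs, of i] by simp
      qed
      have u: "(\<Sum>j=1..J. if c \<in> ultra_set U X (?A j) then 1 / M else 0) \<le> hat f c"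
        by (rule tendsto_lowerbound[OF th _ not_bot]) (use ev in \<open>auto elim: eventually_mono\<close>)
      have "hat f c - 1 / M \<le> (\<Sum>j=1..J. if c \<in> ultra_set U X (?A j) then 1 / M else 0)"
        by (rule tendsto_upperbound[OF tendsto_diff[OF th tendsto_const] _ not_bot])
           (use ev in \<open>auto elim: eventually_mono\<close>)
      with u show ?thesis by blast
    qed
    have UA: "{c\<in>space UL. c \<in> ultra_set U X (?A j)} = ultra_set U X (?A j)" for j
      using ultra_set_subset[of "?A j"] by (auto simp: space_UL ultra_space_eq)
    note s = s_int[OF prob_UL, of "\<lambda>j c. c \<in> ultra_set U X (?A j)", unfolded UA, OF ultra_set_in_sets[OF A]]
    have 2: "S \<le> (\<integral>c. hat f c \<partial>UL)"
      unfolding S_def s(1)[symmetric] by (intro integral_mono s(2) int_h) (use hA in auto)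
    have "(\<integral>c. hat f c - 1 / M \<partial>UL) \<le> S"
      unfolding S_def s(1)[symmetric] by (intro integral_mono s(2)) (use hA int_h in auto)
    then have 3: "(\<integral>c. hat f c \<partial>UL) - 1 / M \<le> S"
      using int_h by (simp add: UL.prob_space)
    from 1 2 3 have "\<bar>(\<integral>c. hat f c \<partial>UL) - ?l\<bar> \<le> 1 / M + 1 / M" by linarith
    then show ?thesis by (simp add: M_def)
  qed
  have "(\<integral>c. hat f c \<partial>UL) = ?l"
  proof (rule ccontr)
    assume "\<not> ?thesis"
    then obtain N where "1 / real (Suc N) < \<bar>(\<integral>c. hat f c \<partial>UL) - ?l\<bar> / 2"
      using nat_approx_posE[of "\<bar>(\<integral>c. hat f c \<partial>UL) - ?l\<bar> / 2"] by auto
    with approx[of N] show False by simp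
  qed
  with lim show ?thesis by simp
qed

end

section \<open>The group action on an ultralimit\<close>

text \<open>Actions on a sequence of probability spaces together with bounded functions \<open>r g i\<close> that are
  asymptotically, in total variation, the Radon--Nikodym derivatives of the translates.\<close>

locale ultra_action = group G for G (structure) +
  fixes U :: "nat filter" and X :: "nat \<Rightarrow> 'x measure"
    and act :: "nat \<Rightarrow> 'a \<Rightarrow> 'x \<Rightarrow> 'x"
    and r :: "'a \<Rightarrow> nat \<Rightarrow> 'x \<Rightarrow> real" and b :: "'a \<Rightarrow> real"
  assumes npu': "nonprincipal_ultrafilter U"
    and ma: "\<And>i. measurable_action G (X i) (act i)"
    and r_meas: "\<And>g i. g \<in> carrier G \<Longrightarrow> r g i \<in> borel_measurable (X i)"
    and r_bd: "\<And>g i x. g \<in> carrier G \<Longrightarrow> x \<in> space (X i) \<Longrightarrow> 0 \<le> r g i x \<and> r g i x \<le> b g"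
    and approx: "\<And>g A. g \<in> carrier G \<Longrightarrow> (\<And>i. A i \<in> sets (X i)) \<Longrightarrow>
      ((\<lambda>i. measure (X i) (act i g -` A i \<inter> space (X i)) - (\<integral>x. indicator (A i) x * r g i x \<partial>X i)) \<longlongrightarrow> 0) U"
begin

sublocale loeb U X
  by (intro loeb.intro nat_ultrafilter.intro loeb_axioms.intro npu' measurable_action.prob[OF ma])

abbreviation uact :: "'a \<Rightarrow> (nat \<Rightarrow> 'x) set \<Rightarrow> (nat \<Rightarrow> 'x) set" where
  "uact \<equiv> ultra_act U X act"

lemma act_pts: "g \<in> carrier G \<Longrightarrow> x \<in> pts \<Longrightarrow> (\<lambda>i. act i g (x i)) \<in> pts"
  using measurable_action.act_space[OF ma] by (auto simp: pts_def)

lemma uact_cls: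
  assumes g: "g \<in> carrier G" and x: "x \<in> pts"
  shows "uact g (cls x) = cls (\<lambda>i. act i g (x i))"
proof -
  have "(\<Union>y\<in>cls x. ultra_rel U X `` {\<lambda>i. act i g (y i)}) = cls (\<lambda>i. act i g (x i))"
  proof -
    have "cls (\<lambda>i. act i g (y i)) = cls (\<lambda>i. act i g (x i))" if "y \<in> cls x" for y
    proof -
      have "y \<in> pts" "eventually (\<lambda>i. x i = y i) U" using that x by (auto simp: mem_cls_iff)
      then show ?thesis
        using g x by (auto simp: cls_eq_iff act_pts elim: eventually_mono)
    qed
    moreover have "x \<in> cls x" using x by (simp add: mem_cls_iff)
    ultimately show ?thesis unfolding cls_def[of "\<lambda>i. act i g (_ i)", symmetric] by blast
  qed
  then show ?thesis
    using x by (simp add: ultra_act_def ultra_space_eq)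
qed

lemma uact_vimage:
  assumes g: "g \<in> carrier G"
  shows "uact g -` ultra_set U X A \<inter> space UL = ultra_set U X (\<lambda>i. act i g -` A i \<inter> space (X i))"
proof -
  have "uact g (cls x) \<in> ultra_set U X A \<longleftrightarrow> cls x \<in> ultra_set U X (\<lambda>i. act i g -` A i \<inter> space (X i))"
    if x: "x \<in> pts" for x
    using x g by (simp add: uact_cls cls_in_ultra_set_iff act_pts) (simp add: pts_def)
  note iff = this
  show ?thesis
  proof (intro equalityI subsetI)
    fix c assume "c \<in> uact g -` ultra_set U X A \<inter> space UL"
    then obtain x where "x \<in> pts" "c = cls x" "uact g (cls x) \<in> ultra_set U X A"
      by (auto simp: space_UL)
    then show "c \<in> ultra_set U X (\<lambda>i. act i g -` A i \<inter> space (X i))" using iff by blast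
  next
    fix c assume c: "c \<in> ultra_set U X (\<lambda>i. act i g -` A i \<inter> space (X i))"
    then obtain x where "x \<in> pts" "c = cls x"
      using ultra_set_subset ultra_space_eq by blast
    then show "c \<in> uact g -` ultra_set U X A \<inter> space UL" using c iff by (simp add: space_UL)
  qed
qed

lemma uact_measurable_action: "measurable_action G UL uact"
proof (intro measurable_action.intro measurable_action_axioms.intro group_axioms)
  show "prob_space UL" by (rule prob_UL)
  show "group_action G (space UL) uact"
  proof (rule group_actionI)
    fix g h c assume g: "g \<in> carrier G" and h: "h \<in> carrier G" and "c \<in> space UL"
    then obtain x where x: "x \<in> pts" "c = cls x" by (auto simp: space_UL)
    have "(\<lambda>i. act i (g \<otimes> h) (x i)) = (\<lambda>i. act i g (act i h (x i)))"
      using measurable_action.act_mult[OF ma] g h x(1) by (auto simp: pts_def)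
    then show "uact (g \<otimes> h) c = uact g (uact h c)"
      using g h x act_pts[OF h x(1)] by (simp add: uact_cls)
  next
    fix c assume "c \<in> space UL"
    then obtain x where x: "x \<in> pts" "c = cls x" by (auto simp: space_UL)
    have "(\<lambda>i. act i \<one> (x i)) = x"
      using measurable_action.act_one[OF ma] x(1) by (auto simp: pts_def)
    then show "uact \<one> c = c" using x by (simp add: uact_cls)
  next
    fix g show "uact g \<in> extensional (space UL)"
      by (auto simp: ultra_act_def space_UL ultra_space_eq)
  qed (auto simp: space_UL uact_cls act_pts)
  fix g assume g: "g \<in> carrier G"
  show "uact g \<in> UL \<rightarrow>\<^sub>M UL"
  proof (rule measurable_sigma_sets[OF sets_UL])
    show "ultra_set U X ` {A. \<forall>i. A i \<in> sets (X i)} \<subseteq> Pow (cls ` pts)"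
      using ultra_set_subset by (auto simp: ultra_space_eq)
    show "uact g \<in> space UL \<rightarrow> cls ` pts" using g by (auto simp: space_UL uact_cls act_pts)
    fix S assume "S \<in> ultra_set U X ` {A. \<forall>i. A i \<in> sets (X i)}"
    then obtain A where "\<And>i. A i \<in> sets (X i)" "S = ultra_set U X A" by auto
    then show "uact g -` S \<inter> space UL \<in> sets UL"
      using g measurable_action.act_vimage_sets[OF ma] by (auto simp: uact_vimage intro!: ultra_set_in_sets)
  qed
qed

lemma translate_UL:
  assumes g: "g \<in> carrier G"
  shows "distr UL UL (uact g) = density UL (\<lambda>c. ennreal (hat (r g) c))"
proof (rule UL_measure_eqI)
  interpret U: measurable_action G UL uact by (rule uact_measurable_action)
  interpret UL: prob_space UL by (rule prob_UL)
  have rb: "0 \<le> r g i x" "r g i x \<le> max 1 (b g)" if "x \<in> space (X i)" for i x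
    using r_bd[OF g that] by auto
  have hm[measurable]: "hat (r g) \<in> borel_measurable UL"
    using hat_measurable[of "r g" 0 "max 1 (b g)"] r_meas[OF g] rb by blast
  have hb: "0 \<le> hat (r g) c" "hat (r g) c \<le> max 1 (b g)" if "c \<in> space UL" for c
    using that tendsto_hat(2,3)[of _ 0 "r g" "max 1 (b g)"] rb by (auto simp: space_UL)
  show "finite_measure (distr UL UL (uact g))"
    using g by (intro finite_measure.finite_measure_distr U.act_measurable) unfold_locales
  fix A assume A: "\<And>i. A i \<in> sets (X i)"
  let ?f = "\<lambda>i x. indicator (A i) x * r g i x"
  have US: "ultra_set U X A \<in> sets UL" by (rule ultra_set_in_sets[OF A])
  have fm: "?f i \<in> borel_measurable (X i)" for i using A r_meas[OF g] by measurable
  have fb: "0 \<le> ?f i x" "?f i x \<le> max 1 (b g)" if "x \<in> space (X i)" for i x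
    using rb[OF that] by (auto simp: indicator_def)
  have hat_f: "hat ?f c = indicator (ultra_set U X A) c * hat (r g) c" if c: "c \<in> space UL" for c
  proof -
    obtain x where x: "x \<in> pts" "c = cls x" using c by (auto simp: space_UL)
    note th = tendsto_hat(1)[of x 0 "r g" "max 1 (b g)", OF x(1) rb]
    show ?thesis
    proof (cases "c \<in> ultra_set U X A")
      case True
      then have "eventually (\<lambda>i. r g i (x i) = ?f i (x i)) U"
        using x cls_in_ultra_set_iff[OF x(1), of A] by (auto elim: eventually_mono)
      from Lim_transform_eventually[OF th this] True show ?thesis
        using x hat_cls[of x ?f "hat (r g) (cls x)"] by simp
    next
      case False
      then have "eventually (\<lambda>i. 0 = ?f i (x i)) U"
        using x cls_in_ultra_set_iff[OF x(1), of A] eventually_not_iff[of "\<lambda>i. x i \<in> A i"]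
        by (auto elim: eventually_mono)
      from Lim_transform_eventually[OF tendsto_const this] False show ?thesis
        using x hat_cls[of x ?f 0] by simp
    qed
  qed
  have "((\<lambda>i. \<integral>x. ?f i x \<partial>X i) \<longlongrightarrow> (\<integral>c. hat ?f c \<partial>UL)) U"
    by (rule hat_integral[OF fm, where B="max 1 (b g)"]) (use fb in auto)
  from tendsto_add[OF approx[OF g A] this]
  have "((\<lambda>i. measure (X i) (act i g -` A i \<inter> space (X i))) \<longlongrightarrow> (\<integral>c. hat ?f c \<partial>UL)) U"
    by simp
  moreover have "((\<lambda>i. measure (X i) (act i g -` A i \<inter> space (X i))) \<longlongrightarrow>
      measure UL (uact g -` ultra_set U X A \<inter> space UL)) U"
    unfolding uact_vimage[OF g] using measurable_action.act_vimage_sets[OF ma g A] by (rule measure_UL)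
  ultimately have eq: "measure UL (uact g -` ultra_set U X A \<inter> space UL) = (\<integral>c. hat ?f c \<partial>UL)"
    using tendsto_unique[OF not_bot] by blast
  have "emeasure (distr UL UL (uact g)) (ultra_set U X A) = ennreal (\<integral>c. hat ?f c \<partial>UL)"
    by (simp add: U.emeasure_translate[OF g US] UL.emeasure_eq_measure eq)
  also have "(\<integral>c. hat ?f c \<partial>UL) = (\<integral>c. indicator (ultra_set U X A) c * hat (r g) c \<partial>UL)"
    using hat_f by (intro Bochner_Integration.integral_cong) auto
  also have "ennreal \<dots> = (\<integral>\<^sup>+c. ennreal (indicator (ultra_set U X A) c * hat (r g) c) \<partial>UL)"
  proof (rule nn_integral_eq_integral[symmetric])
    show "integrable UL (\<lambda>c. indicator (ultra_set U X A) c * hat (r g) c)"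
      using US hb by (intro UL.integrable_const_bound[where B="max 1 (b g)"])
        (auto simp: indicator_def intro!: AE_I2)
  qed (use hb in \<open>auto intro!: AE_I2\<close>)
  also have "\<dots> = (\<integral>\<^sup>+c. ennreal (hat (r g) c) * indicator (ultra_set U X A) c \<partial>UL)"
    by (intro nn_integral_cong) (auto simp: indicator_def)
  also have "\<dots> = emeasure (density UL (\<lambda>c. ennreal (hat (r g) c))) (ultra_set U X A)"
    using US by (simp add: emeasure_density)
  finally show "emeasure (distr UL UL (uact g)) (ultra_set U X A) =
    emeasure (density UL (\<lambda>c. ennreal (hat (r g) c))) (ultra_set U X A)" .
qed auto

lemma qi_UL: "qi_space G UL uact"
proof -
  interpret U: measurable_action G UL uact by (rule uact_measurable_action)
  show ?thesis
  proof (rule U.qi_of_bound)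
    fix g A assume g: "g \<in> carrier G" and A: "A \<in> sets UL"
    have rb: "0 \<le> r g i x" "r g i x \<le> b g" if "x \<in> space (X i)" for i x
      using r_bd[OF g that] by auto
    have hm: "hat (r g) \<in> borel_measurable UL"
      using hat_measurable[of "r g" 0 "b g"] r_meas[OF g] rb by blast
    have "emeasure (distr UL UL (uact g)) A = (\<integral>\<^sup>+c. ennreal (hat (r g) c) * indicator A c \<partial>UL)"
      using A hm by (simp add: translate_UL[OF g] emeasure_density)
    also have "\<dots> \<le> (\<integral>\<^sup>+c. ennreal (b g) * indicator A c \<partial>UL)"
      using tendsto_hat(3)[of _ 0 "r g" "b g"] rb
      by (intro nn_integral_mono mult_right_mono ennreal_leI) (auto simp: space_UL)
    also have "\<dots> = ennreal (b g) * emeasure UL A" using A by (simp add: nn_integral_cmult_indicator)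
    finally show "emeasure (distr UL UL (uact g)) A \<le> ennreal (b g) * emeasure UL A" .
  qed
qed

lemma rn_cocycle_UL:
  assumes g: "g \<in> carrier G"
  shows "AE c in UL. rn_cocycle UL uact g c = ennreal (hat (r g) c)"
proof -
  interpret UL: prob_space UL by (rule prob_UL)
  have hm[measurable]: "hat (r g) \<in> borel_measurable UL"
    using hat_measurable[of "r g" 0 "b g"] r_meas[OF g] r_bd[OF g] by blast
  have "AE c in UL. ennreal (hat (r g) c) = rn_cocycle UL uact g c"
    unfolding rn_cocycle_def by (rule UL.RN_deriv_unique) (use translate_UL[OF g] in auto)
  then show ?thesis by auto
qed

end

section \<open>Standard models of Radon--Nikodym factors\<close>

text \<open>A quasi-invariant space of a countable group, with the data of the standard model of its
  Radon--Nikodym factor.\<close>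

locale rn_model = measurable_action G X act for G (structure) and X :: "'x measure" and act +
  assumes qi: "qi_space G X act" and count: "countable (carrier G)"
begin

sublocale prob_space X by (rule prob)

text \<open>A code for group elements by natural numbers, and a left inverse of it defined on all of
  \<open>\<nat>\<close>. In sequences below the \<open>n\<close>-th term belongs to the element \<open>enum n\<close>.\<close>

definition idx :: "'a \<Rightarrow> nat" where "idx = to_nat_on (carrier G)"
definition enum :: "nat \<Rightarrow> 'a" where "enum = from_nat_into (carrier G)"

lemma enum_carrier: "enum n \<in> carrier G"
  unfolding enum_def by (rule from_nat_into) auto

lemma enum_idx: "g \<in> carrier G \<Longrightarrow> enum (idx g) = g"
  unfolding enum_def idx_def using count by (rule from_nat_into_to_nat_on)

abbreviation rn :: "'a \<Rightarrow> 'x \<Rightarrow> ennreal" where "rn \<equiv> rn_cocycle X act"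

lemma rn_measurable[measurable]: "rn g \<in> borel_measurable X"
  by (simp add: rn_cocycle_def)

lemma null_translate: "g \<in> carrier G \<Longrightarrow> null_sets (distr X X (act g)) = null_sets X"
  using qi by (simp add: qi_space_def)

lemma density_rn: "g \<in> carrier G \<Longrightarrow> density X (rn g) = distr X X (act g)"
  unfolding rn_cocycle_def
  by (rule density_RN_deriv) (simp_all add: absolutely_continuous_def null_translate)

lemma AE_translate:
  assumes g: "g \<in> carrier G" and P: "AE x in X. P x"
  shows "AE x in X. P (act g x)"
proof (rule AE_distrD[OF act_measurable[OF g]])
  from P obtain N where "{x\<in>space X. \<not> P x} \<subseteq> N" "N \<in> null_sets X"
    by (auto elim!: AE_E simp: null_sets_def)
  then show "AE x in distr X X (act g). P x"
    by (intro AE_I'[of N]) (auto simp: null_translate[OF g])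
qed

lemma rn_pos: "g \<in> carrier G \<Longrightarrow> AE x in X. rn g x \<noteq> 0"
proof -
  assume g: "g \<in> carrier G"
  let ?A = "{x\<in>space X. rn g x = 0}"
  have "emeasure (density X (rn g)) ?A = (\<integral>\<^sup>+x. rn g x * indicator ?A x \<partial>X)"
    by (rule emeasure_density) auto
  also have "\<dots> = (\<integral>\<^sup>+x. 0 \<partial>X)" by (intro nn_integral_cong) (auto simp: indicator_def)
  finally have "?A \<in> null_sets (density X (rn g))" by (auto intro!: null_setsI)
  then have "?A \<in> null_sets X" by (simp add: density_rn[OF g] null_translate[OF g])
  then show "AE x in X. rn g x \<noteq> 0" by (rule AE_I') auto
qed

lemma rn_finite: "g \<in> carrier G \<Longrightarrow> AE x in X. rn g x \<noteq> \<infinity>"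
proof -
  assume g: "g \<in> carrier G"
  interpret D: prob_space "distr X X (act g)" by (rule prob_space_distr[OF act_measurable[OF g]])
  show ?thesis
    unfolding rn_cocycle_def
    by (rule RN_deriv_finite) (unfold_locales, simp_all add: absolutely_continuous_def null_translate[OF g])
qed

lemma rn_unique:
  assumes "f \<in> borel_measurable X" "density X f = distr X X (act g)"
  shows "AE x in X. rn g x = f x"
  using RN_deriv_unique[OF assms] unfolding rn_cocycle_def by auto

lemma rn_one: "AE x in X. rn \<one> x = 1"
proof (rule rn_unique)
  have "distr X X (act \<one>) = distr X X (\<lambda>x. x)" by (rule distr_cong) (auto simp: act_one)
  then show "density X (\<lambda>x. 1) = distr X X (act \<one>)" by (simp add: density_1 distr_id2)
qed simp

lemma rn_mult:
  assumes g: "g \<in> carrier G" and h: "h \<in> carrier G"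
  shows "AE x in X. rn (g \<otimes> h) x = rn g x * rn h (act (inv g) x)"
proof (rule rn_unique)
  note [measurable] = act_measurable[OF g] act_measurable[OF h] act_measurable[OF inv_closed[OF g]]
  show "(\<lambda>x. rn g x * rn h (act (inv g) x)) \<in> borel_measurable X" by measurable
  have "distr X X (act (g \<otimes> h)) = distr X X (act g \<circ> act h)"
    using g h by (intro distr_cong) (auto simp: act_mult)
  also have "\<dots> = distr (distr X X (act h)) X (act g)"
    by (rule distr_distr[symmetric]) (simp_all add: act_measurable g h)
  also have "\<dots> = distr (density X (rn h)) X (act g)" by (simp add: density_rn[OF h])
  also have "density X (rn h) = density X (\<lambda>x. rn h (act (inv g) (act g x)))"
    by (intro density_cong AE_I2) (auto simp: act_inv g)
  also have "distr (density X (\<lambda>x. rn h (act (inv g) (act g x)))) X (act g) =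
      density (distr X X (act g)) (\<lambda>x. rn h (act (inv g) x))"
    by (rule density_distr[symmetric]) measurable
  also have "\<dots> = density (density X (rn g)) (\<lambda>x. rn h (act (inv g) x))" by (simp add: density_rn[OF g])
  also have "\<dots> = density X (\<lambda>x. rn g x * rn h (act (inv g) x))"
    by (rule density_density_eq) measurable
  finally show "density X (\<lambda>x. rn g x * rn h (act (inv g) x)) = distr X X (act (g \<otimes> h))" by simp
qed

text \<open>The points at which the cocycle is finite, positive and satisfies the cocycle identity, and the
  largest invariant set of such points.\<close>

definition good :: "'x set" where
  "good = {x\<in>space X. rn \<one> x = 1 \<and> (\<forall>g\<in>carrier G. rn g x \<noteq> 0 \<and> rn g x \<noteq> \<infinity> \<and>
     (\<forall>h\<in>carrier G. rn (g \<otimes> h) x = rn g x * rn h (act (inv g) x)))}"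

definition core :: "'x set" where
  "core = {x\<in>space X. \<forall>k\<in>carrier G. act k x \<in> good}"

lemma AE_good: "AE x in X. x \<in> good"
proof -
  have "AE x in X. \<forall>g\<in>carrier G. rn g x \<noteq> 0 \<and> rn g x \<noteq> \<infinity> \<and>
     (\<forall>h\<in>carrier G. rn (g \<otimes> h) x = rn g x * rn h (act (inv g) x))"
    unfolding AE_ball_countable[OF count]
  proof (intro ballI AE_conjI)
    fix g assume g: "g \<in> carrier G"
    show "AE x in X. \<forall>h\<in>carrier G. rn (g \<otimes> h) x = rn g x * rn h (act (inv g) x)"
      unfolding AE_ball_countable[OF count] using rn_mult[OF g] by blast
  qed (use rn_pos rn_finite in auto)
  with rn_one AE_space show ?thesis by eventually_elim (simp add: good_def)
qed

lemma good_sets: "good \<in> sets X"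
proof -
  have [measurable]: "Measurable.pred X (\<lambda>x. rn (g \<otimes> h) x = rn g x * rn h (act (inv g) x))"
    if "g \<in> carrier G" "h \<in> carrier G" for g h
  proof -
    note [measurable] = act_measurable[OF inv_closed[OF that(1)]]
    show ?thesis by measurable
  qed
  have ne: "carrier G \<noteq> {}" by auto
  have "good = {x\<in>space X. rn \<one> x = 1} \<inter> (\<Inter>g\<in>carrier G. {x\<in>space X. rn g x \<noteq> 0 \<and> rn g x \<noteq> \<infinity>} \<inter>
     (\<Inter>h\<in>carrier G. {x\<in>space X. rn (g \<otimes> h) x = rn g x * rn h (act (inv g) x)}))"
    using ne by (auto simp: good_def)
  also have "\<dots> \<in> sets X"
  proof (intro sets.Int sets.countable_INT' count ne image_subsetI)
    fix g h assume [simp]: "g \<in> carrier G" "h \<in> carrier G"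
    show "{x\<in>space X. rn (g \<otimes> h) x = rn g x * rn h (act (inv g) x)} \<in> sets X" by measurable
  qed measurable
  finally show ?thesis .
qed

lemma AE_core: "AE x in X. x \<in> core"
proof -
  have "AE x in X. \<forall>k\<in>carrier G. act k x \<in> good"
    unfolding AE_ball_countable[OF count] using AE_translate AE_good by blast
  with AE_space show ?thesis by eventually_elim (simp add: core_def)
qed

lemma core_sets: "core \<in> sets X"
proof -
  have "core = (\<Inter>k\<in>carrier G. act k -` good \<inter> space X)" by (auto simp: core_def)
  also have "\<dots> \<in> sets X"
    by (intro sets.countable_INT' count) (auto intro!: act_vimage_sets good_sets)
  finally show ?thesis .
qed

lemma core_good: "x \<in> core \<Longrightarrow> x \<in> good"
proof -
  assume x: "x \<in> core"
  then have "act \<one> x \<in> good" by (auto simp: core_def)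
  then show ?thesis using x act_one by (simp add: core_def)
qed

lemma core_act: "g \<in> carrier G \<Longrightarrow> x \<in> space X \<Longrightarrow> act g x \<in> core \<longleftrightarrow> x \<in> core"
proof -
  have *: "act g x \<in> core" if g: "g \<in> carrier G" and x: "x \<in> core" for g x
  proof -
    have "act k (act g x) \<in> good" if k: "k \<in> carrier G" for k
    proof -
      have "act (k \<otimes> g) x \<in> good" using x m_closed[OF k g] by (simp add: core_def)
      then show ?thesis using x act_mult[OF k g] by (simp add: core_def)
    qed
    then show ?thesis using g x act_space by (auto simp: core_def)
  qed
  assume g: "g \<in> carrier G" and x: "x \<in> space X"
  show ?thesis
    using *[OF g, of x] *[OF inv_closed[OF g], of "act g x"] act_inv[OF g x] by auto
qed

text \<open>The factor map is the logarithm of the cocycle. Off the conull set \<open>core\<close> it is the zero sequence,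
  a fixed point of \<open>zact\<close>, so that equivariance holds everywhere.\<close>

definition logs :: "'x \<Rightarrow> nat \<Rightarrow> real" where
  "logs x = (\<lambda>n. ln (enn2real (rn (enum n) x)))"

definition pmap :: "'x \<Rightarrow> nat \<Rightarrow> real" where
  "pmap x = (if x \<in> core then logs x else (\<lambda>n. 0))"

text \<open>The space of the model: functions of \<open>G\<close> that vanish at the identity, written as sequences. The
  second condition says that a term depends only on the group element that it belongs to.\<close>

definition Zset :: "(nat \<Rightarrow> real) set" where
  "Zset = {z. z (idx \<one>) = 0 \<and> (\<forall>n. z n = z (idx (enum n)))}"

text \<open>The action forced by the cocycle identity
  \<open>\<rho>\<^sub>g\<^sub>h(x) = \<rho>\<^sub>g(x) \<rho>\<^sub>h(g\<^sup>-\<^sup>1x)\<close>.\<close>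

definition zact :: "'a \<Rightarrow> (nat \<Rightarrow> real) \<Rightarrow> nat \<Rightarrow> real" where
  "zact g = (\<lambda>z\<in>Zset. \<lambda>n. z (idx (inv g \<otimes> enum n)) - z (idx (inv g)))"

definition ZB :: "(nat \<Rightarrow> real) measure" where
  "ZB = restrict_space borel Zset"

text \<open>The measure of the model is the law of the factor map.\<close>

definition Zmod :: "(nat \<Rightarrow> real) measure" where
  "Zmod = distr X ZB pmap"

lemma space_ZB[simp]: "space ZB = Zset" by (simp add: ZB_def space_restrict_space)
lemma space_Zmod[simp]: "space Zmod = Zset" by (simp add: Zmod_def)
lemma sets_Zmod[simp, measurable_cong]: "sets Zmod = sets ZB" by (simp add: Zmod_def)

lemma closed_Zset: "closed Zset"
proof -
  have "Zset = {z. z (idx \<one>) = 0} \<inter> (\<Inter>n. {z. z n = z (idx (enum n))})" by (auto simp: Zset_def)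
  also have "closed \<dots>"
    by (intro closed_Int closed_INT ballI closed_Collect_eq continuous_intros) auto
  finally show ?thesis .
qed

lemma coord_ZB[measurable]: "(\<lambda>z. z n) \<in> borel_measurable ZB"
  unfolding ZB_def by (intro measurable_restrict_space1) simp

lemma standard_borel_Zmod: "standard_borel Zmod"
  unfolding standard_borel_def
proof (intro exI conjI)
  let ?T = "subtopology euclidean Zset"
  show "completely_metrizable_space ?T"
    using closed_Zset by (intro completely_metrizable_space_closedin completely_metrizable_space_euclidean) simp
  have "second_countable (euclidean :: (nat \<Rightarrow> real) topology)"
  proof -
    obtain B :: "(nat \<Rightarrow> real) set set" where B: "countable B" "topological_basis B"
      using ex_countable_basis by auto
    show ?thesis unfolding second_countable_def
    proof (intro exI[of _ B] conjI ballI allI impI)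
      fix V :: "(nat \<Rightarrow> real) set" and x assume "openin euclidean V \<and> x \<in> V"
      then have "open V" "x \<in> V" by simp_all
      then obtain W where "W \<in> B" "x \<in> W" "W \<subseteq> V" by (rule topological_basisE[OF B(2)])
      then show "\<exists>W\<in>B. x \<in> W \<and> W \<subseteq> V" by blast
    qed (use B topological_basis_open[OF B(2)] in auto)
  qed
  then show "second_countable ?T" by (rule second_countable_subtopology)
  show "topspace ?T = space Zmod" by simp
  have "sets Zmod = (\<inter>) Zset ` sigma_sets UNIV {S. open S}"
    by (simp add: ZB_def sets_restrict_space borel_def)
  also have "\<dots> = sigma_sets Zset ((\<inter>) Zset ` {S. open S})"
  proof (rule sigma_sets_Int)
    have "Zset \<in> sets borel" using closed_Zset by (rule borel_closed)
    then show "Zset \<in> sigma_sets UNIV {S. open S}" by (simp add: borel_def)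
  qed simp
  also have "(\<inter>) Zset ` {S. open S} = {U. openin ?T U}"
    by (auto simp: openin_subtopology)
  finally show "sets Zmod = sigma_sets (topspace ?T) {U. openin ?T U}" by simp
qed

lemma logs_measurable[measurable]: "logs \<in> borel_measurable X"
  unfolding logs_def by (intro measurable_coordinatewise_then_product) measurable

lemma logs_Zset: "x \<in> core \<Longrightarrow> logs x \<in> Zset"
  using core_good[of x] by (auto simp: Zset_def logs_def good_def enum_idx enum_carrier)

lemma pmap_Zset: "pmap x \<in> Zset"
  using logs_Zset by (auto simp: pmap_def) (simp add: Zset_def)

lemma pmap_measurable[measurable]: "pmap \<in> X \<rightarrow>\<^sub>M ZB"
  unfolding ZB_def
proof (rule measurable_restrict_space2)
  show "pmap \<in> space X \<rightarrow> Zset" using pmap_Zset by auto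
  show "pmap \<in> borel_measurable X"
    unfolding pmap_def using core_sets by (intro measurable_If) auto
qed

lemma pmap_equivariant:
  assumes g: "g \<in> carrier G" and x: "x \<in> space X"
  shows "pmap (act g x) = zact g (pmap x)"
proof (cases "x \<in> core")
  case False
  then have "pmap x = (\<lambda>n. 0)" "pmap (act g x) = (\<lambda>n. 0)" using core_act[OF g x] by (auto simp: pmap_def)
  then show ?thesis using pmap_Zset[of x] by (simp add: zact_def)
next
  case True
  have *: "logs (act g x) n = logs x (idx (inv g \<otimes> enum n)) - logs x (idx (inv g))" for n
  proof -
    have gd: "x \<in> good" using core_good[OF True] .
    have ig: "inv g \<in> carrier G" using g by simp
    have c: "inv g \<otimes> enum n \<in> carrier G" using ig enum_carrier by simp
    have m: "rn (inv g \<otimes> enum n) x = rn (inv g) x * rn (enum n) (act g x)"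
      using gd ig enum_carrier[of n] g by (auto simp: good_def)
    have "act g x \<in> good" using True g by (simp add: core_def)
    then have "rn (enum n) (act g x) \<noteq> 0" "rn (enum n) (act g x) \<noteq> \<infinity>"
      using enum_carrier by (auto simp: good_def)
    then have p1: "0 < enn2real (rn (enum n) (act g x))" by (simp add: enn2real_positive_iff less_top zero_less_iff_neq_zero)
    have "rn (inv g) x \<noteq> 0" "rn (inv g) x \<noteq> \<infinity>" using gd ig by (auto simp: good_def)
    then have p2: "0 < enn2real (rn (inv g) x)" by (simp add: enn2real_positive_iff less_top zero_less_iff_neq_zero)
    show ?thesis
      using p1 p2 by (simp add: logs_def enum_idx[OF c] enum_idx[OF ig] m enn2real_mult ln_mult)
  qed
  then show ?thesis
    using True core_act[OF g x] logs_Zset[OF True] by (simp add: pmap_def zact_def fun_eq_iff)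
qed

lemma zact_Zset: "g \<in> carrier G \<Longrightarrow> z \<in> Zset \<Longrightarrow> zact g z \<in> Zset"
  using enum_idx enum_carrier by (simp add: Zset_def zact_def)

lemma zact_action: "group_action G Zset zact"
proof (rule group_actionI)
  show "group G" by (rule group_axioms)
  fix g h z assume g: "g \<in> carrier G" and h: "h \<in> carrier G" and z: "z \<in> Zset"
  have e: "enum (idx (inv g \<otimes> enum n)) = inv g \<otimes> enum n" "enum (idx (inv g)) = inv g" for n
    using g enum_carrier by (simp_all add: enum_idx)
  have "inv (g \<otimes> h) \<otimes> enum n = inv h \<otimes> (inv g \<otimes> enum n)" "inv (g \<otimes> h) = inv h \<otimes> inv g" for n
    using g h enum_carrier by (simp_all add: inv_mult_group m_assoc)
  then show "zact (g \<otimes> h) z = zact g (zact h z)"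
    using z zact_Zset[OF h z] by (simp add: zact_def fun_eq_iff e)
next
  fix z assume z: "z \<in> Zset"
  then show "zact \<one> z = z"
    using enum_carrier by (simp add: zact_def fun_eq_iff) (simp add: Zset_def)
qed (auto simp: zact_Zset, simp add: zact_def)

lemma zact_measurable: "g \<in> carrier G \<Longrightarrow> zact g \<in> ZB \<rightarrow>\<^sub>M ZB"
proof -
  assume g: "g \<in> carrier G"
  show ?thesis
    unfolding ZB_def 
  proof (rule measurable_restrict_space2)
    show "zact g \<in> space (restrict_space borel Zset) \<rightarrow> Zset"
      using zact_Zset[OF g] by (auto simp: space_restrict_space)
    have "(\<lambda>z n. z (idx (inv g \<otimes> enum n)) - z (idx (inv g))) \<in> borel_measurable ZB"
      by (intro measurable_coordinatewise_then_product) measurable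
    then show "zact g \<in> borel_measurable (restrict_space borel Zset)"
      by (subst measurable_cong[where g="\<lambda>z n. z (idx (inv g \<otimes> enum n)) - z (idx (inv g))"])
         (auto simp: ZB_def zact_def space_restrict_space)
  qed
qed

sublocale Z: prob_space Zmod
  unfolding Zmod_def by (rule prob_space_distr) simp

lemma AE_exp_pmap: "g \<in> carrier G \<Longrightarrow> AE x in X. ennreal (exp (pmap x (idx g))) = rn g x"
  using AE_core
proof eventually_elim
  fix x assume g: "g \<in> carrier G" and x: "x \<in> core"
  have "rn g x \<noteq> 0" "rn g x \<noteq> \<infinity>" using core_good[OF x] g by (auto simp: good_def)
  then have "0 < enn2real (rn g x)" "ennreal (enn2real (rn g x)) = rn g x"
    by (simp_all add: enn2real_positive_iff less_top zero_less_iff_neq_zero)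
  then show "ennreal (exp (pmap x (idx g))) = rn g x"
    using x g by (simp add: pmap_def logs_def enum_idx)
qed

lemma translate_Zmod:
  assumes g: "g \<in> carrier G"
  shows "distr Zmod Zmod (zact g) = density Zmod (\<lambda>z. ennreal (exp (z (idx g))))"
proof -
  note [measurable] = act_measurable[OF g] zact_measurable[OF g]
  have "distr Zmod Zmod (zact g) = distr (distr X ZB pmap) ZB (zact g)"
    by (rule distr_cong) (simp_all add: Zmod_def)
  also have "\<dots> = distr X ZB (zact g \<circ> pmap)" by (rule distr_distr) measurable
  also have "\<dots> = distr X ZB (pmap \<circ> act g)"
    by (rule distr_cong) (auto simp: pmap_equivariant[OF g])
  also have "\<dots> = distr (distr X X (act g)) ZB pmap" by (rule distr_distr[symmetric]) measurable
  also have "\<dots> = distr (density X (rn g)) ZB pmap" by (simp add: density_rn[OF g])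
  also have "density X (rn g) = density X (\<lambda>x. ennreal (exp (pmap x (idx g))))"
    by (rule density_cong) (use AE_exp_pmap[OF g] in \<open>auto intro: measurable_compose[OF pmap_measurable]\<close>)
  also have "distr (density X (\<lambda>x. ennreal (exp (pmap x (idx g))))) ZB pmap =
      density (distr X ZB pmap) (\<lambda>z. ennreal (exp (z (idx g))))"
    by (rule density_distr[symmetric]) measurable
  finally show ?thesis by (simp add: Zmod_def)
qed

lemma qi_Zmod: "qi_space G Zmod zact"
proof -
  have "null_sets (distr Zmod Zmod (zact g)) = null_sets Zmod" if g: "g \<in> carrier G" for g
  proof -
    have "A \<in> null_sets (density Zmod (\<lambda>z. ennreal (exp (z (idx g))))) \<longleftrightarrow> A \<in> null_sets Zmod" for A
      by (subst null_sets_density_iff) (auto simp: AE_iff_null_sets intro: AE_not_in)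
    then show ?thesis using translate_Zmod[OF g] by auto
  qed
  moreover have "zact g \<in> Zmod \<rightarrow>\<^sub>M Zmod" if "g \<in> carrier G" for g
    using zact_measurable[OF that] by (simp cong: measurable_cong_sets)
  ultimately show ?thesis
    using zact_action by (simp add: qi_space_def Z.prob_space_axioms)
qed

lemma factor_Zmod: "measure_preserving_factor G X act Zmod zact pmap"
  unfolding measure_preserving_factor_def qi_factor_def
proof (intro conjI ballI qi qi_Zmod)
  show "pmap \<in> X \<rightarrow>\<^sub>M Zmod" by (simp cong: measurable_cong_sets)
  show "distr X Zmod pmap = Zmod"
    unfolding Zmod_def by (rule distr_cong) auto
next
  fix g x assume "g \<in> carrier G" "x \<in> space X"
  then show "pmap (act g x) = zact g (pmap x)" by (rule pmap_equivariant)
next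
  fix g assume g: "g \<in> carrier G"
  have "AE z in Zmod. ennreal (exp (z (idx g))) = rn_cocycle Zmod zact g z"
    unfolding rn_cocycle_def by (rule Z.RN_deriv_unique) (simp_all add: translate_Zmod[OF g])
  then have "AE x in X. ennreal (exp (pmap x (idx g))) = rn_cocycle Zmod zact g (pmap x)"
    unfolding Zmod_def by (rule AE_distrD[OF pmap_measurable])
  with AE_exp_pmap[OF g] show "AE x in X. rn g x = rn_cocycle Zmod zact g (pmap x)"
    by eventually_elim simp
qed

lemma RN_factor_Zmod: "RN_factor G X act Zmod zact pmap"
  unfolding RN_factor_def
proof (intro conjI ballI standard_borel_Zmod factor_Zmod)
  define M' where "M' = sigma (space X) {rn g -` B \<inter> space X | g B. g \<in> carrier G \<and> B \<in> sets borel}"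
  have M': "sets M' = rn_sigma G X act" "space M' = space X"
    unfolding M'_def rn_sigma_def by (auto simp: sets_measure_of_conv space_measure_of_conv)
  have [measurable]: "rn g \<in> borel_measurable M'" if "g \<in> carrier G" for g
  proof (rule measurableI)
    fix A :: "ennreal set" assume "A \<in> sets borel"
    then have "rn g -` A \<inter> space X \<in> rn_sigma G X act"
      unfolding rn_sigma_def using that by (intro sigma_sets.Basic) auto
    then show "rn g -` A \<inter> space M' \<in> sets M'" using M' by simp
  qed simp
  have logs': "logs \<in> borel_measurable M'"
    unfolding logs_def using enum_carrier by (intro measurable_coordinatewise_then_product) measurable
  have eq: "AE x in X. pmap x \<in> B' \<inter> Zset \<longleftrightarrow> x \<in> logs -` B' \<inter> space X" for B'
    using AE_core AE_space by eventually_elim (use logs_Zset in \<open>auto simp: pmap_def\<close>)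
  fix B assume "B \<in> sets Zmod"
  then obtain B' where B': "B' \<in> sets borel" "B = B' \<inter> Zset"
    by (auto simp: ZB_def sets_restrict_space)
  have "logs -` B' \<inter> space X \<in> rn_sigma G X act"
    using measurable_sets[OF logs' B'(1)] M' by simp
  with eq[of B'] show "\<exists>A\<in>rn_sigma G X act. AE x in X. pmap x \<in> B \<longleftrightarrow> x \<in> A"
    unfolding B'(2) by blast
next
  fix A assume "A \<in> rn_sigma G X act"
  then show "\<exists>B\<in>sets Zmod. AE x in X. pmap x \<in> B \<longleftrightarrow> x \<in> A"
    unfolding rn_sigma_def
  proof induction
    case (Basic A)
    then obtain g B where g: "g \<in> carrier G" and B: "B \<in> sets borel" and A: "A = rn g -` B \<inter> space X" by auto
    have "{z\<in>space Zmod. ennreal (exp (z (idx g))) \<in> B} \<in> sets Zmod"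
      using B by measurable
    moreover have "AE x in X. pmap x \<in> {z\<in>space Zmod. ennreal (exp (z (idx g))) \<in> B} \<longleftrightarrow> x \<in> A"
      using AE_exp_pmap[OF g] AE_space by eventually_elim (auto simp: A pmap_Zset)
    ultimately show ?case by blast
  next
    case Empty
    show ?case by (rule bexI[of _ "{}"]) auto
  next
    case (Compl A)
    then obtain B where B: "B \<in> sets Zmod" "AE x in X. pmap x \<in> B \<longleftrightarrow> x \<in> A" by blast
    have "AE x in X. pmap x \<in> space Zmod - B \<longleftrightarrow> x \<in> space X - A"
      using B(2) AE_space by eventually_elim (auto simp: pmap_Zset)
    then show ?case using sets.compl_sets[OF B(1)] by (rule bexI)
  next
    case (Union A)
    then have "\<forall>i. \<exists>B. B \<in> sets Zmod \<and> (AE x in X. pmap x \<in> B \<longleftrightarrow> x \<in> A i)" by blast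
    then obtain B where "\<forall>i. B i \<in> sets Zmod \<and> (AE x in X. pmap x \<in> B i \<longleftrightarrow> x \<in> A i)"
      by (rule choice[THEN exE])
    then have B: "\<And>i. B i \<in> sets Zmod" "\<And>i. AE x in X. pmap x \<in> B i \<longleftrightarrow> x \<in> A i" by blast+
    have "AE x in X. \<forall>i. pmap x \<in> B i \<longleftrightarrow> x \<in> A i" using B(2) by (simp add: AE_all_countable)
    then have "AE x in X. pmap x \<in> (\<Union>i. B i) \<longleftrightarrow> x \<in> (\<Union>i. A i)" by eventually_elim auto
    with B(1) show ?case by (intro bexI[of _ "\<Union>i. B i"]) auto
  qed
qed

text \<open>The joint law of the cocycle.\<close>

definition rn_law :: "(nat \<Rightarrow> real) measure" where
  "rn_law = distr X borel (\<lambda>x n. enn2real (rn (enum n) x))"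

lemma emeasure_Zmod:
  assumes B: "B \<in> sets borel"
  shows "emeasure Zmod (B \<inter> Zset) = emeasure rn_law ((\<lambda>z n. ln (z n)) -` B)"
proof -
  have [measurable]: "(\<lambda>x n. enn2real (rn (enum n) x)) \<in> borel_measurable X"
    by (intro measurable_coordinatewise_then_product) measurable
  have ln: "(\<lambda>z n. ln (z n)) \<in> borel_measurable (borel :: (nat \<Rightarrow> real) measure)"
    by (intro measurable_coordinatewise_then_product) measurable
  have BZ: "B \<inter> Zset \<in> sets ZB" using B by (auto simp: ZB_def sets_restrict_space)
  have "emeasure Zmod (B \<inter> Zset) = emeasure X (pmap -` (B \<inter> Zset) \<inter> space X)"
    unfolding Zmod_def by (rule emeasure_distr[OF pmap_measurable BZ])
  also have "\<dots> = emeasure X (logs -` B \<inter> space X)"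
  proof (rule emeasure_eq_AE)
    show "AE x in X. x \<in> pmap -` (B \<inter> Zset) \<inter> space X \<longleftrightarrow> x \<in> logs -` B \<inter> space X"
      using AE_core by eventually_elim (use logs_Zset in \<open>auto simp: pmap_def\<close>)
    show "pmap -` (B \<inter> Zset) \<inter> space X \<in> sets X" by (rule measurable_sets[OF pmap_measurable BZ])
    show "logs -` B \<inter> space X \<in> sets X" by (rule measurable_sets[OF logs_measurable B])
  qed
  also have "logs -` B \<inter> space X = (\<lambda>x n. enn2real (rn (enum n) x)) -` ((\<lambda>z n. ln (z n)) -` B) \<inter> space X"
    by (auto simp: logs_def)
  also have "emeasure X \<dots> = emeasure rn_law ((\<lambda>z n. ln (z n)) -` B)"
    unfolding rn_law_def using measurable_sets[OF ln B] by (subst emeasure_distr) auto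
  finally show ?thesis .
qed

end

lemma rn_model_same_law:
  assumes "rn_model G X actX" "rn_model G Y actY"
    and law: "rn_model.rn_law G X actX = rn_model.rn_law G Y actY"
  shows "\<exists>(Z :: (nat \<Rightarrow> real) measure) actZ p q. RN_factor G X actX Z actZ p \<and> RN_factor G Y actY Z actZ q"
proof -
  interpret X: rn_model G X actX by fact
  interpret Y: rn_model G Y actY by fact
  have "X.Zmod = Y.Zmod"
  proof (rule measure_eqI)
    fix A assume "A \<in> sets X.Zmod"
    then obtain B where B: "B \<in> sets borel" "A = B \<inter> X.Zset"
      by (auto simp: X.ZB_def sets_restrict_space)
    then show "emeasure X.Zmod A = emeasure Y.Zmod A"
      using X.emeasure_Zmod[OF B(1)] Y.emeasure_Zmod[OF B(1)] law by simp
  qed simp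
  then have "RN_factor G Y actY X.Zmod Y.zact Y.pmap" using Y.RN_factor_Zmod by simp
  with X.RN_factor_Zmod show ?thesis by blast
qed

lemma qi_isomorphic_refl: "group G \<Longrightarrow> qi_isomorphic G Z actZ Z actZ"
  unfolding qi_isomorphic_def
  by (rule exI[of _ "\<lambda>x. x"], rule exI[of _ "\<lambda>x. x"]) (simp add: distr_id2)

section \<open>The law of the Radon--Nikodym cocycle\<close>

text \<open>Lipschitz approximations of the indicator function of \<open>{a<..}\<close>.\<close>

definition ramp :: "nat \<Rightarrow> real \<Rightarrow> real \<Rightarrow> real" where
  "ramp k a x = max 0 (min 1 (real k * (x - a)))"

lemma ramp_bounds: "0 \<le> ramp k a x" "ramp k a x \<le> 1"
  by (auto simp: ramp_def)

lemma ramp_lipschitz: "\<bar>ramp k a x - ramp k a y\<bar> \<le> real k * \<bar>x - y\<bar>"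
proof -
  have "\<bar>ramp k a x - ramp k a y\<bar> \<le> \<bar>real k * (x - a) - real k * (y - a)\<bar>"
    by (simp add: ramp_def max_def min_def abs_if)
  also have "\<dots> = real k * \<bar>x - y\<bar>" by (simp add: right_diff_distrib[symmetric] abs_mult)
  finally show ?thesis .
qed

lemma ramp_continuous: "continuous_on UNIV (ramp k a)"
  unfolding ramp_def by (intro continuous_intros)

lemma ramp_measurable[measurable]: "ramp k a \<in> borel_measurable borel"
  by (rule borel_measurable_continuous_onI[OF ramp_continuous])

lemma ramp_tendsto: "(\<lambda>k. ramp k a x) \<longlonglongrightarrow> (if a < x then 1 else 0)"
proof (cases "a < x")
  case True
  obtain K where K: "1 \<le> real K * (x - a)" using True real_arch_simple[of "1 / (x - a)"] by (auto simp: field_simps)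
  have "ramp k a x = 1" if "K \<le> k" for k
  proof -
    have "real K * (x - a) \<le> real k * (x - a)" using that True by (intro mult_right_mono) auto
    with K show ?thesis by (simp add: ramp_def)
  qed
  then have "eventually (\<lambda>k. ramp k a x = 1) sequentially" by (auto simp: eventually_sequentially)
  then show ?thesis using True by (simp add: tendsto_eventually)
next
  case False
  have "ramp k a x = 0" for k
  proof -
    have "real k * (x - a) \<le> 0" using False by (simp add: mult_nonneg_nonpos)
    then show ?thesis by (simp add: ramp_def)
  qed
  then show ?thesis using False by simp
qed

lemma prod_ramp_bounds: "0 \<le> (\<Prod>j\<in>J. ramp k (a j) (f j))" "(\<Prod>j\<in>J. ramp k (a j) (f j)) \<le> 1"
  by (auto intro!: prod_nonneg prod_le_1 simp: ramp_bounds)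

text \<open>The law of a sequence of random variables is determined by the integrals of products of ramps.\<close>

lemma law_eqI:
  fixes f :: "nat \<Rightarrow> 'x \<Rightarrow> real" and h :: "nat \<Rightarrow> 'y \<Rightarrow> real"
  assumes X: "prob_space X" and Y: "prob_space Y"
    and f[measurable]: "\<And>n. f n \<in> borel_measurable X" and h[measurable]: "\<And>n. h n \<in> borel_measurable Y"
    and eq: "\<And>(J :: nat set) k a. finite J \<Longrightarrow>
      (\<integral>x. (\<Prod>j\<in>J. ramp k (a j) (f j x)) \<partial>X) = (\<integral>y. (\<Prod>j\<in>J. ramp k (a j) (h j y)) \<partial>Y)"
  shows "distr X borel (\<lambda>x n. f n x) = distr Y borel (\<lambda>y n. h n y)"
proof -
  define C where "C J a = {z :: nat \<Rightarrow> real. \<forall>j\<in>J. a j < z j}" for J :: "nat set" and a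
  define E where "E = {C J a | J a. finite J}"
  have Cm: "C J a \<in> sets borel" if "finite J" for J a
  proof -
    have "C J a = (\<Inter>j\<in>J. {z\<in>space borel. a j < z j}) \<inter> space borel" by (auto simp: C_def)
    also have "\<dots> \<in> sets borel" using that by (cases "J = {}") (auto intro!: sets.finite_INT sets.Int)
    finally show ?thesis .
  qed
  have gen: "sets (borel :: (nat \<Rightarrow> real) measure) = sigma_sets UNIV E"
  proof (intro equalityI)
    show "sigma_sets UNIV E \<subseteq> sets borel"
      using sets.sigma_sets_subset[of E borel] Cm by (auto simp: E_def)
    let ?S = "sigma UNIV E"
    have S: "sets ?S = sigma_sets UNIV E" "space ?S = UNIV" by simp_all
    have "(\<lambda>z. z n) \<in> borel_measurable ?S" for n
    proof (rule borel_measurableI_greater)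
      fix y :: real
      have "{z\<in>space ?S. y < z n} = C {n} (\<lambda>_. y)" by (auto simp: C_def)
      also have "\<dots> \<in> E" unfolding E_def by blast
      then have "C {n} (\<lambda>_. y) \<in> sets ?S" by simp
      finally show "{z\<in>space ?S. y < z n} \<in> sets ?S" .
    qed
    then have id: "(\<lambda>z. z) \<in> borel_measurable ?S"
      by (intro measurable_coordinatewise_then_product)
    show "sets borel \<subseteq> sigma_sets UNIV E"
    proof
      fix A :: "(nat \<Rightarrow> real) set" assume "A \<in> sets borel"
      from measurable_sets[OF id this] show "A \<in> sigma_sets UNIV E" using S by simp
    qed
  qed
  have meas: "measure (distr M borel (\<lambda>x n. f n x)) (C J a) = lim (\<lambda>k. \<integral>x. (\<Prod>j\<in>J. ramp k (a j) (f j x)) \<partial>M)"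
    if M: "prob_space M" and [measurable]: "\<And>n. f n \<in> borel_measurable M" and J: "finite J"
    for M :: "'z measure" and f :: "nat \<Rightarrow> 'z \<Rightarrow> real" and J a
  proof -
    interpret M: prob_space M by fact
    have F: "(\<lambda>x n. f n x) \<in> borel_measurable M"
      by (intro measurable_coordinatewise_then_product) measurable
    have "(\<lambda>k. \<integral>x. (\<Prod>j\<in>J. ramp k (a j) (f j x)) \<partial>M) \<longlonglongrightarrow> (\<integral>x. (\<Prod>j\<in>J. if a j < f j x then 1 else 0 :: real) \<partial>M)"
    proof (rule integral_dominated_convergence[where w="\<lambda>_. 1"])
      show "AE x in M. (\<lambda>k. \<Prod>j\<in>J. ramp k (a j) (f j x)) \<longlonglongrightarrow> (\<Prod>j\<in>J. if a j < f j x then 1 else 0)"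
        by (intro AE_I2 tendsto_prod ramp_tendsto)
    qed (auto simp: prod_ramp_bounds)
    moreover have "(\<Prod>j\<in>J. if a j < f j x then 1 else 0) = (indicator {x\<in>space M. \<forall>j\<in>J. a j < f j x} x :: real)"
      if "x \<in> space M" for x
      using J that by (auto simp: indicator_def intro!: prod.neutral)
    then have "(\<integral>x. (\<Prod>j\<in>J. if a j < f j x then 1 else 0 :: real) \<partial>M) = (\<integral>x. indicator {x\<in>space M. \<forall>j\<in>J. a j < f j x} x \<partial>M)"
      by (intro Bochner_Integration.integral_cong) auto
    moreover have "{x\<in>space M. \<forall>j\<in>J. a j < f j x} = (\<lambda>x n. f n x) -` C J a \<inter> space M"
      by (auto simp: C_def)
    moreover have "measure (distr M borel (\<lambda>x n. f n x)) (C J a) = measure M ((\<lambda>x n. f n x) -` C J a \<inter> space M)"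
      by (rule measure_distr[OF F Cm[OF J]])
    ultimately show ?thesis by (simp add: limI Int_absorb2)
  qed
  have F: "(\<lambda>x n. f n x) \<in> borel_measurable X" "(\<lambda>x n. h n x) \<in> borel_measurable Y"
    by (intro measurable_coordinatewise_then_product; measurable)+
  interpret DX: prob_space "distr X borel (\<lambda>x n. f n x)" by (rule prob_space.prob_space_distr[OF X F(1)])
  interpret DY: prob_space "distr Y borel (\<lambda>x n. h n x)" by (rule prob_space.prob_space_distr[OF Y F(2)])
  show ?thesis
  proof (rule measure_eqI_generator_eq[of E UNIV _ _ "\<lambda>_. UNIV"])
    show "Int_stable E"
    proof (unfold Int_stable_def E_def, safe)
      fix J K :: "nat set" and a b assume fin: "finite J" "finite K"
      have "C J a \<inter> C K b = C (J \<union> K) (\<lambda>j. if j \<in> J \<inter> K then max (a j) (b j) else if j \<in> J then a j else b j)"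
        by (auto simp: C_def split: if_splits)
      then show "\<exists>Ja aa. C J a \<inter> C K b = C Ja aa \<and> finite Ja" using fin by blast
    qed
    show "E \<subseteq> Pow UNIV" by simp
    have "UNIV = C {} (\<lambda>_. 0)" by (auto simp: C_def)
    then show "range (\<lambda>_. UNIV) \<subseteq> E" unfolding E_def by blast
    fix S assume "S \<in> E"
    then obtain J a where J: "finite J" "S = C J a" by (auto simp: E_def)
    show "emeasure (distr X borel (\<lambda>x n. f n x)) S = emeasure (distr Y borel (\<lambda>x n. h n x)) S"
      unfolding DX.emeasure_eq_measure DY.emeasure_eq_measure J(2)
      using meas[OF X f J(1)] meas[OF Y h J(1)] eq[OF J(1)] by simp
  qed (use gen DX.emeasure_space_1 in auto)
qed

context ultra_action begin

lemma law_UL: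
  fixes \<nu> :: "'s measure" and \<rho> :: "'a \<Rightarrow> 's \<Rightarrow> real" and e :: "nat \<Rightarrow> 'a"
  assumes N: "prob_space \<nu>" and rho: "\<And>g. g \<in> carrier G \<Longrightarrow> \<rho> g \<in> borel_measurable \<nu>"
    and e: "\<And>n. e n \<in> carrier G"
    and conv: "\<And>(J :: nat set) k a. finite J \<Longrightarrow>
      ((\<lambda>i. \<integral>x. (\<Prod>j\<in>J. ramp k (a j) (r (e j) i x)) \<partial>X i) \<longlongrightarrow>
        (\<integral>s. (\<Prod>j\<in>J. ramp k (a j) (\<rho> (e j) s)) \<partial>\<nu>)) U"
  shows "distr UL borel (\<lambda>c n. hat (r (e n)) c) = distr \<nu> borel (\<lambda>s n. \<rho> (e n) s)"
proof (rule law_eqI[OF prob_UL N])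
  show "hat (r (e n)) \<in> borel_measurable UL" for n
    using hat_measurable[of "r (e n)" 0 "b (e n)"] r_meas[OF e] r_bd[OF e] by blast
  show "\<rho> (e n) \<in> borel_measurable \<nu>" for n by (rule rho[OF e])
  fix J :: "nat set" and k a assume J: "finite J"
  let ?f = "\<lambda>i x. \<Prod>j\<in>J. ramp k (a j) (r (e j) i x)"
  have fm: "?f i \<in> borel_measurable (X i)" for i
    using r_meas[OF e] by (intro borel_measurable_prod measurable_compose[OF _ ramp_measurable])
  have "((\<lambda>i. \<integral>x. ?f i x \<partial>X i) \<longlongrightarrow> (\<integral>c. hat ?f c \<partial>UL)) U"
    by (rule hat_integral[OF fm, of 1]) (auto simp: prod_ramp_bounds)
  then have "(\<integral>c. hat ?f c \<partial>UL) = (\<integral>s. (\<Prod>j\<in>J. ramp k (a j) (\<rho> (e j) s)) \<partial>\<nu>)"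
    using conv[OF J] tendsto_unique[OF not_bot] by blast
  moreover have "(\<integral>c. hat ?f c \<partial>UL) = (\<integral>c. (\<Prod>j\<in>J. ramp k (a j) (hat (r (e j)) c)) \<partial>UL)"
  proof (rule Bochner_Integration.integral_cong[OF refl])
    fix c assume "c \<in> space UL"
    then obtain x where x: "x \<in> pts" "c = cls x" by (auto simp: space_UL)
    have "((\<lambda>i. r (e j) i (x i)) \<longlongrightarrow> hat (r (e j)) c) U" for j
      unfolding x(2) by (rule tendsto_hat(1)[OF x(1), of 0 _ "b (e j)"]) (use r_bd[OF e] in auto)
    then have "((\<lambda>i. ramp k (a j) (r (e j) i (x i))) \<longlongrightarrow> ramp k (a j) (hat (r (e j)) c)) U" for j
      by (rule continuous_on_tendsto_compose[OF ramp_continuous]) auto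
    then have "((\<lambda>i. ?f i (x i)) \<longlongrightarrow> (\<Prod>j\<in>J. ramp k (a j) (hat (r (e j)) c))) U"
      by (intro tendsto_prod)
    then show "hat ?f c = (\<Prod>j\<in>J. ramp k (a j) (hat (r (e j)) c))"
      unfolding x(2) by (rule hat_cls[OF x(1)])
  qed
  ultimately show "(\<integral>c. (\<Prod>j\<in>J. ramp k (a j) (hat (r (e j)) c)) \<partial>UL) = (\<integral>s. (\<Prod>j\<in>J. ramp k (a j) (\<rho> (e j) s)) \<partial>\<nu>)"
    by simp
qed

text \<open>If the approximate derivatives converge in law to the cocycle of \<open>\<nu>\<close>, then \<open>\<nu>\<close> and the
  ultralimit have the same Radon--Nikodym factor. Convergence is tested on products of ramps.\<close>

theorem RN_factors_isomorphic:
  fixes \<nu> :: "'s measure" and \<rho> :: "'a \<Rightarrow> 's \<Rightarrow> real" and actS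
  assumes cnt: "countable (carrier G)" and N: "qi_space G \<nu> actS"
    and rho: "\<And>g. g \<in> carrier G \<Longrightarrow> \<rho> g \<in> borel_measurable \<nu>" "\<And>g s. g \<in> carrier G \<Longrightarrow> 0 \<le> \<rho> g s"
      "\<And>g. g \<in> carrier G \<Longrightarrow> density \<nu> (\<lambda>s. ennreal (\<rho> g s)) = distr \<nu> \<nu> (actS g)"
    and conv: "\<And>(J :: nat set) k a e. finite J \<Longrightarrow> (\<And>n. e n \<in> carrier G) \<Longrightarrow>
      ((\<lambda>i. \<integral>x. (\<Prod>j\<in>J. ramp k (a j) (r (e j) i x)) \<partial>X i) \<longlongrightarrow>
        (\<integral>s. (\<Prod>j\<in>J. ramp k (a j) (\<rho> (e j) s)) \<partial>\<nu>)) U"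
  shows "\<exists>(Z :: (nat \<Rightarrow> real) measure) actZ p (W :: (nat \<Rightarrow> real) measure) actW q.
        RN_factor G \<nu> actS Z actZ p \<and> RN_factor G (ultralimit U X) uact W actW q \<and>
        qi_isomorphic G Z actZ W actW"
proof -
  interpret A: rn_model G \<nu> actS
    using N cnt qi_space_measurable_action[OF group_axioms N]
    by (simp add: rn_model_def rn_model_axioms_def)
  interpret B: rn_model G UL uact
    using qi_UL cnt uact_measurable_action
    by (simp add: rn_model_def rn_model_axioms_def)
  have m: "hat (r g) \<in> borel_measurable UL" "\<And>c. c \<in> space UL \<Longrightarrow> 0 \<le> hat (r g) c" if "g \<in> carrier G" for g
    using hat_measurable[of "r g" 0 "b g"] tendsto_hat(2)[of _ 0 "r g" "b g"] r_meas[OF that] r_bd[OF that]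
    by (auto simp: space_UL)
  have "A.rn_law = distr \<nu> borel (\<lambda>s n. \<rho> (A.enum n) s)"
    unfolding A.rn_law_def
  proof (rule distr_cong_AE)
    have "AE s in \<nu>. A.rn (A.enum n) s = ennreal (\<rho> (A.enum n) s)" for n
      using rho A.enum_carrier by (intro A.rn_unique) auto
    then have "AE s in \<nu>. \<forall>n. A.rn (A.enum n) s = ennreal (\<rho> (A.enum n) s)" by (simp add: AE_all_countable)
    then show "AE s in \<nu>. (\<lambda>n. enn2real (A.rn (A.enum n) s)) = (\<lambda>n. \<rho> (A.enum n) s)"
      by eventually_elim (simp add: rho A.enum_carrier)
  qed (auto intro!: measurable_coordinatewise_then_product rho A.enum_carrier)
  also have "\<dots> = distr UL borel (\<lambda>c n. hat (r (A.enum n)) c)"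
    by (rule law_UL[where e=A.enum and \<rho>=\<rho>, symmetric]) (use A.prob rho A.enum_carrier conv in auto)
  also have "\<dots> = B.rn_law"
    unfolding B.rn_law_def
  proof (rule distr_cong_AE)
    have "AE c in UL. \<forall>n. B.rn (A.enum n) c = ennreal (hat (r (A.enum n)) c)"
      unfolding AE_all_countable using rn_cocycle_UL[OF A.enum_carrier] by blast
    with AE_space show "AE c in UL. (\<lambda>n. hat (r (A.enum n)) c) = (\<lambda>n. enn2real (B.rn (B.enum n) c))"
      by eventually_elim (use m(2)[OF A.enum_carrier] in simp)
  qed (auto intro!: measurable_coordinatewise_then_product m A.enum_carrier)
  finally have "A.rn_law = B.rn_law" .
  then obtain Z :: "(nat \<Rightarrow> real) measure" and actZ p q where
    "RN_factor G \<nu> actS Z actZ p" "RN_factor G UL uact Z actZ q"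
    using rn_model_same_law[OF A.rn_model_axioms B.rn_model_axioms] by blast
  then show ?thesis using qi_isomorphic_refl[OF group_axioms] unfolding UL_def by blast
qed

end

section \<open>Averages of measures over the group\<close>

text \<open>With \<open>m\<^sub>0\<close> of full support, \<open>m = \<Sum>\<^sub>n 2\<^sup>-\<^sup>n\<^sup>-\<^sup>1 m\<^sub>0\<^sup>*\<^sup>n\<close> satisfies \<open>m\<^sub>0 * m \<le> 2 m\<close>, hence
  \<open>m(g\<^sup>-\<^sup>1h) \<le> 2/m\<^sub>0(g) m(h)\<close>.\<close>

lemma (in group) ex_weight:
  assumes count: "countable (carrier G)"
  shows "\<exists>(m :: 'a pmf) M. set_pmf m = carrier G \<and>
    (\<forall>g\<in>carrier G. 1 \<le> M g \<and> (\<forall>h\<in>carrier G. pmf m (inv g \<otimes> h) \<le> M g * pmf m h))"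
proof -
  have ne: "carrier G \<noteq> {}" by auto
  define geo :: "nat pmf" where "geo = geometric_pmf (1/2)"
  define m0 where "m0 = map_pmf (from_nat_into (carrier G)) geo"
  have m0: "set_pmf m0 = carrier G"
    using range_from_nat_into[OF ne count] by (simp add: m0_def geo_def set_pmf_geometric)
  define F where "F Q = bind_pmf m0 (\<lambda>x. map_pmf (\<lambda>y. x \<otimes> y) Q)" for Q
  define P where "P n = (F ^^ n) (return_pmf \<one>)" for n
  define m where "m = bind_pmf geo P"
  have Psub: "set_pmf (P n) \<subseteq> carrier G" for n
    by (induction n) (auto simp: P_def F_def m0)
  have "P 1 = m0" unfolding P_def F_def
    using map_pmf_cong[of m0 m0 "\<lambda>x. x \<otimes> \<one>" "\<lambda>x. x"] m0 by (simp add: map_pmf_def[symmetric])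
  then have "set_pmf m = carrier G"
    using Psub m0 by (auto simp: m_def geo_def set_pmf_geometric)
  have step: "ennreal (pmf m0 g) * ennreal (pmf (P n) (inv g \<otimes> h)) \<le> ennreal (pmf (P (Suc n)) h)"
    if g: "g \<in> carrier G" and h: "h \<in> carrier G" for g h n
  proof -
    have "pmf (P n) (inv g \<otimes> h) \<le> pmf (map_pmf (\<lambda>y. g \<otimes> y) (P n)) h"
      unfolding pmf_map pmf.rep_eq[of "P n"] using g h
      by (intro measure_pmf.finite_measure_mono) (auto simp: m_assoc[symmetric])
    then have "ennreal (pmf m0 g) * ennreal (pmf (P n) (inv g \<otimes> h)) \<le>
       ennreal (pmf (map_pmf (\<lambda>y. g \<otimes> y) (P n)) h) * ennreal (pmf m0 g)"
      by (subst mult.commute) (intro mult_right_mono ennreal_leI, simp_all)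
    also have "\<dots> = (\<integral>\<^sup>+x. ennreal (pmf (map_pmf (\<lambda>y. g \<otimes> y) (P n)) h) * indicator {g} x \<partial>m0)"
      by (subst nn_integral_cmult_indicator) (simp_all add: emeasure_pmf_single)
    also have "\<dots> \<le> (\<integral>\<^sup>+x. ennreal (pmf (map_pmf (\<lambda>y. x \<otimes> y) (P n)) h) \<partial>m0)"
      by (intro nn_integral_mono) (auto simp: indicator_def)
    also have "\<dots> = ennreal (pmf (P (Suc n)) h)"
      by (simp add: P_def F_def ennreal_pmf_bind)
    finally show ?thesis .
  qed
  have series: "ennreal (pmf m h) = (\<Sum>n. ennreal (pmf geo n) * ennreal (pmf (P n) h))" for h
    by (simp add: m_def ennreal_pmf_bind nn_integral_measure_pmf nn_integral_count_space_nat)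
  have bound: "pmf m (inv g \<otimes> h) \<le> (2 / pmf m0 g) * pmf m h"
    if g: "g \<in> carrier G" and h: "h \<in> carrier G" for g h
  proof -
    have p: "0 < pmf m0 g" using m0 g by (simp add: pmf_positive)
    have "ennreal (pmf m0 g / 2) * ennreal (pmf m (inv g \<otimes> h)) =
       (\<Sum>n. ennreal (pmf m0 g / 2) * (ennreal (pmf geo n) * ennreal (pmf (P n) (inv g \<otimes> h))))"
      unfolding series by simp
    also have "\<dots> \<le> (\<Sum>n. ennreal (pmf geo (Suc n)) * ennreal (pmf (P (Suc n)) h))"
    proof (intro suminf_le summableI)
      fix n
      have "ennreal (pmf m0 g / 2) * (ennreal (pmf geo n) * ennreal (pmf (P n) (inv g \<otimes> h))) =
        ennreal (pmf geo (Suc n)) * (ennreal (pmf m0 g) * ennreal (pmf (P n) (inv g \<otimes> h)))"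
        by (simp add: geo_def ennreal_mult[symmetric] field_simps)
      also have "\<dots> \<le> ennreal (pmf geo (Suc n)) * ennreal (pmf (P (Suc n)) h)"
        by (intro mult_left_mono step g h) auto
      finally show "ennreal (pmf m0 g / 2) * (ennreal (pmf geo n) * ennreal (pmf (P n) (inv g \<otimes> h))) \<le>
        ennreal (pmf geo (Suc n)) * ennreal (pmf (P (Suc n)) h)" .
    qed
    also have "\<dots> \<le> ennreal (pmf m h)"
      unfolding series by (subst (2) suminf_offset[of _ 1]) (auto intro: summableI)
    finally have "pmf m0 g / 2 * pmf m (inv g \<otimes> h) \<le> pmf m h"
      by (simp add: ennreal_mult[symmetric] p)
    then show ?thesis using p by (simp add: field_simps)
  qed
  have "1 \<le> 2 / pmf m0 g" if "g \<in> carrier G" for g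
  proof -
    have "0 < pmf m0 g" using m0 that by (simp add: pmf_positive)
    then show ?thesis using pmf_le_1[of m0 g] by (simp add: field_simps)
  qed
  with bound \<open>set_pmf m = carrier G\<close> show ?thesis
    by (intro exI[of _ m] exI[of _ "\<lambda>g. 2 / pmf m0 g"]) auto
qed

text \<open>A probability measure on the group whose translates are dominated by its multiples.\<close>

locale group_weight = group G for G (structure) +
  fixes m :: "'a pmf" and M :: "'a \<Rightarrow> real"
  assumes set_m: "set_pmf m = carrier G"
    and M1: "\<And>g. g \<in> carrier G \<Longrightarrow> 1 \<le> M g"
    and mM: "\<And>g h. g \<in> carrier G \<Longrightarrow> h \<in> carrier G \<Longrightarrow> pmf m (inv g \<otimes> h) \<le> M g * pmf m h"
begin

lemma pmf_shift:
  assumes g: "g \<in> carrier G"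
  shows "pmf (map_pmf (\<lambda>k. g \<otimes> k) m) h \<le> M g * pmf m h"
proof (cases "h \<in> carrier G")
  case True
  have "pmf (map_pmf (\<lambda>k. g \<otimes> k) m) h = measure m ((\<lambda>k. g \<otimes> k) -` {h} \<inter> set_pmf m)"
    by (simp add: pmf_map measure_Int_set_pmf)
  also have "(\<lambda>k. g \<otimes> k) -` {h} \<inter> set_pmf m = {inv g \<otimes> h}"
    using g True set_m by (auto simp: m_assoc[symmetric])
  also have "measure m {inv g \<otimes> h} = pmf m (inv g \<otimes> h)" by (simp add: pmf.rep_eq)
  also have "\<dots> \<le> M g * pmf m h" using mM[OF g True] .
  finally show ?thesis .
next
  case False
  then have "h \<notin> set_pmf (map_pmf (\<lambda>k. g \<otimes> k) m)" using g set_m by auto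
  then have "pmf (map_pmf (\<lambda>k. g \<otimes> k) m) h = 0" unfolding pmf_eq_0_set_pmf .
  then show ?thesis using M1[OF g] by simp
qed

lemma nn_integral_shift:
  assumes g: "g \<in> carrier G"
  shows "(\<integral>\<^sup>+k. u (g \<otimes> k) \<partial>m) \<le> ennreal (M g) * (\<integral>\<^sup>+k. u k \<partial>m)"
proof -
  have "(\<integral>\<^sup>+k. u (g \<otimes> k) \<partial>m) = (\<integral>\<^sup>+k. u k \<partial>map_pmf (\<lambda>k. g \<otimes> k) m)" by simp
  also have "\<dots> = (\<integral>\<^sup>+k. ennreal (pmf (map_pmf (\<lambda>k. g \<otimes> k) m) k) * u k \<partial>count_space UNIV)"
    by (rule nn_integral_measure_pmf)
  also have "\<dots> \<le> (\<integral>\<^sup>+k. ennreal (M g) * (ennreal (pmf m k) * u k) \<partial>count_space UNIV)"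
  proof (intro nn_integral_mono)
    fix k
    have "ennreal (pmf (map_pmf (\<lambda>k. g \<otimes> k) m) k) \<le> ennreal (M g) * ennreal (pmf m k)"
      using pmf_shift[OF g, of k] M1[OF g] by (subst ennreal_mult[symmetric]) (auto intro: ennreal_leI)
    then show "ennreal (pmf (map_pmf (\<lambda>k. g \<otimes> k) m) k) * u k \<le> ennreal (M g) * (ennreal (pmf m k) * u k)"
      by (subst mult.assoc[symmetric]) (rule mult_right_mono, simp_all)
  qed
  also have "\<dots> = ennreal (M g) * (\<integral>\<^sup>+k. u k \<partial>m)"
    by (simp add: nn_integral_cmult nn_integral_measure_pmf)
  finally show ?thesis .
qed

lemma integral_shift:
  assumes g: "g \<in> carrier G" and u: "\<And>k. 0 \<le> u k" "\<And>k. u k \<le> B"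
  shows "(\<integral>k. u (g \<otimes> k) \<partial>m) \<le> M g * (\<integral>k. u k \<partial>m)"
proof -
  have i: "integrable m u" "integrable m (\<lambda>k. u (g \<otimes> k))"
    using u by (auto intro!: measure_pmf.integrable_const_bound[where B=B])
  have "ennreal (\<integral>k. u (g \<otimes> k) \<partial>m) = (\<integral>\<^sup>+k. ennreal (u (g \<otimes> k)) \<partial>m)"
    using u by (intro nn_integral_eq_integral[symmetric] i) auto
  also have "\<dots> \<le> ennreal (M g) * (\<integral>\<^sup>+k. ennreal (u k) \<partial>m)" by (rule nn_integral_shift[OF g])
  also have "(\<integral>\<^sup>+k. ennreal (u k) \<partial>m) = ennreal (\<integral>k. u k \<partial>m)"
    using u by (intro nn_integral_eq_integral i) auto
  finally show ?thesis
    using M1[OF g] u by (simp add: ennreal_mult[symmetric] integral_nonneg_AE)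
qed

text \<open>The average \<open>\<Sum>\<^sub>k m(k) kX\<close> of the translates of a measure. The value of the kernel off
  \<open>carrier G\<close> is irrelevant, because \<open>m\<close> lives on \<open>carrier G\<close>.\<close>

definition average :: "'x measure \<Rightarrow> ('a \<Rightarrow> 'x \<Rightarrow> 'x) \<Rightarrow> 'x measure" where
  "average X act = measure_pmf m \<bind> (\<lambda>k. if k \<in> carrier G then distr X X (act k) else X)"

end

locale weighted_action = group_weight G m M + measurable_action G X act
  for G (structure) and m :: "'a pmf" and M and X :: "'x measure" and act
begin

interpretation X: prob_space X by (rule prob)

lemma kernel: "(\<lambda>k. if k \<in> carrier G then distr X X (act k) else X) \<in> measure_pmf m \<rightarrow>\<^sub>M subprob_algebra X"
proof -
  have "(if k \<in> carrier G then distr X X (act k) else X) \<in> space (subprob_algebra X)" for k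
    using X.prob_space_distr[OF act_measurable] prob
    by (cases "k \<in> carrier G") (simp_all add: space_subprob_algebra prob_space_imp_subprob_space)
  then show ?thesis by simp
qed

lemma sets_average[simp]: "sets (average X act) = sets X"
  unfolding average_def by (rule sets_bind_measurable[OF kernel]) simp

lemma space_average[simp]: "space (average X act) = space X"
  by (rule sets_eq_imp_space_eq) simp

lemma emeasure_average:
  assumes A: "A \<in> sets X"
  shows "emeasure (average X act) A = (\<integral>\<^sup>+k. emeasure X (act k -` A \<inter> space X) \<partial>m)"
  unfolding average_def emeasure_bind[OF _ kernel A, simplified]
  by (intro nn_integral_cong_AE AE_pmfI) (simp add: set_m emeasure_distr act_measurable A)

lemma prob_average: "prob_space (average X act)"
proof
  have "emeasure (average X act) (space X) = (\<integral>\<^sup>+k. 1 \<partial>m)"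
    unfolding emeasure_average[OF sets.top]
  proof (intro nn_integral_cong_AE AE_pmfI)
    fix k assume "k \<in> set_pmf m"
    then have "act k -` space X \<inter> space X = space X" using act_space set_m by auto
    then show "emeasure X (act k -` space X \<inter> space X) = 1" by (simp add: X.emeasure_space_1)
  qed
  then show "emeasure (average X act) (space (average X act)) = 1"
    by (simp add: measure_pmf.emeasure_space_1)
qed

lemma integral_average:
  fixes u :: "'x \<Rightarrow> real"
  assumes u: "u \<in> borel_measurable X" and B: "\<And>x. x \<in> space X \<Longrightarrow> \<bar>u x\<bar> \<le> B"
  shows "(\<integral>x. u x \<partial>average X act) = (\<integral>k. (\<integral>x. u (act k x) \<partial>X) \<partial>m)"
proof -
  have "(\<integral>x. u x \<partial>average X act) = (\<integral>k. (\<integral>x. u x \<partial>(if k \<in> carrier G then distr X X (act k) else X)) \<partial>m)"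
    unfolding average_def
  proof (rule integral_bind[where K=X and B=B and B'=1])

    show "AE k in m. emeasure (if k \<in> carrier G then distr X X (act k) else X)
        (space (if k \<in> carrier G then distr X X (act k) else X)) \<le> ennreal 1"
    proof (intro AE_pmfI)
      fix k
      have "subprob_space (if k \<in> carrier G then distr X X (act k) else X)"
        using measurable_space[OF kernel, of k] unfolding space_subprob_algebra by simp
      from subprob_space.emeasure_space_le_1[OF this]
      show "emeasure (if k \<in> carrier G then distr X X (act k) else X)
        (space (if k \<in> carrier G then distr X X (act k) else X)) \<le> ennreal 1" by simp
    qed
  qed (use kernel u B in \<open>auto simp: measure_pmf.finite_measure_axioms\<close>)
  also have "\<dots> = (\<integral>k. (\<integral>x. u (act k x) \<partial>X) \<partial>m)"
    by (intro integral_cong_AE AE_pmfI) (auto simp: set_m integral_distr act_measurable u)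
  finally show ?thesis .
qed

lemma average_action: "measurable_action G (average X act) act"
  using prob_average ga act_measurable group_axioms
  by (simp add: measurable_action_def measurable_action_axioms_def cong: measurable_cong_sets)

lemma average_bound:
  assumes g: "g \<in> carrier G" and A: "A \<in> sets X"
  shows "emeasure (distr (average X act) (average X act) (act g)) A \<le> ennreal (M g) * emeasure (average X act) A"
proof -
  interpret C: measurable_action G "average X act" act by (rule average_action)
  have "emeasure (distr (average X act) (average X act) (act g)) A = emeasure (average X act) (act g -` A \<inter> space X)"
    using g A by (subst C.emeasure_translate) auto
  also have "\<dots> = (\<integral>\<^sup>+k. emeasure X (act k -` (act g -` A \<inter> space X) \<inter> space X) \<partial>m)"
    by (rule emeasure_average[OF act_vimage_sets[OF g A]])
  also have "\<dots> = (\<integral>\<^sup>+k. emeasure X (act (g \<otimes> k) -` A \<inter> space X) \<partial>m)"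
    by (intro nn_integral_cong_AE AE_pmfI) (simp only: set_m act_vimage_mult[OF g])
  also have "\<dots> \<le> ennreal (M g) * (\<integral>\<^sup>+k. emeasure X (act k -` A \<inter> space X) \<partial>m)"
    by (rule nn_integral_shift[OF g])
  finally show ?thesis by (simp add: emeasure_average[OF A])
qed

lemma average_bqi: "qi_space G (average X act) act" "bqi_bound G M (average X act) act"
proof -
  interpret C: measurable_action G "average X act" act by (rule average_action)
  show "qi_space G (average X act) act" by (rule C.qi_of_bound[where b=M]) (use average_bound in auto)
  show "bqi_bound G M (average X act) act" unfolding bqi_bound_def using average_bound M1 by auto
qed

lemma null_sets_average:
  assumes "qi_space G X act"
  shows "null_sets (average X act) = null_sets X"
proof -
  have n: "act k -` A \<inter> space X \<in> null_sets X \<longleftrightarrow> A \<in> null_sets X" if "k \<in> carrier G" "A \<in> sets X" for k A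
  proof -
    have "A \<in> null_sets (distr X X (act k)) \<longleftrightarrow> act k -` A \<inter> space X \<in> null_sets X"
      using that emeasure_translate[OF that] act_vimage_sets[OF that] by (auto simp: null_sets_def)
    then show ?thesis using assms that by (simp add: qi_space_def)
  qed
  have "emeasure (average X act) A = 0 \<longleftrightarrow> emeasure X A = 0" if A: "A \<in> sets X" for A
  proof -
    have "emeasure (average X act) A = 0 \<longleftrightarrow> (\<forall>k\<in>set_pmf m. emeasure X (act k -` A \<inter> space X) = 0)"
      by (simp add: emeasure_average[OF A] nn_integral_0_iff_AE AE_measure_pmf_iff)
    also have "\<dots> \<longleftrightarrow> (\<forall>k\<in>carrier G. emeasure X A = 0)"
      using n[OF _ A] A act_vimage_sets[OF _ A] by (auto simp: set_m null_sets_def)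
    finally show ?thesis by auto
  qed
  then show ?thesis by (auto simp: null_sets_def)
qed

end

section \<open>Separation of convex sets of bounded functions\<close>

text \<open>The smoothed absolute value \<open>sqrt (x\<^sup>2 + d\<^sup>2)\<close> lies below its quadratic Taylor majorant.\<close>

lemma sqrt_smooth_upper:
  fixes x y d :: real assumes d: "0 < d"
  shows "sqrt (y\<^sup>2 + d\<^sup>2) \<le> sqrt (x\<^sup>2 + d\<^sup>2) + x / sqrt (x\<^sup>2 + d\<^sup>2) * (y - x) + (y - x)\<^sup>2 / (2 * d)"
proof -
  let ?s = "sqrt (x\<^sup>2 + d\<^sup>2)"
  have s: "d \<le> ?s" "0 < ?s" using d by (auto intro: real_le_rsqrt simp: add_nonneg_pos)
  have s2: "?s\<^sup>2 = x\<^sup>2 + d\<^sup>2" by simp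
  have "sqrt (y\<^sup>2 + d\<^sup>2) \<le> (y\<^sup>2 + d\<^sup>2 + ?s\<^sup>2) / (2 * ?s)"
  proof -
    have "0 \<le> (sqrt (y\<^sup>2 + d\<^sup>2) - ?s)\<^sup>2" by simp
    then have "2 * ?s * sqrt (y\<^sup>2 + d\<^sup>2) \<le> y\<^sup>2 + d\<^sup>2 + ?s\<^sup>2"
      by (simp add: power2_diff algebra_simps)
    then show ?thesis using s by (simp add: field_simps)
  qed
  also have "\<dots> = ?s + x / ?s * (y - x) + (y - x)\<^sup>2 / (2 * ?s)"
  proof -
    have "(y\<^sup>2 + d\<^sup>2 + ?s\<^sup>2) / (2 * ?s) = (2 * ?s\<^sup>2 + 2 * x * (y - x) + (y - x)\<^sup>2) / (2 * ?s)"
      unfolding s2 by (simp add: power2_eq_square algebra_simps)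
    also have "\<dots> = ?s + x / ?s * (y - x) + (y - x)\<^sup>2 / (2 * ?s)"
    proof -
      have "(2 * r\<^sup>2 + 2 * x * (y - x) + (y - x)\<^sup>2) / (2 * r) = r + x / r * (y - x) + (y - x)\<^sup>2 / (2 * r)"
        if "0 < r" for r :: real
        using that by (simp add: add_divide_distrib power2_eq_square)
      then show ?thesis using s(2) by blast
    qed
    finally show ?thesis .
  qed
  also have "(y - x)\<^sup>2 / (2 * ?s) \<le> (y - x)\<^sup>2 / (2 * d)"
    using s d by (intro divide_left_mono) auto
  finally show ?thesis by simp
qed

lemma sqrt_smooth_lower:
  fixes x d :: real assumes d: "0 < d"
  shows "\<bar>x\<bar> - d \<le> x / sqrt (x\<^sup>2 + d\<^sup>2) * x" "\<bar>x / sqrt (x\<^sup>2 + d\<^sup>2)\<bar> \<le> 1"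
proof -
  let ?s = "sqrt (x\<^sup>2 + d\<^sup>2)"
  have s: "\<bar>x\<bar> \<le> ?s" "0 < ?s" using d by (auto intro: real_le_rsqrt simp: add_nonneg_pos)
  have "?s \<le> \<bar>x\<bar> + d"
    using d by (intro real_le_lsqrt) (auto simp: power2_sum)
  then have "(\<bar>x\<bar> - d) * ?s \<le> \<bar>x\<bar> * \<bar>x\<bar>"
  proof (cases "d \<le> \<bar>x\<bar>")
    case True
    with \<open>?s \<le> \<bar>x\<bar> + d\<close> have "(\<bar>x\<bar> - d) * ?s \<le> (\<bar>x\<bar> - d) * (\<bar>x\<bar> + d)" by (intro mult_left_mono) auto
    also have "\<dots> \<le> \<bar>x\<bar> * \<bar>x\<bar>" by (simp add: algebra_simps)
    finally show ?thesis .
  next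
    case False
    then have "(\<bar>x\<bar> - d) * ?s \<le> 0" using s by (intro mult_nonpos_nonneg) auto
    then show ?thesis by (smt (verit) zero_le_square)
  qed
  then have "\<bar>x\<bar> - d \<le> \<bar>x\<bar> * \<bar>x\<bar> / ?s" using s by (simp only: pos_le_divide_eq)
  then show "\<bar>x\<bar> - d \<le> x / ?s * x" by simp
  show "\<bar>x / ?s\<bar> \<le> 1" using s by simp
qed

text \<open>A convex set of tuples of functions with values in \<open>[-1, 1]\<close> that stays away from \<open>0\<close> in
  \<open>L\<^sup>1\<close> is separated from \<open>0\<close> by a tuple of functions with values in \<open>[-1, 1]\<close>. The separating
  tuple is the gradient of a smoothed norm at an almost minimal point \<open>x0\<close>.\<close>

lemma (in prob_space) convex_separation:
  fixes K :: "('i \<Rightarrow> 'a \<Rightarrow> real) set"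
  assumes I: "finite I" and e: "0 < e"
    and meas: "\<And>x i. x \<in> K \<Longrightarrow> i \<in> I \<Longrightarrow> x i \<in> borel_measurable M"
    and bd: "\<And>x i s. x \<in> K \<Longrightarrow> i \<in> I \<Longrightarrow> s \<in> space M \<Longrightarrow> \<bar>x i s\<bar> \<le> 1"
    and cvx: "\<And>x y t. x \<in> K \<Longrightarrow> y \<in> K \<Longrightarrow> 0 \<le> t \<Longrightarrow> t \<le> 1 \<Longrightarrow> (\<lambda>i s. (1 - t) * x i s + t * y i s) \<in> K"
    and far: "\<And>x. x \<in> K \<Longrightarrow> e \<le> (\<Sum>i\<in>I. \<integral>s. \<bar>x i s\<bar> \<partial>M)"
  shows "\<exists>f. (\<forall>i\<in>I. f i \<in> borel_measurable M) \<and> (\<forall>i s. \<bar>f i s\<bar> \<le> 1) \<and>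
    (\<forall>y\<in>K. e / 2 \<le> (\<Sum>i\<in>I. \<integral>s. f i s * y i s \<partial>M))"
proof (cases "K = {}")
  case True
  then show ?thesis by (intro exI[of _ "\<lambda>_ _. 0"]) auto
next
  case False
  define n where "n = real (card I)"
  have n0: "0 \<le> n" by (simp add: n_def)
  \<comment> \<open>the smoothing scale \<open>d\<close>, and the step \<open>t\<close> from \<open>x0\<close> towards another point, each cost at most \<open>e / 4\<close>\<close>
  define d where "d = e / (4 * (n + 1))"
  have d: "0 < d" using e n0 by (simp add: d_def)
  have nd: "n * d \<le> e / 4" using e n0 by (simp add: d_def field_simps)
  define C where "C = n * (4 / (2 * d))"
  have C0: "0 \<le> C" using n0 d by (simp add: C_def)
  define t where "t = min 1 (e / (4 * (1 + C)))"
  have t: "0 < t" "t \<le> 1" using e C0 by (auto simp: t_def)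
  have tC: "t * (1 + C) \<le> e / 4"
  proof -
    have "t * (1 + C) \<le> e / (4 * (1 + C)) * (1 + C)" using C0 by (intro mult_right_mono) (auto simp: t_def)
    also have "\<dots> = e / 4" using C0 by (simp add: field_simps)
    finally show ?thesis .
  qed
  define \<Phi> where "\<Phi> x = (\<Sum>i\<in>I. \<integral>s. sqrt ((x i s)\<^sup>2 + d\<^sup>2) \<partial>M)" for x :: "'i \<Rightarrow> 'a \<Rightarrow> real"
  have \<Phi>0: "0 \<le> \<Phi> x" for x unfolding \<Phi>_def by (intro sum_nonneg integral_nonneg_AE AE_I2) auto
  have bdd: "bdd_below (\<Phi> ` K)" using \<Phi>0 by (rule bdd_belowI2)
  have ne: "\<Phi> ` K \<noteq> {}" using False by simp
  have "Inf (\<Phi> ` K) < Inf (\<Phi> ` K) + t\<^sup>2" using t by simp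
  then obtain x0 where x0: "x0 \<in> K" and near: "\<Phi> x0 < Inf (\<Phi> ` K) + t\<^sup>2"
    unfolding cInf_less_iff[OF ne bdd] by blast
  define f where "f i s = (if i \<in> I then x0 i s / sqrt ((x0 i s)\<^sup>2 + d\<^sup>2) else 0)" for i s
  have fm: "f i \<in> borel_measurable M" if "i \<in> I" for i
    unfolding f_def using meas[OF x0 that] that by measurable
  have fb: "\<bar>f i s\<bar> \<le> 1" for i s using sqrt_smooth_lower(2)[OF d] by (simp add: f_def)
  have int_p: "integrable M (\<lambda>s. f i s * y i s)" if "y \<in> K" "i \<in> I" for y i
    using fm[OF that(2)] meas[OF that] bd[OF that] fb
    by (intro integrable_const_bound[where B=1] AE_I2) (auto simp: abs_mult mult_le_one)
  have int_a: "integrable M (\<lambda>s. \<bar>y i s\<bar>)" if "y \<in> K" "i \<in> I" for y i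
    using meas[OF that] bd[OF that] by (intro integrable_const_bound[where B=1] AE_I2) auto
  have int_s: "integrable M (\<lambda>s. sqrt ((y i s)\<^sup>2 + d\<^sup>2))" if "y \<in> K" "i \<in> I" for y i
  proof (intro integrable_const_bound[where B="sqrt (1 + d\<^sup>2)"] AE_I2)
    show "(\<lambda>s. sqrt ((y i s)\<^sup>2 + d\<^sup>2)) \<in> borel_measurable M" using meas[OF that] by measurable
    fix s assume "s \<in> space M"
    from bd[OF that this] have "(y i s)\<^sup>2 \<le> 1" by (simp add: abs_square_le_1)
    then show "norm (sqrt ((y i s)\<^sup>2 + d\<^sup>2)) \<le> sqrt (1 + d\<^sup>2)" by simp
  qed
  have base: "e - n * d \<le> (\<Sum>i\<in>I. \<integral>s. f i s * x0 i s \<partial>M)"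
  proof -
    have "(\<Sum>i\<in>I. \<integral>s. \<bar>x0 i s\<bar> \<partial>M) - n * d = (\<Sum>i\<in>I. (\<integral>s. \<bar>x0 i s\<bar> - d \<partial>M))"
      using int_a[OF x0] by (simp add: n_def sum_subtractf prob_space)
    also have "\<dots> \<le> (\<Sum>i\<in>I. \<integral>s. f i s * x0 i s \<partial>M)"
      using int_a[OF x0] int_p[OF x0] sqrt_smooth_lower(1)[OF d]
      by (intro sum_mono integral_mono) (auto simp: f_def)
    finally show ?thesis using far[OF x0] by linarith
  qed
  have "e / 2 \<le> (\<Sum>i\<in>I. \<integral>s. f i s * y i s \<partial>M)" if y: "y \<in> K" for y
  proof -
    define z where "z = (\<lambda>i s. (1 - t) * x0 i s + t * y i s)"
    have z: "z \<in> K" unfolding z_def using cvx[OF x0 y] t by simp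
    let ?fx = "\<Sum>i\<in>I. \<integral>s. f i s * x0 i s \<partial>M" and ?fy = "\<Sum>i\<in>I. \<integral>s. f i s * y i s \<partial>M"
    have "\<Phi> z \<le> (\<Sum>i\<in>I. \<integral>s. sqrt ((x0 i s)\<^sup>2 + d\<^sup>2) + t * (f i s * y i s) - t * (f i s * x0 i s) + t\<^sup>2 * (4 / (2 * d)) \<partial>M)"
      unfolding \<Phi>_def
    proof (intro sum_mono integral_mono int_s z)
      fix i assume i: "i \<in> I"
      show "integrable M (\<lambda>s. sqrt ((x0 i s)\<^sup>2 + d\<^sup>2) + t * (f i s * y i s) - t * (f i s * x0 i s) + t\<^sup>2 * (4 / (2 * d)))"
        by (intro Bochner_Integration.integrable_add Bochner_Integration.integrable_diff
            integrable_mult_right int_s x0 i int_p y integrable_const)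
      fix s assume s: "s \<in> space M"
      have zx: "z i s - x0 i s = t * (y i s - x0 i s)" by (simp add: z_def algebra_simps)
      have "\<bar>y i s - x0 i s\<bar> \<le> 2" using bd[OF x0 i s] bd[OF y i s] by linarith
      then have "(y i s - x0 i s)\<^sup>2 \<le> 2\<^sup>2" by (rule power2_le_iff_abs_le[THEN iffD2, rotated]) simp
      then have "(z i s - x0 i s)\<^sup>2 / (2 * d) \<le> t\<^sup>2 * 4 / (2 * d)"
        unfolding zx power_mult_distrib using d by (intro divide_right_mono mult_left_mono) auto
      then show "sqrt ((z i s)\<^sup>2 + d\<^sup>2) \<le> sqrt ((x0 i s)\<^sup>2 + d\<^sup>2) + t * (f i s * y i s) - t * (f i s * x0 i s) + t\<^sup>2 * (4 / (2 * d))"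
      proof -
        have "sqrt ((z i s)\<^sup>2 + d\<^sup>2) \<le> sqrt ((x0 i s)\<^sup>2 + d\<^sup>2) + f i s * (z i s - x0 i s) + (z i s - x0 i s)\<^sup>2 / (2 * d)"
          using sqrt_smooth_upper[OF d, of "z i s" "x0 i s"] i by (simp add: f_def)
        moreover have "f i s * (z i s - x0 i s) = t * (f i s * y i s) - t * (f i s * x0 i s)"
          unfolding zx by (simp add: algebra_simps)
        moreover have "t\<^sup>2 * 4 / (2 * d) = t\<^sup>2 * (4 / (2 * d))" by simp
        ultimately show ?thesis
          using \<open>(z i s - x0 i s)\<^sup>2 / (2 * d) \<le> t\<^sup>2 * 4 / (2 * d)\<close> by linarith
      qed
    qed
    also have "\<dots> = \<Phi> x0 + t * ?fy - t * ?fx + t\<^sup>2 * C"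
      unfolding \<Phi>_def using int_s[OF x0] int_p[OF x0] int_p[OF y]
      by (simp add: sum.distrib sum_subtractf sum_distrib_left prob_space C_def n_def)
    finally have "Inf (\<Phi> ` K) \<le> \<Phi> x0 + t * ?fy - t * ?fx + t\<^sup>2 * C"
      using cInf_lower[OF imageI[OF z] bdd] by linarith
    with near have "0 \<le> t * (?fy - ?fx + t * (1 + C))" by (simp add: algebra_simps power2_eq_square)
    then have "0 \<le> ?fy - ?fx + t * (1 + C)" using t by (simp add: zero_le_mult_iff)
    with base nd tC show ?thesis by linarith
  qed
  with fm fb show ?thesis by blast
qed

section \<open>Conditional expectations in the sense of Zimmer\<close>

lemma AE_eq_null_sets:
  assumes "sets M = sets N" "null_sets M = null_sets N"
  shows "(AE x in M. P x) \<longleftrightarrow> (AE x in N. P x)"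
  using sets_eq_imp_space_eq[OF assms(1)] assms(2) by (simp add: eventually_ae_filter)

text \<open>A measurable action on \<open>X\<close> with bounded Radon--Nikodym derivatives \<open>\<rho>\<close>, and an equivariant
  conditional expectation for a measure \<open>S\<close> in the same measure class.\<close>

locale amenable_action = measurable_action G X act
  for G (structure) and X :: "'x measure" and act +
  fixes S :: "'x measure" and E :: "('a \<times> 'x \<Rightarrow> real) \<Rightarrow> 'x \<Rightarrow> real"
    and \<rho> :: "'a \<Rightarrow> 'x \<Rightarrow> real" and b :: "'a \<Rightarrow> real"
  assumes count: "countable (carrier G)"
    and sets_S: "sets S = sets X" and null_S: "null_sets S = null_sets X"
    and E: "equivariant_cond_exp G (count_space (carrier G) \<Otimes>\<^sub>M S) (diag_act G S act) S act snd E"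
    and rho_meas: "\<And>g. g \<in> carrier G \<Longrightarrow> \<rho> g \<in> borel_measurable X"
    and rho_bd: "\<And>g s. g \<in> carrier G \<Longrightarrow> 0 \<le> \<rho> g s \<and> \<rho> g s \<le> b g"
    and rho_density: "\<And>g. g \<in> carrier G \<Longrightarrow> density X (\<lambda>s. ennreal (\<rho> g s)) = distr X X (act g)"
begin

sublocale prob_space X by (rule prob)

lemma space_S: "space S = space X" using sets_S by (rule sets_eq_imp_space_eq)

lemma AE_S: "(AE x in S. P x) \<longleftrightarrow> (AE x in X. P x)"
  using sets_S null_S by (rule AE_eq_null_sets)

lemma integral_rho:
  assumes g: "g \<in> carrier G" and u: "u \<in> borel_measurable X"
  shows "(\<integral>s. \<rho> g s * u s \<partial>X) = (\<integral>s. u (act g s) \<partial>X)"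
proof -
  have "(\<integral>s. u (act g s) \<partial>X) = (\<integral>s. u s \<partial>distr X X (act g))"
    by (rule integral_distr[symmetric, OF act_measurable[OF g] u])
  also have "\<dots> = (\<integral>s. \<rho> g s * u s \<partial>X)"
    unfolding rho_density[OF g, symmetric]
    using integral_density[OF u rho_meas[OF g]] rho_bd[OF g] by simp
  finally show ?thesis by simp
qed

text \<open>Bounded functions on \<open>G \<times> X\<close>, with a bound that holds everywhere. Working with them avoids
  null sets of the product.\<close>

definition Bf :: "('a \<times> 'x \<Rightarrow> real) set" where
  "Bf = {f \<in> borel_measurable (count_space (carrier G) \<Otimes>\<^sub>M X). \<exists>C. \<forall>h\<in>carrier G. \<forall>s\<in>space X. \<bar>f (h, s)\<bar> \<le> C}"

lemma sets_prod: "sets (count_space (carrier G) \<Otimes>\<^sub>M S) = sets (count_space (carrier G) \<Otimes>\<^sub>M X)"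
  by (intro sets_pair_measure_cong sets_S) simp

lemma BfI:
  assumes "\<And>h. h \<in> carrier G \<Longrightarrow> (\<lambda>s. f (h, s)) \<in> borel_measurable X"
    and "\<And>h s. h \<in> carrier G \<Longrightarrow> s \<in> space X \<Longrightarrow> \<bar>f (h, s)\<bar> \<le> C"
  shows "f \<in> Bf"
proof -
  have "f \<in> borel_measurable (count_space (carrier G) \<Otimes>\<^sub>M X)"
    by (rule measurable_pair_measure_countable1[OF count assms(1)])
  then show ?thesis unfolding Bf_def using assms(2) by blast
qed

lemma Bf_bound: "f \<in> Bf \<Longrightarrow> \<exists>C. \<forall>h\<in>carrier G. \<forall>s\<in>space X. \<bar>f (h, s)\<bar> \<le> C"
  unfolding Bf_def by blast

lemma Bf_measurable: "f \<in> Bf \<Longrightarrow> f \<in> borel_measurable (count_space (carrier G) \<Otimes>\<^sub>M X)"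
  by (simp add: Bf_def)

lemma Bf_Linf: "f \<in> Bf \<Longrightarrow> f \<in> Linf (count_space (carrier G) \<Otimes>\<^sub>M S)"
proof -
  assume f: "f \<in> Bf"
  then obtain C where C: "\<And>h s. h \<in> carrier G \<Longrightarrow> s \<in> space X \<Longrightarrow> \<bar>f (h, s)\<bar> \<le> C" by (auto simp: Bf_def)
  have "AE y in count_space (carrier G) \<Otimes>\<^sub>M S. \<bar>f y\<bar> \<le> C"
    by (rule AE_I2) (auto simp: space_pair_measure space_S C)
  moreover have "f \<in> borel_measurable (count_space (carrier G) \<Otimes>\<^sub>M S)"
    using Bf_measurable[OF f] measurable_cong_sets[OF sets_prod refl] by blast
  ultimately show ?thesis by (auto simp: Linf_def)
qed

lemma Bf_add: "f \<in> Bf \<Longrightarrow> g \<in> Bf \<Longrightarrow> (\<lambda>y. f y + g y) \<in> Bf"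
proof -
  assume f: "f \<in> Bf" and g: "g \<in> Bf"
  obtain C D where C: "\<forall>h\<in>carrier G. \<forall>s\<in>space X. \<bar>f (h, s)\<bar> \<le> C"
    and D: "\<forall>h\<in>carrier G. \<forall>s\<in>space X. \<bar>g (h, s)\<bar> \<le> D"
    using Bf_bound[OF f] Bf_bound[OF g] by blast
  have "\<bar>f (h, s) + g (h, s)\<bar> \<le> C + D" if "h \<in> carrier G" "s \<in> space X" for h s
    using C[rule_format, OF that] D[rule_format, OF that] by linarith
  then show ?thesis using Bf_measurable[OF f] Bf_measurable[OF g] unfolding Bf_def by auto
qed

lemma Bf_mult: "f \<in> Bf \<Longrightarrow> g \<in> Bf \<Longrightarrow> (\<lambda>y. f y * g y) \<in> Bf"
proof -
  assume f: "f \<in> Bf" and g: "g \<in> Bf"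
  obtain C D where C: "\<forall>h\<in>carrier G. \<forall>s\<in>space X. \<bar>f (h, s)\<bar> \<le> C"
    and D: "\<forall>h\<in>carrier G. \<forall>s\<in>space X. \<bar>g (h, s)\<bar> \<le> D"
    using Bf_bound[OF f] Bf_bound[OF g] by blast
  have "\<bar>f (h, s) * g (h, s)\<bar> \<le> C * D" if "h \<in> carrier G" "s \<in> space X" for h s
    unfolding abs_mult using C[rule_format, OF that] D[rule_format, OF that]
    by (intro mult_mono) (auto intro: order_trans[OF abs_ge_zero])
  then show ?thesis using Bf_measurable[OF f] Bf_measurable[OF g] unfolding Bf_def by auto
qed

lemma Bf_const: "(\<lambda>y. c) \<in> Bf"
  by (auto simp: Bf_def)

lemma Bf_snd: "u \<in> borel_measurable X \<Longrightarrow> (\<And>s. s \<in> space X \<Longrightarrow> \<bar>u s\<bar> \<le> C) \<Longrightarrow> (\<lambda>y. u (snd y)) \<in> Bf"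
  by (rule BfI) auto

lemma Bf_sum: "finite F \<Longrightarrow> (\<And>k. k \<in> F \<Longrightarrow> f k \<in> Bf) \<Longrightarrow> (\<lambda>y. \<Sum>k\<in>F. f k y) \<in> Bf"
  by (induction F rule: finite_induct) (simp_all add: Bf_const Bf_add)

lemma Bf_diag:
  assumes g: "g \<in> carrier G" and f: "f \<in> Bf"
  shows "(\<lambda>y. f (diag_act G S act g y)) \<in> Bf"
proof -
  obtain C where C: "\<And>h s. h \<in> carrier G \<Longrightarrow> s \<in> space X \<Longrightarrow> \<bar>f (h, s)\<bar> \<le> C" using f by (auto simp: Bf_def)
  show ?thesis
  proof (rule BfI)
    fix h assume h: "h \<in> carrier G"
    have "(\<lambda>s. (g \<otimes> h, act g s)) \<in> X \<rightarrow>\<^sub>M count_space (carrier G) \<Otimes>\<^sub>M X"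
      using act_measurable[OF g] g h by (intro measurable_Pair measurable_const) auto
    from measurable_compose[OF this Bf_measurable[OF f]]
    show "(\<lambda>s. f (diag_act G S act g (h, s))) \<in> borel_measurable X"
      by (rule measurable_cong[THEN iffD2, rotated]) (simp add: diag_act_def space_S h)
    fix s assume s: "s \<in> space X"
    then show "\<bar>f (diag_act G S act g (h, s))\<bar> \<le> C"
      using C[of "g \<otimes> h" "act g s"] g h act_space[OF g s] by (simp add: diag_act_def space_S)
  qed
qed

lemma E_Linf: "f \<in> Bf \<Longrightarrow> E f \<in> borel_measurable X \<and> integrable X (E f)"
proof -
  assume f: "f \<in> Bf"
  have "E f \<in> Linf S" using E Bf_Linf[OF f] unfolding equivariant_cond_exp_def by blast
  then obtain C where m: "E f \<in> borel_measurable S" and C: "AE x in S. \<bar>E f x\<bar> \<le> C" by (auto simp: Linf_def)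
  have m': "E f \<in> borel_measurable X" using m measurable_cong_sets[OF sets_S refl] by blast
  moreover have "integrable X (E f)"
    using C m' unfolding AE_S by (intro integrable_const_bound[where B=C]) auto
  ultimately show ?thesis by simp
qed

lemma E_add: "f \<in> Bf \<Longrightarrow> g \<in> Bf \<Longrightarrow> AE x in X. E (\<lambda>y. f y + g y) x = E f x + E g x"
  using E Bf_Linf unfolding equivariant_cond_exp_def AE_S by blast

lemma E_scale: "f \<in> Bf \<Longrightarrow> AE x in X. E (\<lambda>y. c * f y) x = c * E f x"
  using E Bf_Linf unfolding equivariant_cond_exp_def AE_S by blast

lemma E_act: "g \<in> carrier G \<Longrightarrow> f \<in> Bf \<Longrightarrow> AE x in X. E (\<lambda>y. f (diag_act G S act g y)) x = E f (act g x)"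
  using E Bf_Linf unfolding equivariant_cond_exp_def AE_S by blast

lemma E_pos:
  assumes "f \<in> Bf" and "\<And>h s. h \<in> carrier G \<Longrightarrow> s \<in> space X \<Longrightarrow> 0 \<le> f (h, s)"
  shows "AE x in X. 0 \<le> E f x"
proof -
  have "AE y in count_space (carrier G) \<Otimes>\<^sub>M S. 0 \<le> f y"
    using assms(2) by (intro AE_I2) (auto simp: space_pair_measure space_S)
  then show ?thesis using E Bf_Linf[OF assms(1)] unfolding equivariant_cond_exp_def AE_S by blast
qed

lemma E_cong:
  assumes f: "f \<in> Bf" and g: "g \<in> Bf"
    and eq: "\<And>y. y \<in> space (count_space (carrier G) \<Otimes>\<^sub>M S) \<Longrightarrow> f y = g y"
  shows "AE x in X. E f x = E g x"
proof -
  have "\<forall>f\<in>Linf (count_space (carrier G) \<Otimes>\<^sub>M S). \<forall>f'\<in>Linf (count_space (carrier G) \<Otimes>\<^sub>M S).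
     (AE y in count_space (carrier G) \<Otimes>\<^sub>M S. f y = f' y) \<longrightarrow> (AE x in X. E f x = E f' x)"
    using E unfolding equivariant_cond_exp_def AE_S by blast
  then show ?thesis using Bf_Linf[OF f] Bf_Linf[OF g] AE_I2[of _ "\<lambda>y. f y = g y", OF eq] by blast
qed

lemma E_one: "AE x in X. E (\<lambda>y. 1) x = 1"
  using E unfolding equivariant_cond_exp_def AE_S by blast

lemma E_module:
  assumes u: "u \<in> borel_measurable X" "\<And>s. s \<in> space X \<Longrightarrow> \<bar>u s\<bar> \<le> C" and f: "f \<in> Bf"
  shows "AE x in X. E (\<lambda>y. u (snd y) * f y) x = u x * E f x"
proof -
  have "u \<in> borel_measurable S" using u(1) measurable_cong_sets[OF sets_S refl] by blast
  then have "u \<in> Linf S" using u(2) by (auto simp: Linf_def space_S intro!: exI[of _ C] AE_I2)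
  then show ?thesis using E Bf_Linf[OF f] unfolding equivariant_cond_exp_def AE_S by blast
qed

lemma E_sum:
  assumes "finite F" "\<And>k. k \<in> F \<Longrightarrow> f k \<in> Bf"
  shows "AE x in X. E (\<lambda>y. \<Sum>k\<in>F. f k y) x = (\<Sum>k\<in>F. E (f k) x)"
  using assms
proof (induction F rule: finite_induct)
  case empty
  show ?case using E_scale[OF Bf_const[of 0], of 0] by simp
next
  case (insert k F)
  have "AE x in X. E (\<lambda>y. f k y + (\<Sum>k\<in>F. f k y)) x = E (f k) x + E (\<lambda>y. \<Sum>k\<in>F. f k y) x"
    using insert by (intro E_add Bf_sum) auto
  moreover have "AE x in X. E (\<lambda>y. \<Sum>k\<in>F. f k y) x = (\<Sum>k\<in>F. E (f k) x)" using insert by auto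
  ultimately show ?case by eventually_elim (simp add: insert)
qed

text \<open>The function obtained by moving the pairing of \<open>f\<close> with a defect onto a Dirac mass at \<open>h\<close>: the
  sum over \<open>k\<close> of the translate of \<open>f k\<close> by \<open>k\<close>, with its Radon--Nikodym factor, minus \<open>f k\<close>.\<close>

definition drift :: "'a set \<Rightarrow> ('a \<Rightarrow> 'a \<Rightarrow> 'x \<Rightarrow> real) \<Rightarrow> 'a \<Rightarrow> 'x \<Rightarrow> real" where
  "drift F f h s = (\<Sum>k\<in>F. \<rho> k s * f k (inv k \<otimes> h) (act (inv k) s) - f k h s)"

text \<open>By equivariance and linearity over functions on \<open>X\<close>, the conditional expectation maps each
  translate to a function with the same integral as that of \<open>f k\<close>.\<close>

lemma integral_E_drift:
  assumes F: "finite F" "F \<subseteq> carrier G"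
    and fm: "\<And>k h. k \<in> F \<Longrightarrow> h \<in> carrier G \<Longrightarrow> f k h \<in> borel_measurable X"
    and fb: "\<And>k h s. \<bar>f k h s\<bar> \<le> 1"
  shows "(\<lambda>y. drift F f (fst y) (snd y)) \<in> Bf"
    and "(\<integral>x. E (\<lambda>y. drift F f (fst y) (snd y)) x \<partial>X) = 0"
proof -
  define u where "u k y = f k (fst y) (snd y)" for k y
  have u: "u k \<in> Bf" if "k \<in> F" for k
    by (rule BfI[of _ 1]) (simp_all add: u_def fm[OF that] fb)
  define v where "v k y = \<rho> k (snd y) * u k (diag_act G S act (inv k) y) + (-1) * u k y" for k y
  have kG: "k \<in> carrier G" "inv k \<in> carrier G" if "k \<in> F" for k using that F by auto
  have rb: "\<bar>\<rho> k s\<bar> \<le> b k" if "k \<in> F" for k s using rho_bd[OF kG(1)[OF that], of s] by auto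
  have v1: "(\<lambda>y. \<rho> k (snd y) * u k (diag_act G S act (inv k) y)) \<in> Bf" if "k \<in> F" for k
    using Bf_snd[OF rho_meas[OF kG(1)[OF that]] rb[OF that]] u[OF that] kG[OF that]
    by (intro Bf_mult Bf_diag) auto
  have v2: "(\<lambda>y. (-1) * u k y) \<in> Bf" if "k \<in> F" for k
    by (intro Bf_mult Bf_const u that)
  have v: "v k \<in> Bf" if "k \<in> F" for k
    unfolding v_def by (intro Bf_add v1 v2 that)
  let ?w = "\<lambda>y. \<Sum>k\<in>F. v k y"
  let ?d = "\<lambda>y. drift F f (fst y) (snd y)"
  have w: "?w \<in> Bf" using F v by (intro Bf_sum) auto
  have eq: "?d y = ?w y" if "y \<in> space (count_space (carrier G) \<Otimes>\<^sub>M S)" for y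
    using that F by (auto simp: drift_def v_def u_def diag_act_def space_pair_measure intro!: sum.cong)
  have d: "?d \<in> Bf"
  proof -
    obtain C where C: "\<And>h s. h \<in> carrier G \<Longrightarrow> s \<in> space X \<Longrightarrow> \<bar>?w (h, s)\<bar> \<le> C" using w by (auto simp: Bf_def)
    have sp: "(h, s) \<in> space (count_space (carrier G) \<Otimes>\<^sub>M S)" if "h \<in> carrier G" "s \<in> space X" for h s
      using that by (simp add: space_pair_measure space_S)
    have "?d \<in> borel_measurable (count_space (carrier G) \<Otimes>\<^sub>M X)"
      using Bf_measurable[OF w] eq sets_eq_imp_space_eq[OF sets_prod] by (subst measurable_cong[of _ _ ?w]) auto
    then show ?thesis using C eq[OF sp] by (auto simp: Bf_def)
  qed
  then show "(\<lambda>y. drift F f (fst y) (snd y)) \<in> Bf" .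
  have 1: "AE x in X. E ?d x = E ?w x" by (rule E_cong[OF d w eq])
  have 2: "AE x in X. E ?w x = (\<Sum>k\<in>F. E (v k) x)"
    using F v by (intro E_sum) auto
  have 3: "AE x in X. E (v k) x = \<rho> k x * E (u k) (act (inv k) x) - E (u k) x" if k: "k \<in> F" for k
  proof -
    have "AE x in X. E (v k) x = E (\<lambda>y. \<rho> k (snd y) * u k (diag_act G S act (inv k) y)) x + E (\<lambda>y. (-1) * u k y) x"
      unfolding v_def by (intro E_add v1 v2 k)
    moreover have "AE x in X. E (\<lambda>y. \<rho> k (snd y) * u k (diag_act G S act (inv k) y)) x =
       \<rho> k x * E (\<lambda>y. u k (diag_act G S act (inv k) y)) x"
      using E_module[OF rho_meas[OF kG(1)[OF k]] rb[OF k] Bf_diag[OF kG(2)[OF k] u[OF k]]] .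
    moreover have "AE x in X. E (\<lambda>y. u k (diag_act G S act (inv k) y)) x = E (u k) (act (inv k) x)"
      by (rule E_act[OF kG(2)[OF k] u[OF k]])
    moreover have "AE x in X. E (\<lambda>y. (-1) * u k y) x = (-1) * E (u k) x" by (rule E_scale[OF u[OF k]])
    ultimately show ?thesis by eventually_elim simp
  qed
  have "AE x in X. \<forall>k\<in>F. E (v k) x = \<rho> k x * E (u k) (act (inv k) x) - E (u k) x"
    using 3 F by (subst AE_ball_countable) (auto simp: countable_finite)
  with 1 2 have 4: "AE x in X. E ?d x = (\<Sum>k\<in>F. \<rho> k x * E (u k) (act (inv k) x) - E (u k) x)"
    by eventually_elim simp
  have i: "integrable X (\<lambda>x. \<rho> k x * E (u k) (act (inv k) x))"
    "(\<integral>x. \<rho> k x * E (u k) (act (inv k) x) \<partial>X) = (\<integral>x. E (u k) x \<partial>X)" if k: "k \<in> F" for k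
  proof -
    have m: "(\<lambda>x. E (u k) (act (inv k) x)) \<in> borel_measurable X"
      using E_Linf[OF u[OF k]] act_measurable[OF kG(2)[OF k]] by (auto intro: measurable_compose)
    have "(\<integral>x. \<rho> k x * E (u k) (act (inv k) x) \<partial>X) = (\<integral>x. E (u k) (act (inv k) (act k x)) \<partial>X)"
      by (rule integral_rho[OF kG(1)[OF k] m])
    also have "\<dots> = (\<integral>x. E (u k) x \<partial>X)"
      using act_inv(1)[OF kG(1)[OF k]] by (intro Bochner_Integration.integral_cong) auto
    finally show "(\<integral>x. \<rho> k x * E (u k) (act (inv k) x) \<partial>X) = (\<integral>x. E (u k) x \<partial>X)" .
    have "integrable X (\<lambda>x. E (\<lambda>y. \<rho> k (snd y) * u k (diag_act G S act (inv k) y)) x)"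
      using E_Linf[OF v1[OF k]] by simp
    moreover have "AE x in X. E (\<lambda>y. \<rho> k (snd y) * u k (diag_act G S act (inv k) y)) x = \<rho> k x * E (u k) (act (inv k) x)"
      using E_module[OF rho_meas[OF kG(1)[OF k]] rb[OF k] Bf_diag[OF kG(2)[OF k] u[OF k]]] E_act[OF kG(2)[OF k] u[OF k]]
      by eventually_elim simp
    ultimately show "integrable X (\<lambda>x. \<rho> k x * E (u k) (act (inv k) x))"
      using m rho_meas[OF kG(1)[OF k]] by (subst integrable_cong_AE[symmetric]) (auto simp: E_Linf[OF v1[OF k]])
  qed
  have "(\<integral>x. E ?d x \<partial>X) = (\<integral>x. (\<Sum>k\<in>F. \<rho> k x * E (u k) (act (inv k) x) - E (u k) x) \<partial>X)"
  proof (rule integral_cong_AE[OF _ _ 4])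
    show "E ?d \<in> borel_measurable X" using E_Linf[OF d] by simp
    show "(\<lambda>x. \<Sum>k\<in>F. \<rho> k x * E (u k) (act (inv k) x) - E (u k) x) \<in> borel_measurable X"
      using i(1) E_Linf[OF u] by (intro borel_measurable_sum borel_measurable_diff borel_measurable_integrable) auto
  qed
  also have "\<dots> = (\<Sum>k\<in>F. (\<integral>x. \<rho> k x * E (u k) (act (inv k) x) \<partial>X) - (\<integral>x. E (u k) x \<partial>X))"
    using i(1) E_Linf[OF u] by (subst Bochner_Integration.integral_sum) (auto intro!: sum.cong)
  also have "\<dots> = 0" using i(2) by simp
  finally show "(\<integral>x. E (\<lambda>y. drift F f (fst y) (snd y)) x \<partial>X) = 0" .
qed

end

section \<open>Approximately invariant weights\<close>

context amenable_action begin

lemma drift_measurable: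
  assumes F: "finite F" "F \<subseteq> carrier G" and h: "h \<in> carrier G"
    and fm: "\<And>k h. k \<in> F \<Longrightarrow> h \<in> carrier G \<Longrightarrow> f k h \<in> borel_measurable X"
  shows "drift F f h \<in> borel_measurable X"
  unfolding drift_def
proof (intro borel_measurable_sum borel_measurable_diff borel_measurable_times)
  fix k assume k: "k \<in> F"
  then have kG: "k \<in> carrier G" using F by auto
  show "\<rho> k \<in> borel_measurable X" by (rule rho_meas[OF kG])
  show "(\<lambda>s. f k (inv k \<otimes> h) (act (inv k) s)) \<in> borel_measurable X"
    by (rule measurable_compose[OF act_measurable fm[OF k]]) (use kG h in auto)
  show "f k h \<in> borel_measurable X" by (rule fm[OF k h])
qed

lemma drift_bound:
  assumes F: "finite F" "F \<subseteq> carrier G" and fb: "\<And>k h s. \<bar>f k h s\<bar> \<le> 1"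
  shows "\<bar>drift F f h s\<bar> \<le> (\<Sum>k\<in>F. b k + 1)"
  unfolding drift_def
proof (rule order_trans[OF sum_abs sum_mono])
  fix k assume k: "k \<in> F"
  then have kG: "k \<in> carrier G" using F by auto
  have "\<bar>\<rho> k s * f k (inv k \<otimes> h) (act (inv k) s)\<bar> \<le> b k * 1"
    unfolding abs_mult using rho_bd[OF kG, of s] fb by (intro mult_mono) auto
  then show "\<bar>\<rho> k s * f k (inv k \<otimes> h) (act (inv k) s) - f k h s\<bar> \<le> b k + 1"
    using fb[of k h s] by linarith
qed

text \<open>A drift cannot be bounded below, uniformly on the group, by a function with positive integral.\<close>

lemma no_uniform_drift:
  assumes F: "finite F" "F \<subseteq> carrier G"
    and fm: "\<And>k h. k \<in> F \<Longrightarrow> h \<in> carrier G \<Longrightarrow> f k h \<in> borel_measurable X"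
    and fb: "\<And>k h s. \<bar>f k h s\<bar> \<le> 1"
    and e: "range e = carrier G"
    and d: "\<And>n::nat. d \<le> (\<integral>s. Min ((\<lambda>j. drift F f (e j) s) ` {..n}) \<partial>X)"
  shows "d \<le> 0"
proof -
  let ?B = "\<Sum>k\<in>F. b k + 1"
  let ?D = "\<lambda>y. drift F f (fst y) (snd y)"
  have eG: "e j \<in> carrier G" for j using e by auto
  define c where "c n s = Min ((\<lambda>j. drift F f (e j) s) ` {..n})" for n s
  define c' where "c' s = (INF n. c n s)" for s
  have cb: "\<bar>c n s\<bar> \<le> ?B" for n s
  proof -
    have "c n s \<in> (\<lambda>j. drift F f (e j) s) ` {..n}" unfolding c_def by (rule Min_in) auto
    then show ?thesis using drift_bound[OF F fb] by auto
  qed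
  have bdd: "bdd_below (range (\<lambda>n. c n s))" for s
    using cb by (intro bdd_belowI[of _ "- ?B"]) (auto simp: abs_le_iff minus_le_iff)
  have cdec: "decseq (\<lambda>n. c n s)" for s
    unfolding c_def by (intro decseq_SucI Min_antimono) auto
  have lim: "(\<lambda>n. c n s) \<longlonglongrightarrow> c' s" for s
    unfolding c'_def by (rule LIMSEQ_decseq_INF[OF bdd cdec])
  have cm: "c n \<in> borel_measurable X" for n
    unfolding c_def by (intro borel_measurable_Min drift_measurable F eG fm) auto
  have cm': "c' \<in> borel_measurable X" by (rule borel_measurable_LIMSEQ_real[OF lim cm])
  have cb': "\<bar>c' s\<bar> \<le> ?B" for s
    by (rule LIMSEQ_le_const2[OF tendsto_rabs[OF lim]]) (use cb in auto)
  have "(\<lambda>n. \<integral>s. c n s \<partial>X) \<longlonglongrightarrow> (\<integral>s. c' s \<partial>X)"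
    by (rule integral_dominated_convergence[where w="\<lambda>_. ?B"]) (use cm cm' cb lim in auto)
  then have 1: "d \<le> (\<integral>s. c' s \<partial>X)"
    by (rule LIMSEQ_le_const) (use d in \<open>auto simp: c_def\<close>)
  have le: "c' s \<le> drift F f h s" if h: "h \<in> carrier G" for h s
  proof -
    obtain j where j: "h = e j" using e h by auto
    have "c' s \<le> c j s" unfolding c'_def by (rule cINF_lower[OF bdd]) simp
    also have "\<dots> \<le> drift F f (e j) s" unfolding c_def by (rule Min_le) auto
    finally show ?thesis using j by simp
  qed
  have D: "?D \<in> Bf" by (rule integral_E_drift(1)[OF F fm fb])
  have one: "(\<lambda>y. 1) \<in> Bf" by (rule Bf_const)
  have C: "(\<lambda>y. c' (snd y) * 1) \<in> Bf"
    using Bf_snd[OF cm' cb'] by simp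
  have C': "(\<lambda>y. (-1) * (c' (snd y) * 1)) \<in> Bf" by (rule Bf_mult[OF Bf_const C])
  have "AE x in X. 0 \<le> E (\<lambda>y. ?D y + (-1) * (c' (snd y) * 1)) x"
    by (rule E_pos[OF Bf_add[OF D C']]) (use le in auto)
  moreover have "AE x in X. E (\<lambda>y. ?D y + (-1) * (c' (snd y) * 1)) x = E ?D x + E (\<lambda>y. (-1) * (c' (snd y) * 1)) x"
    by (rule E_add[OF D C'])
  moreover have "AE x in X. E (\<lambda>y. (-1) * (c' (snd y) * 1)) x = (-1) * E (\<lambda>y. c' (snd y) * 1) x"
    by (rule E_scale[OF C])
  moreover have "AE x in X. E (\<lambda>y. c' (snd y) * 1) x = c' x * E (\<lambda>y. 1) x"
    by (rule E_module[OF cm' cb' one])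
  ultimately have "AE x in X. c' x \<le> E ?D x"
    using E_one by eventually_elim simp
  then have "(\<integral>x. c' x \<partial>X) \<le> (\<integral>x. E ?D x \<partial>X)"
    using cm' cb' E_Linf[OF D] by (intro integral_mono_AE) (auto intro!: integrable_const_bound[where B="?B"])
  also have "\<dots> = 0" by (rule integral_E_drift(2)[OF F fm fb])
  finally show ?thesis using 1 by simp
qed

text \<open>Measurable families of probability measures on a finite subset \<open>H\<close> of the group.\<close>

definition weights :: "'a set \<Rightarrow> ('a \<Rightarrow> 'x \<Rightarrow> real) \<Rightarrow> bool" where
  "weights H \<phi> \<longleftrightarrow> (\<forall>h. \<phi> h \<in> borel_measurable X) \<and> (\<forall>h s. 0 \<le> \<phi> h s) \<and>
     (\<forall>h s. h \<notin> H \<longrightarrow> \<phi> h s = 0) \<and> (\<forall>s. (\<Sum>h\<in>H. \<phi> h s) = 1)"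

text \<open>The elements \<open>h\<close> at which \<open>defect \<phi> k h\<close> can be nonzero when \<open>\<phi>\<close> is supported in \<open>H\<close>.\<close>

definition window :: "'a set \<Rightarrow> 'a \<Rightarrow> 'a set" where
  "window H k = H \<union> (\<lambda>h. inv k \<otimes> h) ` H"

text \<open>The failure of \<open>\<phi>\<close> to be equivariant under \<open>k\<close>.\<close>

definition defect :: "('a \<Rightarrow> 'x \<Rightarrow> real) \<Rightarrow> 'a \<Rightarrow> 'a \<Rightarrow> 'x \<Rightarrow> real" where
  "defect \<phi> k h s = \<phi> (k \<otimes> h) (act k s) - \<phi> h s"

lemma weights_le_1:
  assumes "weights H \<phi>" "finite H"
  shows "\<phi> h s \<le> 1"
proof (cases "h \<in> H")
  case True
  have "\<phi> h s \<le> (\<Sum>h\<in>H. \<phi> h s)"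
    using assms True by (intro member_le_sum) (auto simp: weights_def)
  then show ?thesis using assms by (simp add: weights_def)
qed (use assms in \<open>simp add: weights_def\<close>)

lemma defect_bound: "weights H \<phi> \<Longrightarrow> finite H \<Longrightarrow> \<bar>defect \<phi> k h s\<bar> \<le> 1"
  using weights_le_1[of H \<phi> "k \<otimes> h" "act k s"] weights_le_1[of H \<phi> h s]
  by (auto simp: weights_def defect_def abs_le_iff intro: order_trans) (smt (verit))+

lemma defect_measurable: "weights H \<phi> \<Longrightarrow> k \<in> carrier G \<Longrightarrow> defect \<phi> k h \<in> borel_measurable X"
  unfolding defect_def weights_def
  by (intro borel_measurable_diff measurable_compose[OF act_measurable]) auto

lemma weights_convex:
  assumes "weights H \<phi>" "weights H \<psi>" "0 \<le> t" "t \<le> 1"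
  shows "weights H (\<lambda>h s. (1 - t) * \<phi> h s + t * \<psi> h s)"
proof -
  have "(\<lambda>s. (1 - t) * \<phi> h s + t * \<psi> h s) \<in> borel_measurable X" for h
    using assms(1,2) unfolding weights_def
    by (intro borel_measurable_add borel_measurable_times borel_measurable_const) auto
  then show ?thesis
    using assms by (auto simp: weights_def sum.distrib sum_distrib_left[symmetric])
qed

text \<open>The functions \<open>f\<close> separate the defects of all weights on \<open>H\<close> from \<open>0\<close>.\<close>

definition separates :: "'a set \<Rightarrow> 'a set \<Rightarrow> real \<Rightarrow> ('a \<Rightarrow> 'a \<Rightarrow> 'x \<Rightarrow> real) \<Rightarrow> bool" where
  "separates F H d f \<longleftrightarrow> (\<forall>k\<in>F. \<forall>h. f k h \<in> borel_measurable X) \<and> (\<forall>k h s. \<bar>f k h s\<bar> \<le> 1) \<and>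
    (\<forall>\<psi>. weights H \<psi> \<longrightarrow> d \<le> (\<Sum>k\<in>F. \<Sum>h\<in>window H k. \<integral>s. f k h s * defect \<psi> k h s \<partial>X))"

lemma separation:
  assumes F: "finite F" "F \<subseteq> carrier G" and H: "finite H" and d: "0 < d"
    and far: "\<And>\<phi>. weights H \<phi> \<Longrightarrow> d \<le> (\<Sum>k\<in>F. \<Sum>h\<in>window H k. \<integral>s. \<bar>defect \<phi> k h s\<bar> \<partial>X)"
  shows "\<exists>f. separates F H (d / 2) f"
proof -
  define K where "K = {(\<lambda>(k, h). defect \<phi> k h) | \<phi>. weights H \<phi>}"
  have fin: "finite (window H k)" for k using H by (simp add: window_def)
  have s: "(\<Sum>k\<in>F. \<Sum>h\<in>window H k. u k h) = (\<Sum>(k, h)\<in>Sigma F (window H). u k h)" for u :: "'a \<Rightarrow> 'a \<Rightarrow> real"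
    by (rule sum.Sigma) (use F fin in auto)
  have "\<exists>f. (\<forall>i\<in>Sigma F (window H). f i \<in> borel_measurable X) \<and> (\<forall>i s. \<bar>f i s\<bar> \<le> 1) \<and>
    (\<forall>y\<in>K. d / 2 \<le> (\<Sum>i\<in>Sigma F (window H). \<integral>s. f i s * y i s \<partial>X))"
  proof (rule convex_separation)
    show "finite (Sigma F (window H))" using F fin by auto
    fix x i assume "x \<in> K" and i: "i \<in> Sigma F (window H)"
    then show "x i \<in> borel_measurable X" "\<And>s. \<bar>x i s\<bar> \<le> 1"
      using F H defect_measurable defect_bound by (auto simp: K_def)
  next
    fix x y t assume "x \<in> K" "y \<in> K" and t: "0 \<le> t" "t \<le> (1::real)"
    then obtain \<phi> \<psi> where w: "weights H \<phi>" "x = (\<lambda>(k, h). defect \<phi> k h)" "weights H \<psi>" "y = (\<lambda>(k, h). defect \<psi> k h)"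
      by (auto simp: K_def)
    have "(\<lambda>i s. (1 - t) * x i s + t * y i s) = (\<lambda>(k, h). defect (\<lambda>h s. (1 - t) * \<phi> h s + t * \<psi> h s) k h)"
      by (auto simp: w fun_eq_iff defect_def algebra_simps)
    then show "(\<lambda>i s. (1 - t) * x i s + t * y i s) \<in> K"
      unfolding K_def using weights_convex[OF w(1,3) t] by blast
  next
    fix x assume "x \<in> K"
    then obtain \<phi> where w: "weights H \<phi>" "x = (\<lambda>(k, h). defect \<phi> k h)" by (auto simp: K_def)
    show "d \<le> (\<Sum>i\<in>Sigma F (window H). \<integral>s. \<bar>x i s\<bar> \<partial>X)"
      using far[OF w(1)] unfolding s by (simp add: w(2) case_prod_beta)
  qed (rule d)
  then obtain f where f: "(\<forall>i\<in>Sigma F (window H). f i \<in> borel_measurable X) \<and> (\<forall>i s. \<bar>f i s\<bar> \<le> 1) \<and>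
    (\<forall>y\<in>K. d / 2 \<le> (\<Sum>i\<in>Sigma F (window H). \<integral>s. f i s * y i s \<partial>X))" by (rule exE)
  note f = f[THEN conjunct1, THEN bspec] f[THEN conjunct2, THEN conjunct1, THEN spec, THEN spec]
    f[THEN conjunct2, THEN conjunct2, THEN bspec]
  define f' where "f' k h = (if h \<in> window H k then f (k, h) else (\<lambda>s. 0))" for k h
  have "d / 2 \<le> (\<Sum>k\<in>F. \<Sum>h\<in>window H k. \<integral>s. f' k h s * defect \<psi> k h s \<partial>X)" if "weights H \<psi>" for \<psi>
  proof -
    have "(\<lambda>(k, h). defect \<psi> k h) \<in> K" using that by (auto simp: K_def)
    note f(3)[OF this]
    also have "(\<Sum>i\<in>Sigma F (window H). \<integral>s. f i s * (case i of (k, h) \<Rightarrow> defect \<psi> k h) s \<partial>X) =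
      (\<Sum>(k, h)\<in>Sigma F (window H). \<integral>s. f' k h s * defect \<psi> k h s \<partial>X)"
      by (intro sum.cong) (auto simp: f'_def)
    finally show ?thesis unfolding s .
  qed
  moreover have "f' k h \<in> borel_measurable X" if "k \<in> F" for k h
    using f(1) that by (auto simp: f'_def)
  moreover have "\<bar>f' k h s\<bar> \<le> 1" for k h s using f(2) by (auto simp: f'_def)
  ultimately show ?thesis unfolding separates_def by blast
qed

lemma window_reindex:
  assumes H: "finite H" "H \<subseteq> carrier G" and k: "k \<in> carrier G"
    and w: "\<And>h. h \<notin> H \<Longrightarrow> w h = (0::real)"
  shows "(\<Sum>h\<in>window H k. w (k \<otimes> h)) = (\<Sum>h\<in>H. w h)"
proof -
  have kk: "k \<otimes> (inv k \<otimes> h) = h" "inv k \<otimes> (k \<otimes> h) = h" if "h \<in> carrier G" for h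
    using that k by (simp_all add: m_assoc[symmetric])
  have DG: "h \<in> carrier G" if "h \<in> window H k" for h using that k H by (auto simp: window_def)
  have "(\<Sum>h\<in>window H k. w (k \<otimes> h)) = (\<Sum>h\<in>(\<lambda>h. inv k \<otimes> h) ` H. w (k \<otimes> h))"
  proof (rule sum.mono_neutral_right)
    show "finite (window H k)" using H by (simp add: window_def)
    show "(\<lambda>h. inv k \<otimes> h) ` H \<subseteq> window H k" by (auto simp: window_def)
    show "\<forall>h\<in>window H k - (\<lambda>h. inv k \<otimes> h) ` H. w (k \<otimes> h) = 0"
    proof
      fix h assume h: "h \<in> window H k - (\<lambda>h. inv k \<otimes> h) ` H"
      show "w (k \<otimes> h) = 0"
      proof (rule w, rule notI)
        assume "k \<otimes> h \<in> H"
        then have "inv k \<otimes> (k \<otimes> h) \<in> (\<lambda>h. inv k \<otimes> h) ` H" by (rule imageI)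
        with h kk(2)[OF DG] show False by auto
      qed
    qed
  qed
  also have "\<dots> = (\<Sum>h\<in>H. w h)"
  proof (subst sum.reindex)
    show "inj_on (\<lambda>h. inv k \<otimes> h) H"
    proof (rule inj_onI)
      fix x y assume "x \<in> H" "y \<in> H" "inv k \<otimes> x = inv k \<otimes> y"
      then have "k \<otimes> (inv k \<otimes> x) = k \<otimes> (inv k \<otimes> y)" "x \<in> carrier G" "y \<in> carrier G" using H(2) by auto
      then show "x = y" using kk by simp
    qed
    show "sum ((\<lambda>h. w (k \<otimes> h)) \<circ> (\<lambda>h. inv k \<otimes> h)) H = (\<Sum>h\<in>H. w h)"
      using H kk(1) by (intro sum.cong) auto
  qed
  finally show ?thesis .
qed

text \<open>The pairing with the defect of the Dirac masses at a measurable selection \<open>\<sigma>\<close> involves only the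
  integrals of \<open>f\<close> over finitely many sets, which do not depend on \<open>H'\<close>; this is what allows a
  weak-star limit.\<close>

lemma selector_pairing:
  assumes H: "finite H" "H \<subseteq> carrier G" and H': "finite H'" "H \<subseteq> H'" "H' \<subseteq> carrier G" and k: "k \<in> carrier G"
    and sg: "\<And>s. \<sigma> s \<in> H" and sm: "\<And>h. {s\<in>space X. \<sigma> s = h} \<in> sets X"
    and fm: "\<And>h. f h \<in> borel_measurable X" and fb: "\<And>h s. \<bar>f h s\<bar> \<le> (1::real)"
  shows "(\<Sum>h\<in>window H' k. \<integral>s. f h s * defect (\<lambda>h s. if \<sigma> s = h then 1 else 0) k h s \<partial>X) =
    (\<Sum>h\<in>H. (\<integral>s. indicator (act k -` {s\<in>space X. \<sigma> s = h} \<inter> space X) s * f (inv k \<otimes> h) s \<partial>X) -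
      (\<integral>s. indicator {s\<in>space X. \<sigma> s = h} s * f h s \<partial>X))"
proof -
  define A where "A h = {s\<in>space X. \<sigma> s = h}" for h
  define A' where "A' h = act k -` A h \<inter> space X" for h
  have A: "A h \<in> sets X" "A' h \<in> sets X" for h
    using sm[of h] act_vimage_sets[OF k sm[of h]] by (auto simp: A_def A'_def)
  have int: "integrable X (\<lambda>s. indicator B s * f h s)" if "B \<in> sets X" for B h
    using that fm fb by (intro integrable_const_bound[where B=1] AE_I2) (auto simp: indicator_def)
  have A0: "A h = {}" "A' h = {}" if "h \<notin> H" for h
    using sg that by (auto simp: A_def A'_def)
  have D: "finite (window H' k)" using H' by (simp add: window_def)
  have kh: "k \<otimes> h \<in> carrier G" "inv k \<otimes> (k \<otimes> h) = h" if "h \<in> carrier G" for h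
    using that k by (simp_all add: m_assoc[symmetric])
  have DG: "h \<in> carrier G" if "h \<in> window H' k" for h using that k H' by (auto simp: window_def)
  have "(\<Sum>h\<in>window H' k. \<integral>s. f h s * defect (\<lambda>h s. if \<sigma> s = h then 1 else 0) k h s \<partial>X) =
    (\<Sum>h\<in>window H' k. (\<integral>s. indicator (A' (k \<otimes> h)) s * f h s \<partial>X) - (\<integral>s. indicator (A h) s * f h s \<partial>X))"
  proof (intro sum.cong refl)
    fix h
    have "(\<integral>s. f h s * defect (\<lambda>h s. if \<sigma> s = h then 1 else 0) k h s \<partial>X) =
      (\<integral>s. indicator (A' (k \<otimes> h)) s * f h s - indicator (A h) s * f h s \<partial>X)"
      using act_space[OF k] by (intro Bochner_Integration.integral_cong) (auto simp: defect_def A'_def A_def indicator_def)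
    then show "(\<integral>s. f h s * defect (\<lambda>h s. if \<sigma> s = h then 1 else 0) k h s \<partial>X) =
      (\<integral>s. indicator (A' (k \<otimes> h)) s * f h s \<partial>X) - (\<integral>s. indicator (A h) s * f h s \<partial>X)"
      using int[OF A(1)] int[OF A(2)] by simp
  qed
  also have "\<dots> = (\<Sum>h\<in>window H' k. \<integral>s. indicator (A' (k \<otimes> h)) s * f h s \<partial>X) -
      (\<Sum>h\<in>window H' k. \<integral>s. indicator (A h) s * f h s \<partial>X)"
    by (rule sum_subtractf)
  also have "(\<Sum>h\<in>window H' k. \<integral>s. indicator (A h) s * f h s \<partial>X) = (\<Sum>h\<in>H. \<integral>s. indicator (A h) s * f h s \<partial>X)"
  proof (rule sum.mono_neutral_right[OF D])
    show "H \<subseteq> window H' k" using H' by (auto simp: window_def)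
    show "\<forall>h\<in>window H' k - H. (\<integral>s. indicator (A h) s * f h s \<partial>X) = 0"
      using A0 by simp
  qed
  also have "(\<Sum>h\<in>window H' k. \<integral>s. indicator (A' (k \<otimes> h)) s * f h s \<partial>X) =
      (\<Sum>h\<in>window H' k. \<integral>s. indicator (A' (k \<otimes> h)) s * f (inv k \<otimes> (k \<otimes> h)) s \<partial>X)"
    using kh(2)[OF DG] by (intro sum.cong) auto
  also have "\<dots> = (\<Sum>h\<in>H'. \<integral>s. indicator (A' h) s * f (inv k \<otimes> h) s \<partial>X)"
  proof (rule window_reindex[OF H'(1,3) k])
    fix h assume "h \<notin> H'"
    then have "A' h = {}" using A0 H'(2) by blast
    then show "(\<integral>s. indicator (A' h) s * f (inv k \<otimes> h) s \<partial>X) = 0" by simp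
  qed
  also have "\<dots> = (\<Sum>h\<in>H. \<integral>s. indicator (A' h) s * f (inv k \<otimes> h) s \<partial>X)"
    using A0 by (intro sum.mono_neutral_right H') auto
  finally show ?thesis unfolding A'_def A_def by (simp add: sum_subtractf)
qed

text \<open>Zimmer amenability in the form of a Reiter condition.\<close>

theorem reiter:
  assumes F: "finite F" "F \<subseteq> carrier G" and d: "0 < d"
  shows "\<exists>H \<phi>. finite H \<and> H \<subseteq> carrier G \<and> weights H \<phi> \<and>
    (\<Sum>k\<in>F. \<Sum>h\<in>window H k. \<integral>s. \<bar>defect \<phi> k h s\<bar> \<partial>X) < d"
proof (rule ccontr)
  assume neg: "\<not> ?thesis"
  define e where "e = from_nat_into (carrier G)"
  have re: "range e = carrier G" unfolding e_def by (rule range_from_nat_into[OF _ count]) auto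
  have eG: "e j \<in> carrier G" for j using re by auto
  define H where "H n = e ` {..n}" for n :: nat
  have H: "finite (H n)" "H n \<subseteq> carrier G" for n using eG by (auto simp: H_def)
  have "\<exists>f. separates F (H n) (d / 2) f" for n
    by (rule separation[OF F H(1) d]) (use neg H[of n] in \<open>force simp: not_less\<close>)
  then have "\<forall>n. \<exists>f. separates F (H n) (d / 2) f" by blast
  from choice[OF this] obtain f where f: "\<forall>n. separates F (H n) (d / 2) (f n)" by (rule exE)
  have fm: "f n k h \<in> borel_measurable X" if "k \<in> F" for n k h
    using f that by (simp add: separates_def)
  have fb: "\<bar>f n k h s\<bar> \<le> 1" for n k h s using f by (simp add: separates_def)
  have fs: "d / 2 \<le> (\<Sum>k\<in>F. \<Sum>h\<in>window (H n) k. \<integral>s. f n k h s * defect \<psi> k h s \<partial>X)" if "weights (H n) \<psi>" for n \<psi>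
    using f that by (simp add: separates_def)
  obtain U where "nat_ultrafilter U" using ex_nat_ultrafilter by blast
  then interpret U: nat_ultrafilter U .
  have "\<forall>i. \<exists>g. fst i \<in> F \<longrightarrow> g \<in> borel_measurable X \<and> (\<forall>x. \<bar>g x\<bar> \<le> 1) \<and>
    (\<forall>A\<in>sets X. ((\<lambda>n. \<integral>x. indicator A x * f n (fst i) (snd i) x \<partial>X) \<longlongrightarrow> (\<integral>x. indicator A x * g x \<partial>X)) U)"
  proof
    fix i :: "'a \<times> 'a"
    show "\<exists>g. fst i \<in> F \<longrightarrow> g \<in> borel_measurable X \<and> (\<forall>x. \<bar>g x\<bar> \<le> 1) \<and>
      (\<forall>A\<in>sets X. ((\<lambda>n. \<integral>x. indicator A x * f n (fst i) (snd i) x \<partial>X) \<longlongrightarrow> (\<integral>x. indicator A x * g x \<partial>X)) U)"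
    proof (cases "fst i \<in> F")
      case True
      from U.weak_star_limit[of X "\<lambda>n. f n (fst i) (snd i)", OF prob fm[OF True] fb]
      show ?thesis by blast
    qed simp
  qed
  from choice[OF this] obtain g0 where g0: "\<forall>i. fst i \<in> F \<longrightarrow> g0 i \<in> borel_measurable X \<and> (\<forall>x. \<bar>g0 i x\<bar> \<le> 1) \<and>
    (\<forall>A\<in>sets X. ((\<lambda>n. \<integral>x. indicator A x * f n (fst i) (snd i) x \<partial>X) \<longlongrightarrow> (\<integral>x. indicator A x * g0 i x \<partial>X)) U)"
    by (rule exE)
  define g where "g k h = (if k \<in> F then g0 (k, h) else (\<lambda>s. 0))" for k h
  have gm: "g k h \<in> borel_measurable X" for k h using spec[OF g0, of "(k, h)"] by (simp add: g_def)
  have gb: "\<bar>g k h s\<bar> \<le> 1" for k h s using spec[OF g0, of "(k, h)"] by (simp add: g_def)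
  have glim: "((\<lambda>n. \<integral>x. indicator A x * f n k h x \<partial>X) \<longlongrightarrow> (\<integral>x. indicator A x * g k h x \<partial>X)) U"
    if "k \<in> F" "A \<in> sets X" for k h A
    using spec[OF g0, of "(k, h)"] that by (simp add: g_def)
  have dm: "drift F g (e j) \<in> borel_measurable X" for j by (rule drift_measurable[OF F eG gm])
  have "d / 2 \<le> (\<integral>s. Min ((\<lambda>j. drift F g (e j) s) ` {..N}) \<partial>X)" for N
  proof -
    \<comment> \<open>a measurable selector of a minimiser\<close>
    define l where "l s = (LEAST j. j \<le> N \<and> (\<forall>i\<le>N. drift F g (e j) s \<le> drift F g (e i) s))" for s
    have l: "l s \<le> N" "drift F g (e (l s)) s = Min ((\<lambda>j. drift F g (e j) s) ` {..N})" for s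
    proof -
      let ?Q = "\<lambda>j. j \<le> N \<and> (\<forall>i\<le>N. drift F g (e j) s \<le> drift F g (e i) s)"
      have "Min ((\<lambda>j. drift F g (e j) s) ` {..N}) \<in> (\<lambda>j. drift F g (e j) s) ` {..N}" by (rule Min_in) auto
      then obtain j where j: "Min ((\<lambda>j. drift F g (e j) s) ` {..N}) = drift F g (e j) s" "j \<in> {..N}"
        by (rule imageE)
      have "drift F g (e j) s \<le> drift F g (e i) s" if "i \<le> N" for i
        unfolding j(1)[symmetric] using that by (intro Min_le) auto
      with j(2) have "?Q j" by simp
      then have Q: "?Q (l s)" unfolding l_def by (rule LeastI)
      then show "l s \<le> N" by simp
      show "drift F g (e (l s)) s = Min ((\<lambda>j. drift F g (e j) s) ` {..N})"
        by (rule Min_eqI[symmetric]) (use Q in auto)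
    qed
    define \<sigma> where "\<sigma> s = e (l s)" for s
    have sN: "\<sigma> s \<in> H N" for s using l(1) by (auto simp: \<sigma>_def H_def)
    have "l \<in> X \<rightarrow>\<^sub>M count_space UNIV"
      unfolding l_def using dm by measurable
    then have "(\<lambda>s. \<sigma> s) \<in> X \<rightarrow>\<^sub>M count_space UNIV" unfolding \<sigma>_def by (rule measurable_compose) simp
    then have sm: "{s\<in>space X. \<sigma> s = h} \<in> sets X" for h by measurable
    define \<psi> where "\<psi> h s = (if \<sigma> s = h then 1 else 0 :: real)" for h s
    have w: "weights (H n) \<psi>" if "N \<le> n" for n
    proof -
      have "\<sigma> s \<in> H n" for s using sN[of s] that by (auto simp: H_def)
      moreover have "\<psi> h \<in> borel_measurable X" for h
        unfolding \<psi>_def using sm[of h] by measurable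
      ultimately show ?thesis using H by (auto simp: weights_def \<psi>_def)
    qed
    define A where "A h = {s\<in>space X. \<sigma> s = h}" for h
    have A: "A h \<in> sets X" for h using sm by (simp add: A_def)
    define V where "V f = (\<Sum>k\<in>F. \<Sum>h\<in>H N. (\<integral>s. indicator (act k -` A h \<inter> space X) s * f k (inv k \<otimes> h) s \<partial>X) -
      (\<integral>s. indicator (A h) s * f k h s \<partial>X))" for f :: "'a \<Rightarrow> 'a \<Rightarrow> 'x \<Rightarrow> real"
    have Vf: "d / 2 \<le> V (f n)" if n: "N \<le> n" for n
    proof -
      have "d / 2 \<le> (\<Sum>k\<in>F. \<Sum>h\<in>window (H n) k. \<integral>s. f n k h s * defect \<psi> k h s \<partial>X)" by (rule fs[OF w[OF n]])
      also have "\<dots> = V (f n)"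
        unfolding V_def
      proof (rule sum.cong[OF refl])
        fix k assume k: "k \<in> F"
        show "(\<Sum>h\<in>window (H n) k. \<integral>s. f n k h s * defect \<psi> k h s \<partial>X) =
          (\<Sum>h\<in>H N. (\<integral>s. indicator (act k -` A h \<inter> space X) s * f n k (inv k \<otimes> h) s \<partial>X) -
            (\<integral>s. indicator (A h) s * f n k h s \<partial>X))"
          unfolding \<psi>_def[abs_def] A_def
        proof (rule selector_pairing[OF H H(1) _ H(2) _ sN sm fm[OF k] fb])
          show "H N \<subseteq> H n" using n by (auto simp: H_def)
          show "k \<in> carrier G" using k F by auto
        qed
      qed
      finally show ?thesis .
    qed
    have "((\<lambda>n. V (f n)) \<longlongrightarrow> V g) U"
      unfolding V_def using A act_vimage_sets F
      by (intro tendsto_sum tendsto_diff glim) auto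
    then have "d / 2 \<le> V g"
      by (rule tendsto_lowerbound[OF _ _ U.not_bot]) (use U.eventually_ge[of N] Vf in \<open>auto elim: eventually_mono\<close>)
    also have "V g = (\<integral>s. (\<Sum>h\<in>H N. indicator (A h) s * drift F g h s) \<partial>X)"
    proof -
      have kG: "k \<in> carrier G" "inv k \<in> carrier G" if "k \<in> F" for k using that F by auto
      have m1: "(\<lambda>s. indicator (A h) s * g k (inv k \<otimes> h) (act (inv k) s)) \<in> borel_measurable X" if "k \<in> F" for k h
        using A[of h] measurable_compose[OF act_measurable[OF kG(2)[OF that]] gm] by measurable
      have i1: "integrable X (\<lambda>s. \<rho> k s * (indicator (A h) s * g k (inv k \<otimes> h) (act (inv k) s)))" if "k \<in> F" for k h
      proof (intro integrable_const_bound[where B="b k"] AE_I2)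
        show "(\<lambda>s. \<rho> k s * (indicator (A h) s * g k (inv k \<otimes> h) (act (inv k) s))) \<in> borel_measurable X"
          by (intro borel_measurable_times rho_meas[OF kG(1)[OF that]] m1[OF that])
        fix s
        have "\<bar>\<rho> k s\<bar> * \<bar>indicator (A h) s * g k (inv k \<otimes> h) (act (inv k) s)\<bar> \<le> b k * 1"
          using rho_bd[OF kG(1)[OF that], of s] gb by (intro mult_mono) (auto simp: indicator_def)
        then show "norm (\<rho> k s * (indicator (A h) s * g k (inv k \<otimes> h) (act (inv k) s))) \<le> b k"
          by (simp add: abs_mult)
      qed
      have i2: "integrable X (\<lambda>s. indicator (A h) s * g k h s)" for k h
        using A gm gb by (intro integrable_const_bound[where B=1] AE_I2) (auto simp: indicator_def)
      have e1: "(\<integral>s. indicator (act k -` A h \<inter> space X) s * g k (inv k \<otimes> h) s \<partial>X) =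
        (\<integral>s. \<rho> k s * (indicator (A h) s * g k (inv k \<otimes> h) (act (inv k) s)) \<partial>X)" if "k \<in> F" for k h
        unfolding integral_rho[OF kG(1)[OF that] m1[OF that]]
        using act_inv(1)[OF kG(1)[OF that]]
        by (intro Bochner_Integration.integral_cong) (auto simp: indicator_def)
      have "V g = (\<Sum>k\<in>F. \<Sum>h\<in>H N. (\<integral>s. \<rho> k s * (indicator (A h) s * g k (inv k \<otimes> h) (act (inv k) s)) - indicator (A h) s * g k h s \<partial>X))"
        unfolding V_def using e1 i1 i2 by (intro sum.cong refl) simp
      also have "\<dots> = (\<Sum>h\<in>H N. \<Sum>k\<in>F. (\<integral>s. \<rho> k s * (indicator (A h) s * g k (inv k \<otimes> h) (act (inv k) s)) - indicator (A h) s * g k h s \<partial>X))"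
        by (rule sum.swap)
      also have "\<dots> = (\<integral>s. (\<Sum>h\<in>H N. \<Sum>k\<in>F. \<rho> k s * (indicator (A h) s * g k (inv k \<otimes> h) (act (inv k) s)) - indicator (A h) s * g k h s) \<partial>X)"
        using i1 i2 by (simp add: Bochner_Integration.integral_sum Bochner_Integration.integrable_sum)
      also have "\<dots> = (\<integral>s. (\<Sum>h\<in>H N. indicator (A h) s * drift F g h s) \<partial>X)"
        by (intro Bochner_Integration.integral_cong refl sum.cong) (auto simp: drift_def sum_distrib_left algebra_simps intro!: sum.cong)
      finally show ?thesis .
    qed
    also have "\<dots> = (\<integral>s. Min ((\<lambda>j. drift F g (e j) s) ` {..N}) \<partial>X)"
    proof (rule Bochner_Integration.integral_cong[OF refl])
      fix s assume s: "s \<in> space X"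
      have "(\<Sum>h\<in>H N. indicator (A h) s * drift F g h s) = (\<Sum>h\<in>H N. if h = \<sigma> s then drift F g h s else 0)"
        using s by (intro sum.cong) (auto simp: A_def)
      also have "\<dots> = drift F g (\<sigma> s) s" using sN H by simp
      finally show "(\<Sum>h\<in>H N. indicator (A h) s * drift F g h s) = Min ((\<lambda>j. drift F g (e j) s) ` {..N})"
        by (simp add: \<sigma>_def l(2))
    qed
    finally show ?thesis .
  qed
  from no_uniform_drift[OF F gm gb re this] d show False by simp
qed

end

section \<open>Approximation by measures on the group times the natural numbers\<close>

text \<open>Finitely many nonnegative measurable functions are recovered up to \<open>\<delta>\<close> from one measurable code
  in \<open>\<nat>\<close>, made of their rounded values.\<close>

lemma finite_discretization:
  fixes f :: "'i \<Rightarrow> 'x \<Rightarrow> real"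
  assumes "finite I" and "0 < \<delta>"
    and "\<And>i. i \<in> I \<Longrightarrow> f i \<in> borel_measurable X"
    and "\<And>i s. i \<in> I \<Longrightarrow> 0 \<le> f i s"
  shows "\<exists>q\<in>X \<rightarrow>\<^sub>M (count_space UNIV :: nat measure). \<exists>d. \<forall>i\<in>I. \<forall>s. \<bar>d i (q s) - f i s\<bar> \<le> \<delta>"
  using assms
proof (induction I rule: finite_induct)
  case empty
  show ?case by (rule bexI[of _ "\<lambda>_. 0"]) auto
next
  case (insert i I)
  then obtain q :: "'x \<Rightarrow> nat" and d where q: "q \<in> X \<rightarrow>\<^sub>M count_space UNIV" and d: "\<forall>i\<in>I. \<forall>s. \<bar>d i (q s) - f i s\<bar> \<le> \<delta>"
    by auto
  define p where "p s = nat \<lfloor>f i s / \<delta>\<rfloor>" for s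
  have fi: "f i \<in> borel_measurable X" "\<And>s. 0 \<le> f i s" using insert by auto
  have p: "p \<in> X \<rightarrow>\<^sub>M count_space UNIV" unfolding p_def using fi(1) by measurable
  have pd: "\<bar>real (p s) * \<delta> - f i s\<bar> \<le> \<delta>" for s
  proof -
    have "real (p s) = of_int \<lfloor>f i s / \<delta>\<rfloor>" using fi(2)[of s] insert(4) by (simp add: p_def)
    then have "real (p s) \<le> f i s / \<delta>" "f i s / \<delta> \<le> real (p s) + 1"
      using of_int_floor_le[of "f i s / \<delta>"] floor_correct[of "f i s / \<delta>"] by linarith+
    then show ?thesis using insert(4) by (simp add: field_simps abs_le_iff)
  qed
  define q' where "q' s = prod_encode (p s, q s)" for s
  have "q' \<in> X \<rightarrow>\<^sub>M count_space UNIV" unfolding q'_def using p q by measurable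
  moreover have "\<forall>j\<in>insert i I. \<forall>s. \<bar>(if j = i then real (fst (prod_decode (q' s))) * \<delta> else d j (snd (prod_decode (q' s)))) - f j s\<bar> \<le> \<delta>"
    using d pd by (auto simp: q'_def)
  ultimately show ?case
    by (intro bexI[of _ q'] exI[of _ "\<lambda>j n. if j = i then real (fst (prod_decode n)) * \<delta> else d j (snd (prod_decode n))"]) auto
qed

lemma abs_integral_le:
  fixes f g :: "'z \<Rightarrow> real"
  assumes "integrable N f" "integrable N g" "\<And>x. x \<in> space N \<Longrightarrow> \<bar>f x\<bar> \<le> g x"
  shows "\<bar>\<integral>x. f x \<partial>N\<bar> \<le> (\<integral>x. g x \<partial>N)"
  by (rule order_trans[OF integral_abs_bound integral_mono]) (use assms in auto)

text \<open>The measure \<open>average X act\<close>, written \<open>\<nu>\<close> below, and a bounded version \<open>\<eta>\<close> of its cocycle. Two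
  measures are needed: almost equivariance holds with respect to \<open>X\<close>, whose derivatives \<open>\<rho>\<close> must
  already be bounded, and averaging \<open>X\<close> once more matches the averaging on \<open>G \<times> \<nat>\<close>.\<close>

locale approximation = group_weight G m M + amenable_action G X act S E \<rho> b
  for G (structure) and m :: "'a pmf" and M :: "'a \<Rightarrow> real" and X :: "'x measure" and act and S and E and \<rho> and b +
  fixes \<eta> :: "'a \<Rightarrow> 'x \<Rightarrow> real"
  assumes eta_meas: "\<And>g. g \<in> carrier G \<Longrightarrow> \<eta> g \<in> borel_measurable X"
    and eta_bd: "\<And>g s. g \<in> carrier G \<Longrightarrow> 0 \<le> \<eta> g s \<and> \<eta> g s \<le> M g"
    and eta_density: "\<And>g. g \<in> carrier G \<Longrightarrow> density (average X act) (\<lambda>s. ennreal (\<eta> g s)) = distr (average X act) (average X act) (act g)"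
begin

sublocale WX: weighted_action G m M X act by unfold_locales

abbreviation \<nu> :: "'x measure" where "\<nu> \<equiv> average X act"

lemma prob_nu: "prob_space \<nu>" by (rule WX.prob_average)

lemma integral_eta:
  assumes g: "g \<in> carrier G" and u: "u \<in> borel_measurable X"
  shows "(\<integral>s. \<eta> g s * u s \<partial>\<nu>) = (\<integral>s. u (act g s) \<partial>\<nu>)"
proof -
  have mc: "borel_measurable \<nu> = borel_measurable X" "\<nu> \<rightarrow>\<^sub>M \<nu> = X \<rightarrow>\<^sub>M X"
    by (simp_all cong: measurable_cong_sets)
  have "(\<integral>s. u (act g s) \<partial>\<nu>) = (\<integral>s. u s \<partial>distr \<nu> \<nu> (act g))"
    using act_measurable[OF g] u by (intro integral_distr[symmetric]) (simp_all add: mc)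
  also have "\<dots> = (\<integral>s. \<eta> g s * u s \<partial>\<nu>)"
    unfolding eta_density[OF g, symmetric]
    using integral_density[of u \<nu> "\<eta> g"] eta_meas[OF g] eta_bd[OF g] u by (simp add: mc)
  finally show ?thesis by simp
qed

text \<open>The total defect of \<open>\<phi>\<close> under \<open>k\<close>.\<close>

definition err :: "'a set \<Rightarrow> ('a \<Rightarrow> 'x \<Rightarrow> real) \<Rightarrow> 'a \<Rightarrow> real" where
  "err H \<phi> k = (if k \<in> carrier G then \<Sum>h\<in>window H k. \<integral>s. \<bar>defect \<phi> k h s\<bar> \<partial>X else 0)"

lemma err_bounds:
  assumes H: "finite H" "H \<subseteq> carrier G" and w: "weights H \<phi>"
  shows "0 \<le> err H \<phi> k" "err H \<phi> k \<le> 2"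
proof -
  show "0 \<le> err H \<phi> k" by (auto simp: err_def intro!: sum_nonneg)
  show "err H \<phi> k \<le> 2"
  proof (cases "k \<in> carrier G")
    case True
    have i: "integrable X (\<lambda>s. \<bar>defect \<phi> k h s\<bar>)" for h
      using defect_measurable[OF w True] defect_bound[OF w H(1)] by (intro integrable_const_bound[where B=1]) auto
    have "err H \<phi> k = (\<integral>s. (\<Sum>h\<in>window H k. \<bar>defect \<phi> k h s\<bar>) \<partial>X)"
      using True i by (simp add: err_def Bochner_Integration.integral_sum)
    also have "\<dots> \<le> (\<integral>s. 2 \<partial>X)"
    proof (intro integral_mono Bochner_Integration.integrable_sum i integrable_const)
      fix s
      have "(\<Sum>h\<in>window H k. \<bar>defect \<phi> k h s\<bar>) \<le> (\<Sum>h\<in>window H k. \<phi> (k \<otimes> h) (act k s) + \<phi> h s)"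
        using w by (intro sum_mono) (auto simp: defect_def weights_def abs_le_iff intro: order_trans[of _ 0])
      also have "\<dots> = (\<Sum>h\<in>H. \<phi> h (act k s)) + (\<Sum>h\<in>window H k. \<phi> h s)"
        using window_reindex[OF H True, of "\<lambda>h. \<phi> h (act k s)"] w by (simp add: sum.distrib weights_def)
      also have "(\<Sum>h\<in>window H k. \<phi> h s) = (\<Sum>h\<in>H. \<phi> h s)"
        using w H by (intro sum.mono_neutral_right) (auto simp: window_def weights_def)
      also have "(\<Sum>h\<in>H. \<phi> h (act k s)) + (\<Sum>h\<in>H. \<phi> h s) = 2" using w by (simp add: weights_def)
      finally show "(\<Sum>h\<in>window H k. \<bar>defect \<phi> k h s\<bar>) \<le> 2" .
    qed
    finally show ?thesis by (simp add: prob_space)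
  qed (simp add: err_def)
qed

lemma ex_small_error:
  assumes d: "0 < d"
  shows "\<exists>H \<phi>. finite H \<and> H \<subseteq> carrier G \<and> weights H \<phi> \<and> (\<integral>k. err H \<phi> k \<partial>m) < d"
proof -
  define e where "e = from_nat_into (carrier G)"
  have re: "range e = carrier G" unfolding e_def by (rule range_from_nat_into[OF _ count]) auto
  have "(\<lambda>n. measure m (e ` {..n})) \<longlonglongrightarrow> measure m (\<Union>n. e ` {..n})"
    by (intro measure_pmf.finite_Lim_measure_incseq) (auto simp: incseq_def)
  moreover have "(\<Union>n. e ` {..n}) = carrier G" unfolding re[symmetric] by (auto intro: imageI)
  moreover have "measure m (carrier G) = 1" unfolding set_m[symmetric] by (rule measure_pmf.prob_eq_1[THEN iffD2]) (auto simp: AE_measure_pmf)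
  ultimately have "(\<lambda>n. measure m (e ` {..n})) \<longlonglongrightarrow> 1" by simp
  then have "eventually (\<lambda>n. 1 - d / 4 < measure m (e ` {..n})) sequentially"
    using d by (intro order_tendstoD) auto
  then obtain n where n: "1 - d / 4 < measure m (e ` {..n})" by (auto simp: eventually_sequentially)
  define F where "F = e ` {..n}"
  have F: "finite F" "F \<subseteq> carrier G" using re by (auto simp: F_def)
  obtain H \<phi> where H: "finite H" "H \<subseteq> carrier G" and w: "weights H \<phi>"
    and small: "(\<Sum>k\<in>F. \<Sum>h\<in>window H k. \<integral>s. \<bar>defect \<phi> k h s\<bar> \<partial>X) < d / 2"
    using reiter[OF F, of "d / 2"] d by auto
  note eb = err_bounds[OF H w]
  have e4: "err H \<phi> k \<le> 4" for k using eb(2)[of k] by simp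
  have "(\<integral>k. err H \<phi> k \<partial>m) \<le> (\<integral>k. indicator F k * err H \<phi> k + 2 * indicator (- F) k \<partial>m)"
    using eb e4 by (intro integral_mono measure_pmf.integrable_const_bound[where B=4])
      (auto simp: indicator_def)
  also have "\<dots> = (\<integral>k. indicator F k * err H \<phi> k \<partial>m) + 2 * measure m (- F)"
  proof (subst Bochner_Integration.integral_add)
    show "integrable m (\<lambda>k. indicator F k * err H \<phi> k)"
      using eb by (intro measure_pmf.integrable_const_bound[where B=2]) (auto simp: indicator_def)
    show "integrable m (\<lambda>k. 2 * indicator (- F) k :: real)"
      by (intro measure_pmf.integrable_const_bound[where B=2]) (auto simp: indicator_def)
  qed simp
  also have "(\<integral>k. indicator F k * err H \<phi> k \<partial>m) = (\<Sum>k\<in>F. pmf m k * err H \<phi> k)"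
    by (subst integral_measure_pmf[OF F(1)]) (auto simp: indicator_def split: if_splits)
  also have "\<dots> \<le> (\<Sum>k\<in>F. err H \<phi> k)"
    using eb pmf_le_1 by (intro sum_mono mult_left_le_one_le) auto
  also have "\<dots> = (\<Sum>k\<in>F. \<Sum>h\<in>window H k. \<integral>s. \<bar>defect \<phi> k h s\<bar> \<partial>X)"
    using F by (intro sum.cong) (auto simp: err_def)
  also have "measure m (- F) = 1 - measure m F"
    using measure_pmf.prob_compl[of F m] by (simp add: Compl_eq_Diff_UNIV)
  finally have "(\<integral>k. err H \<phi> k \<partial>m) < d"
    using small n by (simp add: F_def)
  with H w show ?thesis by blast
qed

text \<open>The measure \<open>\<phi>(h, s) dX(s)\<close> on \<open>G \<times> X\<close>, carried to \<open>G \<times> \<nat>\<close> by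
  \<open>(h, s) \<mapsto> (h, q(h\<^sup>-\<^sup>1s))\<close>, which intertwines the diagonal action with translation.\<close>

definition base :: "('a \<Rightarrow> 'x \<Rightarrow> real) \<Rightarrow> ('x \<Rightarrow> nat) \<Rightarrow> ('a \<times> nat) measure" where
  "base \<phi> q = distr (density (count_space (carrier G) \<Otimes>\<^sub>M X) (\<lambda>y. ennreal (\<phi> (fst y) (snd y))))
     (count_space (carrier G \<times> UNIV)) (\<lambda>y. (fst y, q (act (inv (fst y)) (snd y))))"

lemma sets_base[simp]: "sets (base \<phi> q) = Pow (carrier G \<times> UNIV)" by (simp add: base_def)
lemma space_base[simp]: "space (base \<phi> q) = carrier G \<times> UNIV" by (simp add: base_def)

lemma measurable_base: "f \<in> base \<phi> q \<rightarrow>\<^sub>M N \<longleftrightarrow> f \<in> carrier G \<times> UNIV \<rightarrow> space N"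
proof -
  have "base \<phi> q \<rightarrow>\<^sub>M N = count_space (carrier G \<times> UNIV) \<rightarrow>\<^sub>M N"
    by (rule measurable_cong_sets) simp_all
  then show ?thesis by (simp add: measurable_count_space_eq1)
qed

lemma nn_integral_base:
  assumes H: "finite H" "H \<subseteq> carrier G" and w: "weights H \<phi>" and q: "q \<in> X \<rightarrow>\<^sub>M count_space UNIV"
  shows "(\<integral>\<^sup>+y. u y \<partial>base \<phi> q) = (\<Sum>h\<in>H. \<integral>\<^sup>+s. ennreal (\<phi> h s) * u (h, q (act (inv h) s)) \<partial>X)"
proof -
  let ?P = "count_space (carrier G) \<Otimes>\<^sub>M X"
  let ?Q = "\<lambda>y. (fst y, q (act (inv (fst y)) (snd y)))"
  have fm: "(\<lambda>y. ennreal (\<phi> (fst y) (snd y))) \<in> borel_measurable ?P"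
    using w by (intro measurable_pair_measure_countable1 count) (auto simp: weights_def)
  have Q: "?Q \<in> ?P \<rightarrow>\<^sub>M count_space (carrier G \<times> UNIV)"
  proof (rule measurable_pair_measure_countable1[OF count])
    fix h assume h: "h \<in> carrier G"
    have "(\<lambda>s. q (act (inv h) s)) \<in> X \<rightarrow>\<^sub>M count_space UNIV"
      using h by (intro measurable_compose[OF act_measurable q]) auto
    then have "(\<lambda>s. (h, q (act (inv h) s))) \<in> X \<rightarrow>\<^sub>M count_space (carrier G \<times> UNIV)"
      by (rule measurable_compose) (use h in \<open>auto simp: measurable_count_space_eq1\<close>)
    then show "(\<lambda>y. ?Q (h, y)) \<in> X \<rightarrow>\<^sub>M count_space (carrier G \<times> UNIV)" by simp
  qed
  have um: "(\<lambda>y. u (?Q y)) \<in> borel_measurable ?P"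
    by (rule measurable_compose[OF Q]) (simp add: measurable_count_space_eq1)
  have "(\<integral>\<^sup>+y. u y \<partial>base \<phi> q) = (\<integral>\<^sup>+y. u (?Q y) \<partial>density ?P (\<lambda>y. ennreal (\<phi> (fst y) (snd y))))"
    unfolding base_def using Q by (intro nn_integral_distr) (auto simp: measurable_count_space_eq1)
  also have "\<dots> = (\<integral>\<^sup>+y. ennreal (\<phi> (fst y) (snd y)) * u (?Q y) \<partial>?P)"
    by (rule nn_integral_density[OF fm um])
  also have "\<dots> = (\<integral>\<^sup>+h. (\<integral>\<^sup>+s. ennreal (\<phi> h s) * u (h, q (act (inv h) s)) \<partial>X) \<partial>count_space (carrier G))"
    by (subst nn_integral_fst[symmetric]) (use fm um in auto)
  also have "\<dots> = (\<Sum>h\<in>H. \<integral>\<^sup>+s. ennreal (\<phi> h s) * u (h, q (act (inv h) s)) \<partial>X)"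
    using w H by (intro nn_integral_count_space') (auto simp: weights_def)
  finally show ?thesis .
qed

lemma integral_base:
  assumes H: "finite H" "H \<subseteq> carrier G" and w: "weights H \<phi>" and q: "q \<in> X \<rightarrow>\<^sub>M count_space UNIV"
    and u: "\<And>y. 0 \<le> u y" "\<And>y. u y \<le> B"
  shows "(\<integral>y. u y \<partial>base \<phi> q) = (\<Sum>h\<in>H. \<integral>s. \<phi> h s * u (h, q (act (inv h) s)) \<partial>X)"
proof -
  have i: "integrable X (\<lambda>s. \<phi> h s * u (h, q (act (inv h) s)))" if "h \<in> H" for h
  proof (intro integrable_const_bound[where B=B] AE_I2)
    have "(\<lambda>s. q (act (inv h) s)) \<in> X \<rightarrow>\<^sub>M count_space UNIV"
      using that H by (intro measurable_compose[OF act_measurable q]) auto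
    then have "(\<lambda>s. u (h, q (act (inv h) s))) \<in> borel_measurable X"
      by (rule measurable_compose) simp
    then show "(\<lambda>s. \<phi> h s * u (h, q (act (inv h) s))) \<in> borel_measurable X"
      using w unfolding weights_def by (intro borel_measurable_times) auto
    fix s
    have "\<phi> h s * u (h, q (act (inv h) s)) \<le> 1 * B"
      using weights_le_1[OF w H(1)] w u by (intro mult_mono) (auto simp: weights_def)
    moreover have "0 \<le> \<phi> h s * u (h, q (act (inv h) s))" using w u by (simp add: weights_def)
    ultimately show "norm (\<phi> h s * u (h, q (act (inv h) s))) \<le> B" by simp
  qed
  have "(\<integral>y. u y \<partial>base \<phi> q) = enn2real (\<integral>\<^sup>+y. ennreal (u y) \<partial>base \<phi> q)"
    using u by (intro integral_eq_nn_integral) (auto simp: measurable_base)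
  also have "(\<integral>\<^sup>+y. ennreal (u y) \<partial>base \<phi> q) = (\<Sum>h\<in>H. \<integral>\<^sup>+s. ennreal (\<phi> h s * u (h, q (act (inv h) s))) \<partial>X)"
    unfolding nn_integral_base[OF H w q] using u w by (simp add: ennreal_mult weights_def)
  also have "\<dots> = (\<Sum>h\<in>H. ennreal (\<integral>s. \<phi> h s * u (h, q (act (inv h) s)) \<partial>X))"
    using i u w by (intro sum.cong refl nn_integral_eq_integral) (auto simp: weights_def)
  also have "\<dots> = ennreal (\<Sum>h\<in>H. \<integral>s. \<phi> h s * u (h, q (act (inv h) s)) \<partial>X)"
    using u w by (intro sum_ennreal) (auto simp: weights_def intro!: integral_nonneg_AE)
  also have "enn2real \<dots> = (\<Sum>h\<in>H. \<integral>s. \<phi> h s * u (h, q (act (inv h) s)) \<partial>X)"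
    using u w by (intro enn2real_ennreal sum_nonneg integral_nonneg_AE) (auto simp: weights_def)
  finally show ?thesis .
qed

lemma base_weighted_action:
  assumes H: "finite H" "H \<subseteq> carrier G" and w: "weights H \<phi>" and q: "q \<in> X \<rightarrow>\<^sub>M count_space UNIV"
  shows "weighted_action G m M (base \<phi> q) (transl_act G)"
proof -
  have "prob_space (base \<phi> q)"
  proof
    have "emeasure (base \<phi> q) (space (base \<phi> q)) = (\<integral>\<^sup>+y. 1 \<partial>base \<phi> q)" by simp
    also have "\<dots> = (\<Sum>h\<in>H. \<integral>\<^sup>+s. ennreal (\<phi> h s) \<partial>X)" unfolding nn_integral_base[OF H w q] by simp
    also have "\<dots> = (\<integral>\<^sup>+s. (\<Sum>h\<in>H. ennreal (\<phi> h s)) \<partial>X)"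
      using w by (intro nn_integral_sum[symmetric]) (auto simp: weights_def)
    also have "\<dots> = (\<integral>\<^sup>+s. 1 \<partial>X)"
      using w by (intro nn_integral_cong) (auto simp: weights_def sum_ennreal)
    finally show "emeasure (base \<phi> q) (space (base \<phi> q)) = 1" by (simp add: emeasure_space_1)
  qed
  moreover have "group_action G (space (base \<phi> q)) (transl_act G)"
    by (rule group_actionI[OF group_axioms]) (auto simp: transl_act_def m_assoc)
  moreover have "transl_act G g \<in> base \<phi> q \<rightarrow>\<^sub>M base \<phi> q" if "g \<in> carrier G" for g
    using that by (auto simp: measurable_base transl_act_def)
  ultimately show ?thesis
    by (intro weighted_action.intro group_weight_axioms measurable_action.intro group_axioms measurable_action_axioms.intro)
qed

text \<open>The integral of \<open>u\<close> over the fibre of \<open>s\<close> with respect to \<open>\<phi>\<close>.\<close>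

definition fibre :: "'a set \<Rightarrow> ('a \<Rightarrow> 'x \<Rightarrow> real) \<Rightarrow> ('x \<Rightarrow> nat) \<Rightarrow> ('a \<times> nat \<Rightarrow> real) \<Rightarrow> 'x \<Rightarrow> real" where
  "fibre H \<phi> q u s = (\<Sum>h\<in>H. \<phi> h s * u (h, q (act (inv h) s)))"

lemma fibre_measurable:
  assumes H: "finite H" "H \<subseteq> carrier G" and w: "weights H \<phi>" and q: "q \<in> X \<rightarrow>\<^sub>M count_space UNIV"
  shows "fibre H \<phi> q u \<in> borel_measurable X"
  unfolding fibre_def
proof (intro borel_measurable_sum borel_measurable_times)
  fix h assume h: "h \<in> H"
  show "\<phi> h \<in> borel_measurable X" using w by (simp add: weights_def)
  have "(\<lambda>s. q (act (inv h) s)) \<in> X \<rightarrow>\<^sub>M count_space UNIV"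
    using h H by (intro measurable_compose[OF act_measurable q]) auto
  then show "(\<lambda>s. u (h, q (act (inv h) s))) \<in> borel_measurable X"
    by (rule measurable_compose) simp
qed

lemma fibre_bounds:
  assumes w: "weights H \<phi>" and u: "\<And>y. 0 \<le> u y" "\<And>y. u y \<le> B"
  shows "0 \<le> fibre H \<phi> q u s" "fibre H \<phi> q u s \<le> B"
proof -
  show "0 \<le> fibre H \<phi> q u s" unfolding fibre_def using w u by (intro sum_nonneg) (auto simp: weights_def)
  have "fibre H \<phi> q u s \<le> (\<Sum>h\<in>H. \<phi> h s * B)"
    unfolding fibre_def using w u by (intro sum_mono mult_left_mono) (auto simp: weights_def)
  also have "\<dots> = B" using w by (simp add: sum_distrib_right[symmetric] weights_def)
  finally show "fibre H \<phi> q u s \<le> B" .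
qed

lemma transfer_step:
  assumes H: "finite H" "H \<subseteq> carrier G" and w: "weights H \<phi>" and q: "q \<in> X \<rightarrow>\<^sub>M count_space UNIV"
    and u: "\<And>y. 0 \<le> u y" "\<And>y. u y \<le> B" and k: "k \<in> carrier G"
  shows "\<bar>(\<integral>y. u (transl_act G k y) \<partial>base \<phi> q) - (\<integral>s. fibre H \<phi> q u (act k s) \<partial>X)\<bar> \<le> B * err H \<phi> k"
proof -
  define v where "v h s = u (k \<otimes> h, q (act (inv h) s))" for h s
  have D: "finite (window H k)" "window H k \<subseteq> carrier G" using H k by (auto simp: window_def)
  have vm: "v h \<in> borel_measurable X" if "h \<in> carrier G" for h
  proof -
    have "(\<lambda>s. q (act (inv h) s)) \<in> X \<rightarrow>\<^sub>M count_space UNIV"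
      using that by (intro measurable_compose[OF act_measurable q]) auto
    then show ?thesis unfolding v_def by (rule measurable_compose) simp
  qed
  have vb: "0 \<le> v h s" "v h s \<le> B" for h s using u by (auto simp: v_def)
  have B: "0 \<le> B" using u order_trans by blast
  have pm: "\<phi> h \<in> borel_measurable X" for h using w by (simp add: weights_def)
  have pb: "0 \<le> \<phi> h s" "\<phi> h s \<le> 1" for h s using w weights_le_1[OF w H(1)] by (auto simp: weights_def)
  have pk: "(\<lambda>s. \<phi> (k \<otimes> h) (act k s)) \<in> borel_measurable X" for h
    by (rule measurable_compose[OF act_measurable[OF k] pm])
  have bnd: "norm (c * v h s) \<le> B" if "0 \<le> c" "c \<le> 1" for c h s
    using that vb[of h s] mult_mono[of c 1 "v h s" B] by simp
  have i1: "integrable X (\<lambda>s. \<phi> h s * v h s)" if "h \<in> carrier G" for h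
    using pm[of h] vm[OF that] pb bnd by (intro integrable_const_bound[where B=B] AE_I2 borel_measurable_times) auto
  have i2: "integrable X (\<lambda>s. \<phi> (k \<otimes> h) (act k s) * v h s)" if "h \<in> carrier G" for h
    using pk[of h] vm[OF that] pb bnd by (intro integrable_const_bound[where B=B] AE_I2 borel_measurable_times) auto
  have "(\<integral>y. u (transl_act G k y) \<partial>base \<phi> q) = (\<Sum>h\<in>H. \<integral>s. \<phi> h s * u (transl_act G k (h, q (act (inv h) s))) \<partial>X)"
    by (rule integral_base[OF H w q, where B=B]) (use u in auto)
  also have "\<dots> = (\<Sum>h\<in>H. \<integral>s. \<phi> h s * v h s \<partial>X)"
    using H by (intro sum.cong refl Bochner_Integration.integral_cong) (auto simp: v_def transl_act_def)
  also have "\<dots> = (\<Sum>h\<in>window H k. \<integral>s. \<phi> h s * v h s \<partial>X)"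
    using w D by (intro sum.mono_neutral_left) (auto simp: window_def weights_def)
  finally have I: "(\<integral>y. u (transl_act G k y) \<partial>base \<phi> q) = (\<Sum>h\<in>window H k. \<integral>s. \<phi> h s * v h s \<partial>X)" .
  have "fibre H \<phi> q u (act k s) = (\<Sum>h\<in>window H k. \<phi> (k \<otimes> h) (act k s) * v h s)" if s: "s \<in> space X" for s
  proof -
    have "fibre H \<phi> q u (act k s) = (\<Sum>h\<in>window H k. \<phi> (k \<otimes> h) (act k s) * u (k \<otimes> h, q (act (inv (k \<otimes> h)) (act k s))))"
      unfolding fibre_def by (rule window_reindex[OF H k, symmetric]) (use w in \<open>simp add: weights_def\<close>)
    also have "\<dots> = (\<Sum>h\<in>window H k. \<phi> (k \<otimes> h) (act k s) * v h s)"
    proof (intro sum.cong refl)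
      fix h assume "h \<in> window H k"
      then have h: "h \<in> carrier G" using D by auto
      have "act (inv (k \<otimes> h)) (act k s) = act (inv h) s"
        using h k s act_mult[of "inv h" "inv k" "act k s"] act_space[OF k s] act_inv(1)[OF k s]
        by (simp add: inv_mult_group)
      then show "\<phi> (k \<otimes> h) (act k s) * u (k \<otimes> h, q (act (inv (k \<otimes> h)) (act k s))) = \<phi> (k \<otimes> h) (act k s) * v h s"
        by (simp add: v_def)
    qed
    finally show ?thesis .
  qed
  then have "(\<integral>s. fibre H \<phi> q u (act k s) \<partial>X) = (\<integral>s. (\<Sum>h\<in>window H k. \<phi> (k \<otimes> h) (act k s) * v h s) \<partial>X)"
    by (intro Bochner_Integration.integral_cong) auto
  also have "\<dots> = (\<Sum>h\<in>window H k. \<integral>s. \<phi> (k \<otimes> h) (act k s) * v h s \<partial>X)"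
    using i2 D by (intro Bochner_Integration.integral_sum) auto
  finally have J: "(\<integral>s. fibre H \<phi> q u (act k s) \<partial>X) = (\<Sum>h\<in>window H k. \<integral>s. \<phi> (k \<otimes> h) (act k s) * v h s \<partial>X)" .
  have "\<bar>(\<Sum>h\<in>window H k. \<integral>s. \<phi> h s * v h s \<partial>X) - (\<Sum>h\<in>window H k. \<integral>s. \<phi> (k \<otimes> h) (act k s) * v h s \<partial>X)\<bar>
    \<le> (\<Sum>h\<in>window H k. \<bar>(\<integral>s. \<phi> h s * v h s \<partial>X) - (\<integral>s. \<phi> (k \<otimes> h) (act k s) * v h s \<partial>X)\<bar>)"
    unfolding sum_subtractf[symmetric] by (rule sum_abs)
  also have "\<dots> \<le> (\<Sum>h\<in>window H k. B * (\<integral>s. \<bar>defect \<phi> k h s\<bar> \<partial>X))"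
  proof (rule sum_mono)
    fix h assume "h \<in> window H k"
    then have h: "h \<in> carrier G" using D by auto
    have "(\<integral>s. \<phi> h s * v h s \<partial>X) - (\<integral>s. \<phi> (k \<otimes> h) (act k s) * v h s \<partial>X) = (\<integral>s. \<phi> h s * v h s - \<phi> (k \<otimes> h) (act k s) * v h s \<partial>X)"
      using i1[OF h] i2[OF h] by simp
    also have "\<bar>\<dots>\<bar> \<le> (\<integral>s. \<bar>\<phi> h s * v h s - \<phi> (k \<otimes> h) (act k s) * v h s\<bar> \<partial>X)"
      by (rule integral_abs_bound)
    also have "\<dots> \<le> (\<integral>s. B * \<bar>defect \<phi> k h s\<bar> \<partial>X)"
    proof (rule integral_mono)
      show "integrable X (\<lambda>s. \<bar>\<phi> h s * v h s - \<phi> (k \<otimes> h) (act k s) * v h s\<bar>)"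
        using i1[OF h] i2[OF h] by simp
      have "integrable X (defect \<phi> k h)"
        using defect_measurable[OF w k] defect_bound[OF w H(1)] by (intro integrable_const_bound[where B=1]) auto
      then show "integrable X (\<lambda>s. B * \<bar>defect \<phi> k h s\<bar>)" by simp
      fix s
      have "\<bar>\<phi> h s * v h s - \<phi> (k \<otimes> h) (act k s) * v h s\<bar> = v h s * \<bar>defect \<phi> k h s\<bar>"
        using vb[of h s] by (simp add: defect_def left_diff_distrib[symmetric] abs_mult abs_minus_commute)
      also have "\<dots> \<le> B * \<bar>defect \<phi> k h s\<bar>" using vb by (intro mult_right_mono) auto
      finally show "\<bar>\<phi> h s * v h s - \<phi> (k \<otimes> h) (act k s) * v h s\<bar> \<le> B * \<bar>defect \<phi> k h s\<bar>" .
    qed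
    finally show "\<bar>(\<integral>s. \<phi> h s * v h s \<partial>X) - (\<integral>s. \<phi> (k \<otimes> h) (act k s) * v h s \<partial>X)\<bar> \<le> B * (\<integral>s. \<bar>defect \<phi> k h s\<bar> \<partial>X)"
      by simp
  qed
  also have "\<dots> = B * err H \<phi> k" using k by (simp add: err_def sum_distrib_left)
  finally show ?thesis unfolding I J .
qed

text \<open>Up to the total defect of \<open>\<phi>\<close>, integrating against the averaged measure on \<open>G \<times> \<nat>\<close>, or
  against one of its translates, amounts to integrating over the fibres and then against \<open>\<nu>\<close>, or
  against its translate.\<close>

lemma transfer:
  assumes H: "finite H" "H \<subseteq> carrier G" and w: "weights H \<phi>" and q: "q \<in> X \<rightarrow>\<^sub>M count_space UNIV"
    and u: "\<And>y. 0 \<le> u y" "\<And>y. u y \<le> B" and g: "g \<in> carrier G"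
  shows "\<bar>(\<integral>y. u (transl_act G g y) \<partial>average (base \<phi> q) (transl_act G)) - (\<integral>s. fibre H \<phi> q u (act g s) \<partial>\<nu>)\<bar>
    \<le> B * M g * (\<integral>k. err H \<phi> k \<partial>m)"
proof -
  interpret Y: weighted_action G m M "base \<phi> q" "transl_act G" by (rule base_weighted_action[OF H w q])
  interpret Yp: prob_space "base \<phi> q" by (rule Y.prob)
  have B: "0 \<le> B" using u order_trans by blast
  define I where "I k = (if k \<in> carrier G then \<integral>y. u (transl_act G k y) \<partial>base \<phi> q else 0)" for k
  define J where "J k = (if k \<in> carrier G then \<integral>s. fibre H \<phi> q u (act k s) \<partial>X else 0)" for k
  note fm = fibre_measurable[OF H w q, of u] and fb = fibre_bounds[OF w u, of q]
  have "(\<integral>y. u (transl_act G g y) \<partial>average (base \<phi> q) (transl_act G)) =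
     (\<integral>k. (\<integral>y. u (transl_act G g (transl_act G k y)) \<partial>base \<phi> q) \<partial>m)"
    by (rule Y.integral_average[where B=B]) (use u in \<open>auto simp: measurable_base\<close>)
  also have "\<dots> = (\<integral>k. I (g \<otimes> k) \<partial>m)"
  proof (intro integral_cong_AE AE_pmfI)
    fix k assume "k \<in> set_pmf m"
    then have k: "k \<in> carrier G" by (simp add: set_m)
    show "(\<integral>y. u (transl_act G g (transl_act G k y)) \<partial>base \<phi> q) = I (g \<otimes> k)"
      using g k Y.act_mult[OF g k] by (auto simp: I_def intro!: Bochner_Integration.integral_cong)
  qed auto
  finally have 1: "(\<integral>y. u (transl_act G g y) \<partial>average (base \<phi> q) (transl_act G)) = (\<integral>k. I (g \<otimes> k) \<partial>m)" .
  have "(\<integral>s. fibre H \<phi> q u (act g s) \<partial>\<nu>) = (\<integral>k. (\<integral>s. fibre H \<phi> q u (act g (act k s)) \<partial>X) \<partial>m)"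
    by (rule WX.integral_average[where B=B]) (use fb in \<open>auto intro!: measurable_compose[OF act_measurable[OF g] fm]\<close>)
  also have "\<dots> = (\<integral>k. J (g \<otimes> k) \<partial>m)"
  proof (intro integral_cong_AE AE_pmfI)
    fix k assume "k \<in> set_pmf m"
    then have k: "k \<in> carrier G" by (simp add: set_m)
    show "(\<integral>s. fibre H \<phi> q u (act g (act k s)) \<partial>X) = J (g \<otimes> k)"
      using g k act_mult[OF g k] by (auto simp: J_def intro!: Bochner_Integration.integral_cong)
  qed auto
  finally have 2: "(\<integral>s. fibre H \<phi> q u (act g s) \<partial>\<nu>) = (\<integral>k. J (g \<otimes> k) \<partial>m)" .
  have IB: "\<bar>I k\<bar> \<le> B" for k
  proof (cases "k \<in> carrier G")
    case True
    have "integrable (base \<phi> q) (\<lambda>y. u (transl_act G k y))"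
      by (rule Yp.integrable_const_bound[where B=B]) (use u in \<open>auto simp: measurable_base\<close>)
    then have "(\<integral>y. u (transl_act G k y) \<partial>base \<phi> q) \<le> B"
      by (rule Yp.integral_le_const) (use u in auto)
    moreover have "0 \<le> (\<integral>y. u (transl_act G k y) \<partial>base \<phi> q)" using u by simp
    ultimately show ?thesis using True by (simp add: I_def)
  qed (use B in \<open>simp add: I_def\<close>)
  have JB: "\<bar>J k\<bar> \<le> B" for k
  proof (cases "k \<in> carrier G")
    case True
    have "integrable X (\<lambda>s. fibre H \<phi> q u (act k s))"
      by (rule integrable_const_bound[where B=B])
         (use fb in \<open>auto intro!: measurable_compose[OF act_measurable[OF True] fm]\<close>)
    then have "(\<integral>s. fibre H \<phi> q u (act k s) \<partial>X) \<le> B"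
      by (rule integral_le_const) (use fb in auto)
    moreover have "0 \<le> (\<integral>s. fibre H \<phi> q u (act k s) \<partial>X)" using fb by simp
    ultimately show ?thesis using True by (simp add: J_def)
  qed (use B in \<open>simp add: J_def\<close>)
  have ii: "integrable m (\<lambda>k. I (g \<otimes> k))" "integrable m (\<lambda>k. J (g \<otimes> k))"
    using IB JB by (auto intro!: measure_pmf.integrable_const_bound[where B=B])
  note eb = err_bounds[OF H w]
  have "(\<integral>k. I (g \<otimes> k) \<partial>m) - (\<integral>k. J (g \<otimes> k) \<partial>m) = (\<integral>k. I (g \<otimes> k) - J (g \<otimes> k) \<partial>m)"
    using ii by simp
  also have "\<bar>\<dots>\<bar> \<le> (\<integral>k. B * err H \<phi> (g \<otimes> k) \<partial>m)"
  proof (rule abs_integral_le)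
    show "integrable m (\<lambda>k. B * err H \<phi> (g \<otimes> k))"
      using eb by (intro integrable_mult_right measure_pmf.integrable_const_bound[where B=2]) auto
    fix k
    show "\<bar>I (g \<otimes> k) - J (g \<otimes> k)\<bar> \<le> B * err H \<phi> (g \<otimes> k)"
      using transfer_step[OF H w q u, of "g \<otimes> k"] by (auto simp: I_def J_def err_def)
  qed (use ii in simp)
  also have "\<dots> = B * (\<integral>k. err H \<phi> (g \<otimes> k) \<partial>m)" by simp
  also have "\<dots> \<le> B * (M g * (\<integral>k. err H \<phi> k \<partial>m))"
    using B eb by (intro mult_left_mono integral_shift[OF g, of _ 2]) auto
  finally show ?thesis unfolding 1 2 by (simp add: mult.assoc)
qed

text \<open>A BQI measure on \<open>G \<times> \<nat>\<close> with functions \<open>r g\<close> that are, for \<open>g \<in> F\<close>, up to multiples of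
  \<open>\<delta>\<close> the derivatives of its translates and that have almost the same joint law as \<open>\<eta>\<close>.\<close>

definition approximant ::
  "'a set \<Rightarrow> real \<Rightarrow> ('a \<times> nat) measure \<Rightarrow> ('a \<Rightarrow> 'a \<times> nat \<Rightarrow> real) \<Rightarrow> bool" where
  "approximant F \<delta> L r \<longleftrightarrow>
    sets L = Pow (carrier G \<times> UNIV) \<and> qi_space G L (transl_act G) \<and> bqi_bound G M L (transl_act G) \<and>
    (\<forall>g\<in>carrier G. \<forall>y. 0 \<le> r g y \<and> r g y \<le> M g) \<and>
    (\<forall>g\<in>F. \<forall>A\<subseteq>carrier G \<times> UNIV.
       \<bar>measure L (transl_act G g -` A \<inter> space L) - (\<integral>y. indicator A y * r g y \<partial>L)\<bar>
         \<le> (M g + M g * M \<one> + 1) * \<delta>) \<and>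
    (\<forall>(J :: nat set) k a e. finite J \<longrightarrow> e ` J \<subseteq> F \<longrightarrow>
       \<bar>(\<integral>y. (\<Prod>j\<in>J. ramp k (a j) (r (e j) y)) \<partial>L) - (\<integral>s. (\<Prod>j\<in>J. ramp k (a j) (\<eta> (e j) s)) \<partial>\<nu>)\<bar>
        \<le> (M \<one> + real (card J) * real k) * \<delta>)"

lemma ex_approximant:
  assumes F: "finite F" "F \<subseteq> carrier G" and d: "0 < \<delta>"
  shows "\<exists>L r. approximant F \<delta> L r"
proof -
  obtain H \<phi> where H: "finite H" "H \<subseteq> carrier G" and w: "weights H \<phi>" and small: "(\<integral>k. err H \<phi> k \<partial>m) < \<delta>"
    using ex_small_error[OF d] by blast
  note eb = err_bounds[OF H w]
  have err0: "0 \<le> (\<integral>k. err H \<phi> k \<partial>m)" using eb by simp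
  have "\<exists>q\<in>X \<rightarrow>\<^sub>M (count_space UNIV :: nat measure). \<exists>d. \<forall>i\<in>F \<times> H. \<forall>s. \<bar>d i (q s) - (if s \<in> space X then \<eta> (fst i) (act (snd i) s) else 0)\<bar> \<le> \<delta>"
  proof (rule finite_discretization)
    show "finite (F \<times> H)" using F H by simp
    fix i assume i: "i \<in> F \<times> H"
    then have gi: "fst i \<in> carrier G" "snd i \<in> carrier G" using F H by auto
    show "(\<lambda>s. if s \<in> space X then \<eta> (fst i) (act (snd i) s) else 0) \<in> borel_measurable X"
      by (rule measurable_cong[THEN iffD2, OF _ measurable_compose[OF act_measurable[OF gi(2)] eta_meas[OF gi(1)]]]) simp
    show "0 \<le> (if s \<in> space X then \<eta> (fst i) (act (snd i) s) else 0)" for s using eta_bd[OF gi(1)] by simp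
  qed (rule d)
  then obtain q :: "'x \<Rightarrow> nat" and D where q: "q \<in> X \<rightarrow>\<^sub>M count_space UNIV"
    and D0: "\<forall>i\<in>F \<times> H. \<forall>s. \<bar>D i (q s) - (if s \<in> space X then \<eta> (fst i) (act (snd i) s) else 0)\<bar> \<le> \<delta>"
    by (elim bexE exE)
  have D: "\<bar>D (g, h) (q s) - \<eta> g (act h s)\<bar> \<le> \<delta>" if "g \<in> F" "h \<in> H" "s \<in> space X" for g h s
    using D0[THEN bspec, THEN spec, of "(g, h)" s] that by simp
  interpret Y: weighted_action G m M "base \<phi> q" "transl_act G" by (rule base_weighted_action[OF H w q])
  define L where "L = average (base \<phi> q) (transl_act G)"
  interpret N: prob_space \<nu> by (rule prob_nu)
  interpret L: prob_space L unfolding L_def by (rule Y.prob_average)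
  have sL: "sets L = Pow (carrier G \<times> UNIV)" "space L = carrier G \<times> UNIV" by (simp_all add: L_def)
  have mL: "f \<in> borel_measurable L" for f :: "'a \<times> nat \<Rightarrow> real"
    by (rule measurableI) (auto simp: sL)
  have mnu: "borel_measurable \<nu> = (borel_measurable X :: ('x \<Rightarrow> real) set)"
    by (rule measurable_cong_sets) simp_all
  \<comment> \<open>\<open>D\<close> decodes the cocycle only along the support of \<open>\<phi>\<close>; truncation bounds \<open>r\<close> everywhere\<close>
  define r where "r g y = max 0 (min (M g) (D (g, fst y) (snd y)))" for g y
  have r: "0 \<le> r g y" "r g y \<le> M g" if "g \<in> carrier G" for g y
    using M1[OF that] by (auto simp: r_def)
  have rD: "\<bar>r g (h, q (act (inv h) s)) - \<eta> g s\<bar> \<le> \<delta>" if "g \<in> F" "h \<in> H" "s \<in> space X" for g h s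
  proof -
    have hG: "h \<in> carrier G" "inv h \<in> carrier G" and gG: "g \<in> carrier G" using that F H by auto
    have "\<bar>D (g, h) (q (act (inv h) s)) - \<eta> g s\<bar> \<le> \<delta>"
      using D[OF that(1,2) act_space[OF hG(2) that(3)]] act_inv(2)[OF hG(1) that(3)] by simp
    then show ?thesis using eta_bd[OF gG, of s] by (auto simp: r_def max_def min_def abs_if split: if_splits)
  qed
  have t1: "\<bar>(\<integral>y. u y \<partial>L) - (\<integral>s. fibre H \<phi> q u s \<partial>\<nu>)\<bar> \<le> B * M \<one> * \<delta>"
    if u: "\<And>y. 0 \<le> u y" "\<And>y. u y \<le> B" for u B
  proof -
    have "(\<integral>y. u (transl_act G \<one> y) \<partial>L) = (\<integral>y. u y \<partial>L)"
      using Y.act_one by (intro Bochner_Integration.integral_cong) (auto simp: sL)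
    moreover have "(\<integral>s. fibre H \<phi> q u (act \<one> s) \<partial>\<nu>) = (\<integral>s. fibre H \<phi> q u s \<partial>\<nu>)"
      using act_one by (intro Bochner_Integration.integral_cong) auto
    moreover have "0 \<le> B" using u order_trans by blast
    then have "B * M \<one> * (\<integral>k. err H \<phi> k \<partial>m) \<le> B * M \<one> * \<delta>"
      using M1[OF one_closed] small by (intro mult_left_mono) auto
    ultimately show ?thesis
      using transfer[where u=u, OF H w q u one_closed] unfolding L_def by simp
  qed
  have cl: "\<bar>(\<integral>s. fibre H \<phi> q u s \<partial>\<nu>) - (\<integral>s. v s \<partial>\<nu>)\<bar> \<le> C * \<delta>"
    if u: "\<And>y. 0 \<le> u y" "\<And>y. u y \<le> B" and v: "v \<in> borel_measurable X" "\<And>s. 0 \<le> v s" "\<And>s. v s \<le> B'"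
      and uv: "\<And>s. s \<in> space X \<Longrightarrow> \<bar>fibre H \<phi> q u s - v s\<bar> \<le> C * \<delta>"
    for u B v B' C
  proof -
    have i: "integrable \<nu> (fibre H \<phi> q u)" "integrable \<nu> v"
    proof -
      note fb = fibre_bounds[where u=u and q=q, OF w u]
      show "integrable \<nu> (fibre H \<phi> q u)"
        using fb fibre_measurable[OF H w q, of u]
        by (intro N.integrable_const_bound[where B=B]) (simp_all add: mnu)
      show "integrable \<nu> v"
        using v by (intro N.integrable_const_bound[where B=B']) (simp_all add: mnu)
    qed
    have "(\<integral>s. fibre H \<phi> q u s \<partial>\<nu>) - (\<integral>s. v s \<partial>\<nu>) = (\<integral>s. fibre H \<phi> q u s - v s \<partial>\<nu>)" using i by simp
    also have "\<bar>\<dots>\<bar> \<le> (\<integral>s. C * \<delta> \<partial>\<nu>)"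
      using i uv by (intro abs_integral_le) auto
    also have "\<dots> = C * \<delta>" using N.prob_space by simp
    finally show ?thesis .
  qed
  have fdiff: "\<bar>fibre H \<phi> q u s - c\<bar> \<le> C"
    if "\<And>h. h \<in> H \<Longrightarrow> \<bar>u (h, q (act (inv h) s)) - c\<bar> \<le> C" for u c C s
  proof -
    have "fibre H \<phi> q u s - c = (\<Sum>h\<in>H. \<phi> h s * (u (h, q (act (inv h) s)) - c))"
      using w by (simp add: fibre_def right_diff_distrib sum_subtractf sum_distrib_right[symmetric] weights_def)
    also have "\<bar>\<dots>\<bar> \<le> (\<Sum>h\<in>H. \<phi> h s * C)"
    proof (rule order_trans[OF sum_abs sum_mono])
      fix h assume "h \<in> H"
      then show "\<bar>\<phi> h s * (u (h, q (act (inv h) s)) - c)\<bar> \<le> \<phi> h s * C"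
        using w that unfolding abs_mult by (simp add: weights_def mult_left_mono)
    qed
    also have "\<dots> = C" using w by (simp add: sum_distrib_right[symmetric] weights_def)
    finally show ?thesis .
  qed
  have part1: "\<bar>measure L (transl_act G g -` A \<inter> space L) - (\<integral>y. indicator A y * r g y \<partial>L)\<bar> \<le> (M g + M g * M \<one> + 1) * \<delta>"
    if g: "g \<in> F" and A: "A \<subseteq> carrier G \<times> UNIV" for g A
  proof -
    have gG: "g \<in> carrier G" using g F by auto
    let ?u = "indicator A :: 'a \<times> nat \<Rightarrow> real" and ?ur = "\<lambda>y. indicator A y * r g y"
    have ub: "0 \<le> ?u y" "?u y \<le> 1" for y by (auto simp: indicator_def)
    have urb: "0 \<le> ?ur y" "?ur y \<le> M g" for y using r[OF gG] M1[OF gG] by (auto simp: indicator_def)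
    have "measure L (transl_act G g -` A \<inter> space L) = (\<integral>y. indicator (transl_act G g -` A \<inter> space L) y \<partial>L)"
      by (simp add: sL)
    also have "\<dots> = (\<integral>y. ?u (transl_act G g y) \<partial>L)"
      by (intro Bochner_Integration.integral_cong) (auto simp: indicator_def)
    finally have e1: "measure L (transl_act G g -` A \<inter> space L) = (\<integral>y. ?u (transl_act G g y) \<partial>L)" .
    have "1 * M g * (\<integral>k. err H \<phi> k \<partial>m) \<le> M g * \<delta>"
      using M1[OF gG] small by simp
    then have s1: "\<bar>(\<integral>y. ?u (transl_act G g y) \<partial>L) - (\<integral>s. fibre H \<phi> q ?u (act g s) \<partial>\<nu>)\<bar> \<le> M g * \<delta>"
      using transfer[where u="?u", OF H w q ub gG] unfolding L_def by linarith
    have s2: "(\<integral>s. fibre H \<phi> q ?u (act g s) \<partial>\<nu>) = (\<integral>s. \<eta> g s * fibre H \<phi> q ?u s \<partial>\<nu>)"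
      by (rule integral_eta[OF gG fibre_measurable[OF H w q], symmetric])
    have s3: "\<bar>(\<integral>y. ?ur y \<partial>L) - (\<integral>s. fibre H \<phi> q ?ur s \<partial>\<nu>)\<bar> \<le> M g * M \<one> * \<delta>"
      by (rule t1[of "?ur" "M g", OF urb])
    have s4: "\<bar>(\<integral>s. fibre H \<phi> q ?ur s \<partial>\<nu>) - (\<integral>s. \<eta> g s * fibre H \<phi> q ?u s \<partial>\<nu>)\<bar> \<le> 1 * \<delta>"
    proof (rule cl[of "?ur" "M g" _ "M g * 1", OF urb])
      show "(\<lambda>s. \<eta> g s * fibre H \<phi> q ?u s) \<in> borel_measurable X"
        by (intro borel_measurable_times eta_meas[OF gG] fibre_measurable[OF H w q])
      fix s
      show "0 \<le> \<eta> g s * fibre H \<phi> q ?u s"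
        using eta_bd[OF gG, of s] fibre_bounds(1)[where u="?u" and q=q and s=s, OF w ub] by simp
      show "\<eta> g s * fibre H \<phi> q ?u s \<le> M g * 1"
        using eta_bd[OF gG, of s] fibre_bounds[where u="?u" and q=q and s=s, OF w ub] by (intro mult_mono) auto
      assume s: "s \<in> space X"
      have "fibre H \<phi> q ?ur s - \<eta> g s * fibre H \<phi> q ?u s =
        (\<Sum>h\<in>H. \<phi> h s * (?u (h, q (act (inv h) s)) * (r g (h, q (act (inv h) s)) - \<eta> g s)))"
        by (simp add: fibre_def sum_distrib_left sum_subtractf[symmetric] algebra_simps)
      also have "\<bar>\<dots>\<bar> \<le> (\<Sum>h\<in>H. \<phi> h s * \<delta>)"
      proof (rule order_trans[OF sum_abs sum_mono])
        fix h assume h: "h \<in> H"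
        have "\<bar>?u (h, q (act (inv h) s)) * (r g (h, q (act (inv h) s)) - \<eta> g s)\<bar> \<le> \<delta>"
          using rD[OF g h s] d by (auto simp: indicator_def)
        then show "\<bar>\<phi> h s * (?u (h, q (act (inv h) s)) * (r g (h, q (act (inv h) s)) - \<eta> g s))\<bar> \<le> \<phi> h s * \<delta>"
          using w unfolding abs_mult[of "\<phi> h s"] by (simp add: weights_def mult_left_mono)
      qed
      also have "\<dots> = \<delta>" using w by (simp add: sum_distrib_right[symmetric] weights_def)
      finally show "\<bar>fibre H \<phi> q ?ur s - \<eta> g s * fibre H \<phi> q ?u s\<bar> \<le> 1 * \<delta>" by simp
    qed
    have "\<bar>measure L (transl_act G g -` A \<inter> space L) - (\<integral>y. ?ur y \<partial>L)\<bar> \<le> M g * \<delta> + M g * M \<one> * \<delta> + \<delta>"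
      using s1 s3 s4 unfolding e1 s2 by linarith
    then show ?thesis by (simp add: distrib_right)
  qed
  have part2: "\<bar>(\<integral>y. (\<Prod>j\<in>J. ramp k (a j) (r (e j) y)) \<partial>L) - (\<integral>s. (\<Prod>j\<in>J. ramp k (a j) (\<eta> (e j) s)) \<partial>\<nu>)\<bar>
        \<le> (M \<one> + real (card J) * real k) * \<delta>" if J: "finite J" "e ` J \<subseteq> F" for J :: "nat set" and k a e
  proof -
    let ?u = "\<lambda>y. \<Prod>j\<in>J. ramp k (a j) (r (e j) y)" and ?v = "\<lambda>s. \<Prod>j\<in>J. ramp k (a j) (\<eta> (e j) s)"
    have eG: "e j \<in> carrier G" "e j \<in> F" if "j \<in> J" for j using J F that by auto
    have "\<bar>(\<integral>y. ?u y \<partial>L) - (\<integral>s. fibre H \<phi> q ?u s \<partial>\<nu>)\<bar> \<le> 1 * M \<one> * \<delta>"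
      by (rule t1) (rule prod_ramp_bounds)+
    moreover have "\<bar>(\<integral>s. fibre H \<phi> q ?u s \<partial>\<nu>) - (\<integral>s. ?v s \<partial>\<nu>)\<bar> \<le> (real (card J) * real k) * \<delta>"
    proof (rule cl)
      show "?v \<in> borel_measurable X"
        using eta_meas eG by (intro borel_measurable_prod measurable_compose[OF _ ramp_measurable]) auto
      fix s assume s: "s \<in> space X"
      show "\<bar>fibre H \<phi> q ?u s - ?v s\<bar> \<le> real (card J) * real k * \<delta>"
      proof (rule fdiff)
        fix h assume h: "h \<in> H"
        have "norm (?u (h, q (act (inv h) s)) - ?v s) \<le> (\<Sum>j\<in>J. norm (ramp k (a j) (r (e j) (h, q (act (inv h) s))) - ramp k (a j) (\<eta> (e j) s)))"
          by (rule norm_prod_diff) (auto simp: ramp_bounds)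
        also have "\<dots> \<le> (\<Sum>j\<in>J. real k * \<delta>)"
        proof (rule sum_mono)
          fix j assume j: "j \<in> J"
          have "real k * \<bar>r (e j) (h, q (act (inv h) s)) - \<eta> (e j) s\<bar> \<le> real k * \<delta>"
            using rD[OF eG(2)[OF j] h s] by (intro mult_left_mono) auto
          then show "norm (ramp k (a j) (r (e j) (h, q (act (inv h) s))) - ramp k (a j) (\<eta> (e j) s)) \<le> real k * \<delta>"
            using ramp_lipschitz[of k "a j" "r (e j) (h, q (act (inv h) s))" "\<eta> (e j) s"] by simp
        qed
        finally show "\<bar>?u (h, q (act (inv h) s)) - ?v s\<bar> \<le> real (card J) * real k * \<delta>" by simp
      qed
    qed (rule prod_ramp_bounds)+
    ultimately show ?thesis by (simp add: distrib_right)
  qed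
  show ?thesis
    unfolding approximant_def
    using sL(1) Y.average_bqi[folded L_def] r part1 part2 by (intro exI[of _ L] exI[of _ r]) auto
qed

lemma approximating_sequence:
  "\<exists>L r. (\<forall>n::nat. sets (L n) = Pow (carrier G \<times> UNIV) \<and> qi_space G (L n) (transl_act G) \<and>
      bqi_bound G M (L n) (transl_act G)) \<and>
    (\<forall>g\<in>carrier G. \<forall>n y. 0 \<le> r g n y \<and> r g n y \<le> M g) \<and>
    (\<forall>g\<in>carrier G. \<forall>A. (\<forall>n. A n \<subseteq> carrier G \<times> UNIV) \<longrightarrow>
      (\<lambda>n. measure (L n) (transl_act G g -` A n \<inter> space (L n)) - (\<integral>y. indicator (A n) y * r g n y \<partial>L n)) \<longlonglongrightarrow> 0) \<and>
    (\<forall>(J :: nat set) k a e. finite J \<longrightarrow> (\<forall>j. e j \<in> carrier G) \<longrightarrow>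
      (\<lambda>n. \<integral>y. (\<Prod>j\<in>J. ramp k (a j) (r (e j) n y)) \<partial>L n) \<longlonglongrightarrow> (\<integral>s. (\<Prod>j\<in>J. ramp k (a j) (\<eta> (e j) s)) \<partial>\<nu>))"
proof -
  define en where "en = from_nat_into (carrier G)"
  have ren: "range en = carrier G" unfolding en_def by (rule range_from_nat_into[OF _ count]) auto
  define F where "F n = en ` {..n}" for n :: nat
  have F: "finite (F n)" "F n \<subseteq> carrier G" for n using ren by (auto simp: F_def)
  have evF: "eventually (\<lambda>n. g \<in> F n) sequentially" if "g \<in> carrier G" for g
  proof -
    have "g \<in> range en" using that ren by simp
    then obtain i where "g = en i" by (rule rangeE)
    then have "\<forall>n\<ge>i. g \<in> F n" by (auto simp: F_def)
    then show ?thesis by (auto simp: eventually_sequentially)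
  qed
  define \<delta> where "\<delta> n = 1 / real (Suc n)" for n
  have d0: "0 < \<delta> n" for n by (simp add: \<delta>_def)
  have dlim: "(\<lambda>n. c * \<delta> n) \<longlonglongrightarrow> 0" for c
    unfolding \<delta>_def using tendsto_mult_right_zero[OF LIMSEQ_inverse_real_of_nat, of c] by (simp add: inverse_eq_divide)
  have "\<forall>n. \<exists>Lr. approximant (F n) (\<delta> n) (fst Lr) (snd Lr)"
    unfolding split_paired_Ex fst_conv snd_conv using ex_approximant[OF F d0] by blast
  from choice[OF this] obtain Lr where Lr: "\<forall>n. approximant (F n) (\<delta> n) (fst (Lr n)) (snd (Lr n))" by (rule exE)
  define L where "L n = fst (Lr n)" for n
  define r where "r g n = snd (Lr n) g" for g n
  have P: "sets (L n) = Pow (carrier G \<times> UNIV)" "qi_space G (L n) (transl_act G)" "bqi_bound G M (L n) (transl_act G)"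
    "\<forall>g\<in>carrier G. \<forall>y. 0 \<le> r g n y \<and> r g n y \<le> M g"
    "\<forall>g\<in>F n. \<forall>A\<subseteq>carrier G \<times> UNIV.
       \<bar>measure (L n) (transl_act G g -` A \<inter> space (L n)) - (\<integral>y. indicator A y * r g n y \<partial>L n)\<bar> \<le> (M g + M g * M \<one> + 1) * \<delta> n"
    "\<forall>(J :: nat set) k a e. finite J \<longrightarrow> e ` J \<subseteq> F n \<longrightarrow>
       \<bar>(\<integral>y. (\<Prod>j\<in>J. ramp k (a j) (r (e j) n y)) \<partial>L n) - (\<integral>s. (\<Prod>j\<in>J. ramp k (a j) (\<eta> (e j) s)) \<partial>\<nu>)\<bar>
        \<le> (M \<one> + real (card J) * real k) * \<delta> n" for n
    using spec[OF Lr, of n] unfolding approximant_def L_def r_def by simp_all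
  have 1: "(\<lambda>n. measure (L n) (transl_act G g -` A n \<inter> space (L n)) - (\<integral>y. indicator (A n) y * r g n y \<partial>L n)) \<longlonglongrightarrow> 0"
    if g: "g \<in> carrier G" and A: "\<And>n. A n \<subseteq> carrier G \<times> UNIV" for g A
  proof (rule Lim_null_comparison[OF _ dlim])
    show "eventually (\<lambda>n. norm (measure (L n) (transl_act G g -` A n \<inter> space (L n)) - (\<integral>y. indicator (A n) y * r g n y \<partial>L n))
      \<le> (M g + M g * M \<one> + 1) * \<delta> n) sequentially"
      using evF[OF g]
    proof eventually_elim
      case (elim n)
      show ?case unfolding real_norm_def by (rule P(5)[THEN bspec, THEN spec, THEN mp, OF elim A])
    qed
  qed
  have 2: "(\<lambda>n. \<integral>y. (\<Prod>j\<in>J. ramp k (a j) (r (e j) n y)) \<partial>L n) \<longlonglongrightarrow> (\<integral>s. (\<Prod>j\<in>J. ramp k (a j) (\<eta> (e j) s)) \<partial>\<nu>)"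
    if J: "finite J" and e: "\<forall>j. e j \<in> carrier G" for J :: "nat set" and k a e
  proof (rule LIM_zero_cancel, rule Lim_null_comparison[OF _ dlim])
    have "eventually (\<lambda>n. \<forall>j\<in>J. e j \<in> F n) sequentially"
      using J evF e by (intro eventually_ball_finite) auto
    then show "eventually (\<lambda>n. norm ((\<integral>y. (\<Prod>j\<in>J. ramp k (a j) (r (e j) n y)) \<partial>L n) - (\<integral>s. (\<Prod>j\<in>J. ramp k (a j) (\<eta> (e j) s)) \<partial>\<nu>))
      \<le> (M \<one> + real (card J) * real k) * \<delta> n) sequentially"
    proof eventually_elim
      case (elim n)
      then have "e ` J \<subseteq> F n" by auto
      then show ?case unfolding real_norm_def by (rule P(6)[THEN spec, THEN spec, THEN spec, THEN spec, THEN mp, THEN mp, OF J])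
    qed
  qed
  show ?thesis
  proof (rule exI[of _ L], rule exI[of _ r], intro conjI)
    show "\<forall>n. sets (L n) = Pow (carrier G \<times> UNIV) \<and> qi_space G (L n) (transl_act G) \<and> bqi_bound G M (L n) (transl_act G)"
      using P(1-3) by simp
    show "\<forall>g\<in>carrier G. \<forall>n y. 0 \<le> r g n y \<and> r g n y \<le> M g" using P(4) by simp
  qed (use 1 2 in simp_all)
qed

end

section \<open>Radon--Nikodym factors of amenable spaces\<close>

theorem theorem5:
  fixes G :: "('g, 'm) monoid_scheme"
    and S :: "'s measure"
    and act :: "'g \<Rightarrow> 's \<Rightarrow> 's"
  assumes "group G"
    and "countable (carrier G)"
    and "qi_space G S act"
    and "ergodic_space G S act"
    and "Zimmer_amenable G S act"
  shows "\<exists>(\<nu> :: 's measure) (\<mu> :: nat \<Rightarrow> ('g \<times> nat) measure).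
    sets \<nu> = sets S \<and> null_sets \<nu> = null_sets S \<and> BQI G \<nu> act \<and>
    (\<forall>n. sets (\<mu> n) = sets (count_space (carrier G \<times> UNIV))) \<and>
    uniformly_BQI G \<mu> (\<lambda>n. transl_act G) \<and>
    (\<forall>\<U> :: nat filter. nonprincipal_ultrafilter \<U> \<longrightarrow>
      (\<exists>(Z :: (nat \<Rightarrow> real) measure) actZ p (W :: (nat \<Rightarrow> real) measure) actW q.
        RN_factor G \<nu> act Z actZ p \<and>
        RN_factor G (ultralimit \<U> \<mu>) (ultra_act \<U> \<mu> (\<lambda>n. transl_act G)) W actW q \<and>
        qi_isomorphic G Z actZ W actW))"
proof -
  interpret group G by fact
  obtain E where E: "equivariant_cond_exp G (count_space (carrier G) \<Otimes>\<^sub>M S) (diag_act G S act) S act snd E"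
    using assms(5) by (auto simp: Zimmer_amenable_def)
  obtain m M where "set_pmf m = carrier G \<and>
    (\<forall>g\<in>carrier G. 1 \<le> M g \<and> (\<forall>h\<in>carrier G. pmf m (inv\<^bsub>G\<^esub> g \<otimes>\<^bsub>G\<^esub> h) \<le> M g * pmf m h))"
    using ex_weight[OF assms(2)] by blast
  then interpret group_weight G m M by unfold_locales auto
  interpret S: measurable_action G S act by (rule qi_space_measurable_action[OF assms(1,3)])
  interpret WS: weighted_action G m M S act by unfold_locales
  \<comment> \<open>\<open>X\<close> has bounded derivatives, as needed for the Reiter condition; \<open>\<nu>\<close> is its average\<close>
  define X where "X = average S act"
  have X: "sets X = sets S" "null_sets X = null_sets S" "qi_space G X act" "bqi_bound G M X act"
    using WS.null_sets_average[OF assms(3)] WS.average_bqi by (simp_all add: X_def)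
  interpret X: measurable_action G X act unfolding X_def by (rule WS.average_action)
  interpret WX: weighted_action G m M X act by unfold_locales
  define \<nu> where "\<nu> = average X act"
  have nu: "sets \<nu> = sets S" "null_sets \<nu> = null_sets S" "qi_space G \<nu> act" "bqi_bound G M \<nu> act"
    using WX.null_sets_average[OF X(3)] WX.average_bqi X by (simp_all add: \<nu>_def)
  interpret N: measurable_action G \<nu> act unfolding \<nu>_def by (rule WX.average_action)
  have "\<forall>g. \<exists>\<rho>. g \<in> carrier G \<longrightarrow> \<rho> \<in> borel_measurable Y \<and> (\<forall>s. 0 \<le> \<rho> s \<and> \<rho> s \<le> M g) \<and>
      density Y (\<lambda>s. ennreal (\<rho> s)) = distr Y Y (act g)"
    if Y: "measurable_action G Y act" and b: "bqi_bound G M Y act" for Y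
  proof
    fix g
    show "\<exists>\<rho>. g \<in> carrier G \<longrightarrow> \<rho> \<in> borel_measurable Y \<and> (\<forall>s. 0 \<le> \<rho> s \<and> \<rho> s \<le> M g) \<and>
      density Y (\<lambda>s. ennreal (\<rho> s)) = distr Y Y (act g)"
    proof (cases "g \<in> carrier G")
      case True
      have "\<exists>\<rho>\<in>borel_measurable Y. (\<forall>s. 0 \<le> \<rho> s \<and> \<rho> s \<le> M g) \<and>
          density Y (\<lambda>s. ennreal (\<rho> s)) = distr Y Y (act g)"
        by (rule prob_space.bounded_density[OF measurable_action.prob[OF Y]])
          (use b True M1[OF True] in \<open>auto simp: bqi_bound_def\<close>)
      then show ?thesis by blast
    qed simp
  qed
  note ex = choice[OF this]
  obtain \<rho> where rho: "\<forall>g. g \<in> carrier G \<longrightarrow> \<rho> g \<in> borel_measurable X \<and> (\<forall>s. 0 \<le> \<rho> g s \<and> \<rho> g s \<le> M g) \<and>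
      density X (\<lambda>s. ennreal (\<rho> g s)) = distr X X (act g)"
    using ex[OF X.measurable_action_axioms X(4)] by (rule exE)
  obtain \<eta> where eta: "\<forall>g. g \<in> carrier G \<longrightarrow> \<eta> g \<in> borel_measurable \<nu> \<and> (\<forall>s. 0 \<le> \<eta> g s \<and> \<eta> g s \<le> M g) \<and>
      density \<nu> (\<lambda>s. ennreal (\<eta> g s)) = distr \<nu> \<nu> (act g)"
    using ex[OF N.measurable_action_axioms nu(4)] by (rule exE)
  have mnu: "borel_measurable \<nu> = (borel_measurable X :: ('s \<Rightarrow> real) set)"
    using nu(1) X(1) by (intro measurable_cong_sets) simp_all
  interpret approximation G m M X act S E \<rho> M \<eta>
  proof
    show "countable (carrier G)" by fact
    show "sets S = sets X" "null_sets S = null_sets X" using X by simp_all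
    show "equivariant_cond_exp G (count_space (carrier G) \<Otimes>\<^sub>M S) (diag_act G S act) S act snd E" by fact
  qed (use rho eta mnu in \<open>simp_all add: \<nu>_def[symmetric]\<close>)
  obtain \<mu> r where mu: "\<forall>n. sets (\<mu> n) = Pow (carrier G \<times> UNIV) \<and> qi_space G (\<mu> n) (transl_act G) \<and> bqi_bound G M (\<mu> n) (transl_act G)"
    and r: "\<forall>g\<in>carrier G. \<forall>n y. 0 \<le> r g n y \<and> r g n y \<le> M g"
    and lim1: "\<forall>g\<in>carrier G. \<forall>A. (\<forall>n. A n \<subseteq> carrier G \<times> UNIV) \<longrightarrow>
      (\<lambda>n. measure (\<mu> n) (transl_act G g -` A n \<inter> space (\<mu> n)) - (\<integral>y. indicator (A n) y * r g n y \<partial>\<mu> n)) \<longlonglongrightarrow> 0"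
    and lim2: "\<forall>(J :: nat set) k a e. finite J \<longrightarrow> (\<forall>j. e j \<in> carrier G) \<longrightarrow>
      (\<lambda>n. \<integral>y. (\<Prod>j\<in>J. ramp k (a j) (r (e j) n y)) \<partial>\<mu> n) \<longlonglongrightarrow> (\<integral>s. (\<Prod>j\<in>J. ramp k (a j) (\<eta> (e j) s)) \<partial>\<nu>)"
    using approximating_sequence unfolding \<nu>_def by (elim exE conjE)
  have "\<exists>(Z :: (nat \<Rightarrow> real) measure) actZ p (W :: (nat \<Rightarrow> real) measure) actW q.
        RN_factor G \<nu> act Z actZ p \<and>
        RN_factor G (ultralimit \<U> \<mu>) (ultra_act \<U> \<mu> (\<lambda>n. transl_act G)) W actW q \<and>
        qi_isomorphic G Z actZ W actW" if U: "nonprincipal_ultrafilter \<U>" for \<U>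
  proof -
    interpret U: nat_ultrafilter \<U> by unfold_locales fact
    interpret A: ultra_action G \<U> \<mu> "\<lambda>n. transl_act G" r M
    proof (intro ultra_action.intro ultra_action_axioms.intro group_axioms U)
      show "measurable_action G (\<mu> i) (transl_act G)" for i
        using mu by (intro qi_space_measurable_action assms(1)) simp
      show "r g i \<in> borel_measurable (\<mu> i)" for g i
      proof -
        have "sets (\<mu> i) = sets (count_space (carrier G \<times> UNIV))" using mu by simp
        then have "borel_measurable (\<mu> i) = (borel_measurable (count_space (carrier G \<times> UNIV)) :: ('g \<times> nat \<Rightarrow> real) set)"
          by (rule measurable_cong_sets) simp
        then show ?thesis by simp
      qed
      show "0 \<le> r g i x \<and> r g i x \<le> M g" if "g \<in> carrier G" for g i x
        using bspec[OF r that(1), THEN spec, THEN spec, of i x] .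
      show "((\<lambda>i. measure (\<mu> i) (transl_act G g -` A i \<inter> space (\<mu> i)) - (\<integral>x. indicator (A i) x * r g i x \<partial>\<mu> i)) \<longlongrightarrow> 0) \<U>"
        if "g \<in> carrier G" "\<And>i. A i \<in> sets (\<mu> i)" for g A
        using lim1 that mu by (intro U.tendsto_ultra) auto
    qed
    show ?thesis
    proof (rule A.RN_factors_isomorphic[OF assms(2) nu(3)])
      show "((\<lambda>i. \<integral>x. (\<Prod>j\<in>J. ramp k (a j) (r (e j) i x)) \<partial>\<mu> i) \<longlongrightarrow>
        (\<integral>s. (\<Prod>j\<in>J. ramp k (a j) (\<eta> (e j) s)) \<partial>\<nu>)) \<U>"
        if "finite J" "\<And>n. e n \<in> carrier G" for J :: "nat set" and k a e
        using lim2 that by (intro U.tendsto_ultra) auto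
    qed (use eta in auto)
  qed
  moreover have "BQI G \<nu> act" using nu by (auto simp: BQI_def)
  moreover have "uniformly_BQI G \<mu> (\<lambda>n. transl_act G)" using mu by (auto simp: uniformly_BQI_def)
  ultimately show ?thesis
    using nu(1,2) mu by (intro exI[of _ \<nu>] exI[of _ \<mu>]) auto
qed

end
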